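(* Let $\Phi(z)=\sum_{n\ge0}z^{2^n}$, and let $\alpha$ be a positive integer. Then, for every positive integer $m$, the generating function $F_m(z)=1+\sum_{\lambda\ge1}f_\lambda^{(3)}(m)\,z^\lambda$, when reduced modulo $2^{3\cdot 2^\alpha}$, can be expressed as a polynomial in $\Phi(z)$ of degree at most $2^{\alpha+2}-1$, with coefficients that are Laurent polynomials in $z$ over the integers; that is, there exist $a_i(z)\in\mathbb Z[z,z^{-1}]$, $0\le i\le 2^{\alpha+2}-1$, such that $F_m(z)=\sum_{i=0}^{2^{\alpha+2}-1}a_i(z)\Phi^i(z)$ modulo $2^{3\cdot2^\alpha}$.
   Context: For a positive integer $m$, let $\Gamma_m(3)=\langle x,y\mid x^{2m}=y^{3m}=1,\ x^2=y^3\rangle = C_{2m}\underset{C_m}{\ast}C_{3m}$ (so $\Gamma_1(3)\cong PSL_2(\mathbb Z)$). The number $f_\lambda^{(3)}(m)$ is the number of free subgroups of index $6m\lambda$ in $\Gamma_m(3)$. For formal Laurent series with integer coefficients, "$f(z)=g(z)$ modulo $M$" means that coefficients of equal powers of $z$ agree modulo $M$. $\Phi^i(z)$ denotes $(\Phi(z))^i$. *)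

theory Defs
  imports "HOL-Algebra.Coset" "HOL-Computational_Algebra.Formal_Laurent_Series"
    "HOL-Number_Theory.Cong"
begin

text \<open>A letter (a, True) stands for a, and (a, False) for the inverse of a.\<close>

type_synonym 'a gword = "('a \<times> bool) list"

inductive pres_eq :: "('a gword \<times> 'a gword) set \<Rightarrow> 'a gword \<Rightarrow> 'a gword \<Rightarrow> bool"
  for R where
  pres_rel: "(u, v) \<in> R \<Longrightarrow> pres_eq R u v"
| pres_cancel: "pres_eq R [(a, s), (a, \<not> s)] []"
| pres_refl: "pres_eq R u u"
| pres_sym: "pres_eq R u v \<Longrightarrow> pres_eq R v u"
| pres_trans: "pres_eq R u v \<Longrightarrow> pres_eq R v w \<Longrightarrow> pres_eq R u w"
| pres_append: "pres_eq R u u' \<Longrightarrow> pres_eq R v v' \<Longrightarrow> pres_eq R (u @ v) (u' @ v')"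

text \<open>The group with all elements of the type 'a as generators, and a defining relation
  u = v for each pair (u, v) in R.\<close>

definition presented_group :: "('a gword \<times> 'a gword) set \<Rightarrow> 'a gword set monoid" where
  "presented_group R =
     \<lparr> carrier = UNIV // {(u, v). pres_eq R u v},
       monoid.mult = (\<lambda>A B. \<Union>u\<in>A. \<Union>v\<in>B. {w. pres_eq R (u @ v) w}),
       one = {w. pres_eq R [] w} \<rparr>"

definition word_val :: "('a, 'b) monoid_scheme \<Rightarrow> 'a gword \<Rightarrow> 'a" where
  "word_val G w =
     foldr (\<lambda>(a, s) g. (if s then a else inv\<^bsub>G\<^esub> a) \<otimes>\<^bsub>G\<^esub> g) w \<one>\<^bsub>G\<^esub>"

definition reduced_words :: "'a set \<Rightarrow> 'a gword set" where
  "reduced_words B =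
     {w. set w \<subseteq> B \<times> UNIV \<and> successively (\<lambda>(a, s) (b, t). a = b \<longrightarrow> s = t) w}"

text \<open>A group is free if it has a basis B: every element is the value of exactly one
  reduced word over B and its inverses. The trivial group is free on the empty basis.\<close>

definition free_group :: "('a, 'b) monoid_scheme \<Rightarrow> bool" where
  "free_group G \<longleftrightarrow>
     group G \<and>
     (\<exists>B \<subseteq> carrier G. bij_betw (word_val G) (reduced_words B) (carrier G))"

datatype gen = Gen_x | Gen_y

definition Gamma3 :: "nat \<Rightarrow> gen gword set monoid" where
  "Gamma3 m = presented_group
     {(replicate (2 * m) (Gen_x, True), []),
      (replicate (3 * m) (Gen_y, True), []),
      (replicate 2 (Gen_x, True), replicate 3 (Gen_y, True))}"

definition free_subgroup_number :: "nat \<Rightarrow> nat \<Rightarrow> nat" where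
  "free_subgroup_number m l =
     card {H. subgroup H (Gamma3 m) \<and> free_group (Gamma3 m \<lparr> carrier := H \<rparr>) \<and>
              card (rcosets\<^bsub>Gamma3 m\<^esub> H) = 6 * m * l}"

definition F_series :: "nat \<Rightarrow> int fps" where
  "F_series m = Abs_fps (\<lambda>l. if l = 0 then 1 else int (free_subgroup_number m l))"

definition Phi :: "int fps" where
  "Phi = Abs_fps (\<lambda>k. if \<exists>n. k = 2 ^ n then 1 else 0)"

definition laurent_polynomial :: "'a::zero fls \<Rightarrow> bool" where
  "laurent_polynomial a \<longleftrightarrow> finite {k. fls_nth a k \<noteq> 0}"

definition fls_cong :: "int fls \<Rightarrow> int fls \<Rightarrow> int \<Rightarrow> bool" where
  "fls_cong f g M \<longleftrightarrow> (\<forall>k. [fls_nth f k = fls_nth g k] (mod M))"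

lemma Phi_sums: "(\<lambda>n. fps_X ^ (2 ^ n)) sums Phi"
  unfolding sums_def tendsto_fps_iff
proof
  fix k
  have "fps_nth (\<Sum>i<n. fps_X ^ (2 ^ i)) k = fps_nth Phi k" if "n > k" for n
  proof (cases "\<exists>j. k = 2 ^ j")
    case True
    then obtain j where j: "k = 2 ^ j" by blast
    have "j < k" using j by simp
    with that have "j < n" by simp
    then show ?thesis using j
      by (simp add: Phi_def fps_sum_nth fps_X_power_nth)
  next
    case False
    then show ?thesis by (auto simp add: Phi_def fps_sum_nth fps_X_power_nth)
  qed
  then show "\<forall>\<^sub>F n in sequentially. fps_nth (\<Sum>i<n. fps_X ^ (2 ^ i)) k = fps_nth Phi k"
    unfolding eventually_sequentially by (metis Suc_le_lessD)
qed

lemma pres_class_eq_iff: "{w. pres_eq R u w} = {w. pres_eq R v w} \<longleftrightarrow> pres_eq R u v"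
  by (metis (mono_tags, lifting) Collect_cong mem_Collect_eq pres_refl pres_sym pres_trans)

lemma carrier_presented_group: "carrier (presented_group R) = range (\<lambda>u. {w. pres_eq R u w})"
  by (auto simp: presented_group_def quotient_def)

lemma one_presented_group: "\<one>\<^bsub>presented_group R\<^esub> = {w. pres_eq R [] w}"
  by (simp add: presented_group_def)

lemma mult_presented_group:
  "{w. pres_eq R u w} \<otimes>\<^bsub>presented_group R\<^esub> {w. pres_eq R v w} = {w. pres_eq R (u @ v) w}"
  by (auto simp: presented_group_def intro: pres_refl)
     (meson pres_append pres_trans)

lemma pres_eq_inverse: "\<exists>v. pres_eq R (v @ u) []"
proof (induction u)
  case Nil
  show ?case by (metis append_Nil pres_refl)
next
  case (Cons p u)
  obtain v where v: "pres_eq R (v @ u) []" using Cons by blast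
  obtain a s where p: "p = (a, s)" by force
  have "pres_eq R [(a, \<not> s), (a, s)] []" using pres_cancel[of R a "\<not> s"] by simp
  from pres_append[OF pres_append[OF pres_refl this] pres_refl, of v u]
  have "pres_eq R ((v @ [(a, \<not> s)]) @ p # u) (v @ u)" by (simp add: p)
  with v show ?case by (blast intro: pres_trans)
qed

lemma group_presented_group: "group (presented_group R)"
proof (rule groupI)
  fix A assume "A \<in> carrier (presented_group R)"
  then obtain u where u: "A = {w. pres_eq R u w}" by (auto simp: carrier_presented_group)
  obtain v where "pres_eq R (v @ u) []" using pres_eq_inverse by blast
  then have "{w. pres_eq R v w} \<otimes>\<^bsub>presented_group R\<^esub> A = \<one>\<^bsub>presented_group R\<^esub>"
    unfolding u mult_presented_group one_presented_group pres_class_eq_iff .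
  then show "\<exists>B\<in>carrier (presented_group R).
      B \<otimes>\<^bsub>presented_group R\<^esub> A = \<one>\<^bsub>presented_group R\<^esub>"
    by (auto simp: carrier_presented_group)
qed (auto simp: carrier_presented_group one_presented_group mult_presented_group)

end

theory Submission
  imports Defs "HOL-Combinatorics.Permutations"
begin

text \<open>
  A subgroup \<open>H\<close> of finite index is free iff \<open>x\<close> and \<open>y\<close> act on its cosets with all cycles of
  length \<open>2 m\<close> and \<open>3 m\<close>: torsion-freeness gives one direction, and a spanning tree of the coset
  graph yields a basis for the other. Counting pairs of such permutations, a second-order
  linear recurrence results for all pairs, and passing to transitive pairs turns it into the
  Riccati equation \<open>G = z (6 m z G' + G\<^sup>2 + 6 m G + 5 m\<^sup>2)\<close> for \<open>G = F - 1\<close>.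

  Hence \<open>U = z G\<close> is a fixed point of \<open>V \<mapsto> V\<^sup>2 + 5 m\<^sup>2 z\<^sup>2 + 6 m z\<^sup>2 V'\<close>, which is a 2-adic
  contraction. Since \<open>z \<Phi>'\<close> is a polynomial modulo any power of 2, iterating from
  \<open>m (\<Phi> - z)\<close>, which is \<open>U\<close> modulo 2, shows that \<open>U\<close> is a polynomial in \<open>\<Phi>\<close> modulo any power
  of 2. The degree is reduced with the \<open>2\<^sup>\<alpha>\<close>-th power of a monic quartic in \<open>\<Phi>\<close> that vanishes
  modulo 8.
\<close>

section \<open>Polynomials in \<open>\<Phi>\<close> modulo powers of 2\<close>

text \<open>The bounds come from a single relation. Modulo 2, \<open>Phi\<close> is a root of a
  monic quadratic; squaring that would give a quartic vanishing modulo 4, but the quartic used here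
  vanishes modulo 8. Its power with exponent \<open>2 ^ \<alpha>\<close> has degree
  \<open>2 ^ (\<alpha> + 2)\<close> and vanishes modulo \<open>8 ^ 2 ^ \<alpha>\<close>, which is
  the stated modulus. Negative powers of z enter only when \<open>U = z G\<close> is undone. On the
  group side, \<open>x^2 = y^3\<close> makes each \<open>x\<close>-cycle behave like one edge
  between the \<open>y\<close>-cycles of \<open>s\<close> and \<open>X s\<close>. A free subgroup is
  the fundamental group of the graph whose vertices are the \<open>y\<close>-cycles and whose edges
  are the \<open>x\<close>-cycles. The count of pairs is a product because the number of
  \<open>X\<close> with \<open>X^2 = Y^3\<close> is the same for every admissible \<open>Y\<close>.
  Its consecutive quotients are rational in the index, and this is the source of the linear
  recurrence.\<close>

lemma of_int_dvd_fps_iff: "of_int M dvd (f :: int fps) \<longleftrightarrow> (\<forall>n. M dvd fps_nth f n)"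
proof
  assume "of_int M dvd f"
  then obtain g where "f = of_int M * g" by (elim dvdE)
  then show "\<forall>n. M dvd fps_nth f n" by (simp add: fps_of_int[symmetric])
next
  assume *: "\<forall>n. M dvd fps_nth f n"
  have "f = of_int M * Abs_fps (\<lambda>n. fps_nth f n div M)"
    by (rule fps_ext) (use * in \<open>simp add: fps_of_int[symmetric]\<close>)
  then show "of_int M dvd f" by (metis dvd_triv_left)
qed

lemma two_power_dvd_fps_iff: "2 ^ k dvd (f :: int fps) \<longleftrightarrow> (\<forall>n. 2 ^ k dvd fps_nth f n)"
  using of_int_dvd_fps_iff[of "2 ^ k" f] by simp

lemma two_dvd_fps_iff: "2 dvd (f :: int fps) \<longleftrightarrow> (\<forall>n. even (fps_nth f n))"
  using two_power_dvd_fps_iff[of 1 f] by simp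

section \<open>Squaring modulo 2 as the substitution z -> z^2\<close>

definition fps_dilate2 :: "int fps \<Rightarrow> int fps" where
  "fps_dilate2 f = Abs_fps (\<lambda>n. if even n then fps_nth f (n div 2) else 0)"

text \<open>Reflection of the index pairs off all terms except a middle one, which exists only for
  even \<open>n\<close>. Applied to the coefficients of a square, this is the Frobenius congruence
  f(z)^2 = f(z^2) modulo 2.\<close>

lemma sum_reflect_half:
  fixes h :: "nat \<Rightarrow> int"
  assumes "\<And>i. i \<le> n \<Longrightarrow> h (n - i) = h i"
  shows "even ((\<Sum>i\<le>n. h i) - (if even n then h (n div 2) else 0))"
proof -
  define L where "L = {i. 2 * i < n}"
  define R where "R = {i. i \<le> n \<and> 2 * i > n}"
  define C where "C = {i. 2 * i = n}"
  have fin: "finite L" "finite R" "finite C"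
    by (rule finite_subset[of _ "{..n}"]; auto simp: L_def R_def C_def)+
  have "{..n} = L \<union> R \<union> C" by (auto simp: L_def R_def C_def)
  then have "sum h {..n} = sum h L + sum h R + sum h C"
    using fin by (simp, subst sum.union_disjoint; (simp, subst sum.union_disjoint)?)
      (auto simp: L_def R_def C_def)
  moreover have "sum h R = sum h L"
    by (rule sum.reindex_bij_witness[of _ "\<lambda>i. n - i" "\<lambda>i. n - i"])
      (use assms in \<open>auto simp: L_def R_def\<close>)
  moreover have "C = (if even n then {n div 2} else {})" by (auto simp: C_def)
  ultimately show ?thesis by auto
qed

lemma square_cong_dilate2: "2 dvd f\<^sup>2 - fps_dilate2 f"
  unfolding two_dvd_fps_iff
proof
  fix n
  have "even ((\<Sum>i\<le>n. fps_nth f i * fps_nth f (n - i)) -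
      (if even n then fps_nth f (n div 2) * fps_nth f (n - n div 2) else 0))"
    by (rule sum_reflect_half) (simp add: mult.commute)
  moreover have "n - n div 2 = n div 2" if "even n" using that by auto
  ultimately show "even (fps_nth (f\<^sup>2 - fps_dilate2 f) n)"
    by (auto simp: fps_square_nth fps_dilate2_def)
qed

lemma fps_dilate2_simps:
  "fps_dilate2 (f + g) = fps_dilate2 f + fps_dilate2 g"
  "fps_dilate2 (f - g) = fps_dilate2 f - fps_dilate2 g"
  "fps_dilate2 fps_X = fps_X\<^sup>2"
  by (auto simp: fps_dilate2_def fps_eq_iff fps_X_power_nth)

lemma fps_dilate2_mult: "fps_dilate2 (f * g) = fps_dilate2 f * fps_dilate2 g"
proof (rule fps_ext)
  fix n
  have "fps_nth (fps_dilate2 f * fps_dilate2 g) n =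
    (\<Sum>i\<in>{i. i \<le> n \<and> even i}. fps_nth f (i div 2) * fps_nth (fps_dilate2 g) (n - i))"
    unfolding fps_mult_nth
    by (rule sum.mono_neutral_cong_right) (auto simp: fps_dilate2_def)
  also have "\<dots> = fps_nth (fps_dilate2 (f * g)) n"
  proof (cases "even n")
    case True
    have "(\<Sum>i\<in>{i. i \<le> n \<and> even i}. fps_nth f (i div 2) * fps_nth (fps_dilate2 g) (n - i)) =
      (\<Sum>i=0..n div 2. fps_nth f i * fps_nth g (n div 2 - i))"
      by (rule sum.reindex_bij_witness[of _ "\<lambda>i. 2 * i" "\<lambda>i. i div 2"])
        (use True in \<open>auto simp: fps_dilate2_def diff_mult_distrib2[symmetric] elim!: evenE\<close>)
    then show ?thesis using True by (simp add: fps_dilate2_def fps_mult_nth)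
  qed (auto simp: fps_dilate2_def intro!: sum.neutral)
  finally show "fps_nth (fps_dilate2 (f * g)) n = fps_nth (fps_dilate2 f * fps_dilate2 g) n" ..
qed

lemma fps_dilate2_Phi: "fps_dilate2 Phi = Phi - fps_X"
proof (rule fps_ext)
  fix n :: nat
  have *: "(\<exists>k. n = 2 ^ k) \<longleftrightarrow> n = 1 \<or> even n \<and> (\<exists>k. n div 2 = 2 ^ k)"
  proof
    assume "\<exists>k. n = 2 ^ k"
    then obtain k where "n = 2 ^ k" by blast
    then show "n = 1 \<or> even n \<and> (\<exists>k. n div 2 = 2 ^ k)" by (cases k) auto
  next
    assume "n = 1 \<or> even n \<and> (\<exists>k. n div 2 = 2 ^ k)"
    then show "\<exists>k. n = 2 ^ k"
    proof (elim disjE conjE exE)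
      fix k assume "even n" "n div 2 = 2 ^ k"
      then have "n = 2 ^ Suc k" by auto
      then show ?thesis ..
    next
      assume "n = 1"
      then have "n = 2 ^ 0" by simp
      then show ?thesis ..
    qed
  qed
  show "fps_nth (fps_dilate2 Phi) n = fps_nth (Phi - fps_X) n"
    using * by (auto simp: fps_dilate2_def Phi_def fps_X_def)
qed

text \<open>Substituting z^2 moves the exponent 2^n to 2^(n+1), so only the first term z of
  \<open>Phi\<close> is lost.\<close>

lemma Phi_square_mod_2: "2 dvd Phi\<^sup>2 - (Phi - fps_X)"
  using square_cong_dilate2[of Phi] by (simp add: fps_dilate2_Phi)

text \<open>With \<open>q = (\<Phi>\<^sup>2 - \<Phi> + z) / 2\<close> one has \<open>q(z\<^sup>2) = q - z (\<Phi> - z)\<close>,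
  so \<open>q\<^sup>2\<close> is known modulo 2; squaring \<open>\<Phi>\<^sup>2 = \<Phi> - z + 2 q\<close> gives \<open>\<Phi>\<^sup>4\<close> modulo 8.\<close>

lemma Phi_quartic_mod_8:
  "8 dvd Phi ^ 4 - 2 * Phi ^ 3 - (1 - 2 * fps_X) * Phi\<^sup>2 + (2 + 2 * fps_X) * Phi
     - 2 * fps_X - 3 * fps_X\<^sup>2"
proof -
  obtain q where q: "Phi\<^sup>2 - (Phi - fps_X) = 2 * q" using Phi_square_mod_2 by (elim dvdE)
  have two: "fps_dilate2 (2 * q) = 2 * fps_dilate2 q"
    by (simp only: mult_2 fps_dilate2_simps)
  have "fps_dilate2 (2 * q) = (Phi - fps_X)\<^sup>2 - ((Phi - fps_X) - fps_X\<^sup>2)"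
    unfolding q[symmetric]
    by (simp add: fps_dilate2_simps power2_eq_square fps_dilate2_mult fps_dilate2_Phi)
  also have "\<dots> = 2 * q - 2 * fps_X * (Phi - fps_X)"
    unfolding q[symmetric] by algebra
  finally have "2 * fps_dilate2 q = 2 * (q - fps_X * (Phi - fps_X))"
    using two by (simp add: algebra_simps)
  moreover have "(2 :: int fps) \<noteq> 0"
    by (auto simp: fps_eq_iff numeral_fps_const intro!: exI[of _ 0])
  ultimately have "fps_dilate2 q = q - fps_X * (Phi - fps_X)" by (metis mult_left_cancel)
  with square_cong_dilate2[of q] have "2 dvd q\<^sup>2 - (q - fps_X * (Phi - fps_X))" by simp
  then obtain r where r: "q\<^sup>2 - (q - fps_X * (Phi - fps_X)) = 2 * r" by (elim dvdE)
  have "Phi ^ 4 - 2 * Phi ^ 3 - (1 - 2 * fps_X) * Phi\<^sup>2 + (2 + 2 * fps_X) * Phi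
     - 2 * fps_X - 3 * fps_X\<^sup>2 = 8 * r"
    using q r by algebra
  then show ?thesis by simp
qed

section \<open>Series that are polynomials in \<open>Phi\<close> modulo \<open>2 ^ N\<close>, a ring
  closed under z d/dz\<close>

lemma fps_XD_mult: "fps_XD (f * g) = fps_XD f * g + f * fps_XD (g :: 'a::comm_ring_1 fps)"
  by (simp add: fps_XD_def algebra_simps)

lemma fps_XD_diff: "fps_XD (f - g) = fps_XD f - fps_XD (g :: 'a::comm_ring_1 fps)"
  by (simp add: fps_XD_def algebra_simps)

lemma fps_XD_of_int_mult: "fps_XD (of_int c * f) = of_int c * fps_XD (f :: 'a::comm_ring_1 fps)"
  by (simp add: fps_of_int[symmetric])

text \<open>In the nested polynomials the outer variable stands for \<open>Phi\<close> and the inner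
  one for z. This keeps the degree in \<open>Phi\<close> available for division.\<close>

definition eval_Phi :: "int poly poly \<Rightarrow> int fps" where
  "eval_Phi p = poly (map_poly fps_of_poly p) Phi"

lemma eval_Phi_pCons [simp]: "eval_Phi (pCons a p) = fps_of_poly a + Phi * eval_Phi p"
  by (simp add: eval_Phi_def map_poly_pCons)

lemma eval_Phi_0 [simp]: "eval_Phi 0 = 0"
  by (simp add: eval_Phi_def)

lemma eval_Phi_1 [simp]: "eval_Phi 1 = 1"
  by (simp add: one_pCons)

lemma eval_Phi_add: "eval_Phi (p + q) = eval_Phi p + eval_Phi q"
  by (induction p q rule: poly_induct2) (simp_all add: fps_of_poly_add algebra_simps)

lemma eval_Phi_smult: "eval_Phi (smult a p) = fps_of_poly a * eval_Phi p"
  by (induction p) (simp_all add: fps_of_poly_mult algebra_simps)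

lemma eval_Phi_mult: "eval_Phi (p * q) = eval_Phi p * eval_Phi q"
  by (induction p) (simp_all add: eval_Phi_add eval_Phi_smult algebra_simps)

lemma eval_Phi_power: "eval_Phi (p ^ n) = eval_Phi p ^ n"
  by (induction n) (simp_all add: eval_Phi_mult)

lemma eval_Phi_altdef: "degree p \<le> n \<Longrightarrow> eval_Phi p = (\<Sum>i\<le>n. fps_of_poly (coeff p i) * Phi ^ i)"
proof (induction p arbitrary: n)
  case (pCons a p)
  show ?case
  proof (cases n)
    case 0
    with pCons show ?thesis by (auto split: if_splits)
  next
    case (Suc k)
    with pCons have "degree p \<le> k" by (auto split: if_splits)
    with pCons have "eval_Phi p = (\<Sum>i\<le>k. fps_of_poly (coeff p i) * Phi ^ i)" by blast
    then show ?thesis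
      by (simp add: Suc sum.atMost_Suc_shift sum_distrib_left mult_ac del: sum.atMost_Suc)
  qed
qed simp

text \<open>The degree in \<open>Phi\<close> is left free, so that products and derivatives stay in
  the class; it is brought down once, at the end.\<close>

definition Phi_poly_mod :: "nat \<Rightarrow> int fps \<Rightarrow> bool" where
  "Phi_poly_mod N f \<longleftrightarrow> (\<exists>p. 2 ^ N dvd f - eval_Phi p)"

lemma Phi_poly_mod_poly: "Phi_poly_mod N (fps_of_poly a)"
proof -
  have "fps_of_poly a = eval_Phi [:a:]" by simp
  then show ?thesis unfolding Phi_poly_mod_def by (metis diff_self dvd_0_right)
qed

lemma Phi_poly_mod_Phi: "Phi_poly_mod N Phi"
proof -
  have "Phi = eval_Phi [:0, 1:]" by simp
  then show ?thesis unfolding Phi_poly_mod_def by (metis diff_self dvd_0_right)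
qed

lemma Phi_poly_mod_add: "Phi_poly_mod N f \<Longrightarrow> Phi_poly_mod N g \<Longrightarrow> Phi_poly_mod N (f + g)"
  unfolding Phi_poly_mod_def
proof (elim exE)
  fix p q assume "2 ^ N dvd f - eval_Phi p" "2 ^ N dvd g - eval_Phi q"
  then have "2 ^ N dvd (f - eval_Phi p) + (g - eval_Phi q)" by (rule dvd_add)
  then show "\<exists>p. 2 ^ N dvd f + g - eval_Phi p"
    by (intro exI[of _ "p + q"]) (simp add: eval_Phi_add algebra_simps)
qed

lemma Phi_poly_mod_mult: "Phi_poly_mod N f \<Longrightarrow> Phi_poly_mod N g \<Longrightarrow> Phi_poly_mod N (f * g)"
  unfolding Phi_poly_mod_def
proof (elim exE)
  fix p q assume "2 ^ N dvd f - eval_Phi p" "2 ^ N dvd g - eval_Phi q"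
  then have "2 ^ N dvd (f - eval_Phi p) * g + eval_Phi p * (g - eval_Phi q)" by simp
  then show "\<exists>p. 2 ^ N dvd f * g - eval_Phi p"
    by (intro exI[of _ "p * q"]) (simp add: eval_Phi_mult algebra_simps)
qed

lemma Phi_poly_mod_cong: "Phi_poly_mod N g \<Longrightarrow> 2 ^ N dvd f - g \<Longrightarrow> Phi_poly_mod N f"
  unfolding Phi_poly_mod_def
proof (elim exE)
  fix p assume "2 ^ N dvd g - eval_Phi p" "2 ^ N dvd f - g"
  then have "2 ^ N dvd (g - eval_Phi p) + (f - g)" by (rule dvd_add)
  then show "\<exists>p. 2 ^ N dvd f - eval_Phi p" by (intro exI[of _ p]) simp
qed

lemma Phi_poly_mod_X: "Phi_poly_mod N fps_X"
  using Phi_poly_mod_poly[of N "[:0, 1:]"] by (simp add: fps_of_poly_pCons)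

lemma Phi_poly_mod_of_int: "Phi_poly_mod N (of_int c)"
  using Phi_poly_mod_poly[of N "[:c:]"] by (simp add: fps_of_poly_const fps_of_int[symmetric])

text \<open>Only finitely many terms of \<open>z \<Phi>' = \<Sum> 2\<^sup>n z\<^bsup>2\<^sup>n\<^esup>\<close> survive modulo a power of 2.\<close>

lemma Phi_poly_mod_XD_Phi: "Phi_poly_mod N (fps_XD Phi)"
proof (rule Phi_poly_mod_cong)
  define a :: "int poly" where "a = (\<Sum>n<N. monom (2 ^ n) (2 ^ n))"
  show "Phi_poly_mod N (fps_of_poly a)" by (rule Phi_poly_mod_poly)
  show "2 ^ N dvd fps_XD Phi - fps_of_poly a"
    unfolding two_power_dvd_fps_iff
  proof
    fix k
    have a: "coeff a k = (\<Sum>n<N. if k = 2 ^ n then 2 ^ n else 0)"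
      unfolding a_def coeff_sum by (rule sum.cong) auto
    show "2 ^ N dvd fps_nth (fps_XD Phi - fps_of_poly a) k"
    proof (cases "\<exists>n. k = 2 ^ n")
      case True
      then obtain j where j: "k = 2 ^ j" by blast
      then have "coeff a k = (\<Sum>n<N. if j = n then 2 ^ n else 0)" unfolding a by simp
      also have "\<dots> = (if j < N then 2 ^ j else 0)" by (simp add: sum.delta)
      finally show ?thesis using j by (auto simp: Phi_def intro: le_imp_power_dvd)
    next
      case False
      then show ?thesis by (auto simp: Phi_def a)
    qed
  qed
qed

text \<open>The product rule reduces everything to \<open>fps_XD Phi\<close>. The operator
  multiplies each coefficient by an integer, so it respects congruences.\<close>

lemma Phi_poly_mod_XD: "Phi_poly_mod N f \<Longrightarrow> Phi_poly_mod N (fps_XD f)"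
proof -
  have poly: "Phi_poly_mod N (fps_XD (eval_Phi p))" for p
  proof (induction p)
    case 0
    then show ?case using Phi_poly_mod_of_int[of N 0] by (simp add: fps_XD_def)
  next
    case (pCons a p)
    have "fps_XD (eval_Phi (pCons a p)) =
      fps_of_poly ([:0, 1:] * pderiv a) + (fps_XD Phi * eval_Phi p + Phi * fps_XD (eval_Phi p))"
      by (simp add: fps_XD_mult fps_XD_def fps_of_poly_mult fps_of_poly_pderiv fps_of_poly_pCons
          algebra_simps)
    moreover have "Phi_poly_mod N (eval_Phi p)" unfolding Phi_poly_mod_def by (metis diff_self dvd_0_right)
    ultimately show ?case
      using pCons by (simp add: Phi_poly_mod_add Phi_poly_mod_mult Phi_poly_mod_Phi
          Phi_poly_mod_poly Phi_poly_mod_XD_Phi del: eval_Phi_pCons)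
  qed
  assume "Phi_poly_mod N f"
  then obtain p where "2 ^ N dvd f - eval_Phi p" unfolding Phi_poly_mod_def by blast
  then have "2 ^ N dvd fps_XD f - fps_XD (eval_Phi p)"
    unfolding fps_XD_diff[symmetric] two_power_dvd_fps_iff by simp
  with poly show ?thesis using Phi_poly_mod_cong by blast
qed

text \<open>The coefficients are themselves polynomials in z and do not form a field;
  pseudo-division is genuine division here because the leading coefficient is 1.\<close>

lemma monic_poly_reduce:
  fixes p Q :: "'a::idom poly"
  assumes "lead_coeff Q = 1"
  shows "\<exists>s r. p = Q * s + r \<and> (r = 0 \<or> degree r < degree Q)"
proof -
  have Q: "Q \<noteq> 0" using assms by auto
  obtain s r where "pseudo_divmod p Q = (s, r)" by force
  from pseudo_divmod[OF Q this] assms show ?thesis by auto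
qed

text \<open>The factor \<open>1 - E\<close> has constant term 1 and is therefore a unit, so it can
  be cancelled modulo 2.\<close>

lemma fps_odd_unit_cancel:
  fixes D E :: "int fps"
  assumes "2 dvd D - D * E" and "fps_nth E 0 = 0"
  shows "2 dvd D"
  unfolding two_dvd_fps_iff
proof
  fix n
  show "even (fps_nth D n)"
  proof (induction n rule: less_induct)
    case (less n)
    have "even (fps_nth (D * E) n)"
      unfolding fps_mult_nth
    proof (rule dvd_sum)
      fix i assume "i \<in> {0..n}"
      then show "even (fps_nth D i * fps_nth E (n - i))"
        using less assms(2) by (cases "i = n") auto
    qed
    moreover have "even (fps_nth D n - fps_nth (D * E) n)"
      using assms(1) unfolding two_dvd_fps_iff by simp
    ultimately show ?case by simp
  qed
qed

section \<open>2-adic iteration for the Riccati equation\<close>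

lemma Phi_poly_mod_riccati:
  fixes U :: "int fps" and m :: int
  assumes U: "U = U\<^sup>2 + of_int (5 * m\<^sup>2) * fps_X\<^sup>2 + of_int (6 * m) * (fps_X * fps_XD U)"
    and U0: "fps_nth U 0 = 0"
  shows "Phi_poly_mod N U"
proof -
  define T where "T V = V\<^sup>2 + of_int (5 * m\<^sup>2) * fps_X\<^sup>2 + of_int (6 * m) * (fps_X * fps_XD V)" for V :: "int fps"
  have "\<exists>V. (\<forall>n. Phi_poly_mod n V) \<and> 2 ^ Suc k dvd U - V" for k
  proof (induction k)
    case 0
    \<comment> \<open>Modulo 2 the equation reads U = U^2 + m z^2, since m^2 = m there. By Phi^2 =
      Phi - z this \<open>V\<close> satisfies V - V^2 = m z^2, so it is a solution modulo 2.\<close>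
    define V where "V = of_int m * (Phi - fps_X)"
    obtain w where w: "Phi\<^sup>2 - (Phi - fps_X) = 2 * w" using Phi_square_mod_2 by (elim dvdE)
    have "even (m\<^sup>2 - m)" by simp
    then obtain c where c: "m\<^sup>2 - m = 2 * c" by (elim dvdE)
    then have "of_int (m\<^sup>2 - m) = (of_int (2 * c) :: int fps)" by simp
    then have c': "(of_int m)\<^sup>2 - of_int m = (2 * of_int c :: int fps)" by simp
    \<comment> \<open>Uniqueness modulo 2: the difference of two solutions, times
      \<open>1 - (U + V)\<close>, is even.\<close>
    have "(U - V) - (U - V) * (U + V) = (U - U\<^sup>2) - (V - V\<^sup>2)" by algebra
    also have "U - U\<^sup>2 = 5 * (of_int m)\<^sup>2 * fps_X\<^sup>2 + 6 * of_int m * (fps_X * fps_XD U)"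
      by (subst U) simp
    also have "\<dots> - (V - V\<^sup>2) = 2 * (of_int c * (Phi - fps_X) + 3 * (of_int m)\<^sup>2 * fps_X\<^sup>2
        + 3 * of_int m * (fps_X * fps_XD U) + (of_int m)\<^sup>2 * (w - fps_X * Phi))"
      unfolding V_def using w c' by algebra
    finally have "2 dvd (U - V) - (U - V) * (U + V)" by (simp only: dvd_triv_left)
    moreover have "fps_nth (U + V) 0 = 0"
      using U0 by (simp add: V_def Phi_def fps_of_int[symmetric])
    ultimately have "2 dvd U - V" by (rule fps_odd_unit_cancel)
    moreover have "Phi_poly_mod n V" for n
    proof -
      have "V = of_int m * (Phi + of_int (- 1) * fps_X)" by (simp add: V_def)
      then show ?thesis
        by (simp only:) (intro Phi_poly_mod_add Phi_poly_mod_mult Phi_poly_mod_of_int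
            Phi_poly_mod_X Phi_poly_mod_Phi)
    qed
    ultimately show ?case by auto
  next
    case (Suc k)
    then obtain V where V: "\<And>n. Phi_poly_mod n V" "2 ^ Suc k dvd U - V" by blast
    then obtain W where W: "U - V = 2 ^ Suc k * W" by (elim dvdE)
    have U_eq: "U = V + 2 ^ Suc k * W" using W by (simp add: algebra_simps)
    have XD: "fps_XD U = fps_XD V + 2 ^ Suc k * fps_XD W"
      unfolding U_eq using fps_XD_of_int_mult[of "2 ^ Suc k" W] by simp
    have "U = T U" unfolding T_def by (rule U)
    then have "U - T V = T U - T V" by (rule arg_cong)
    \<comment> \<open>Each application of \<open>T\<close> gains one factor 2: the difference of
      squares supplies \<open>2 * V + 2 ^ Suc k * W\<close>, and the derivative term carries the
      even factor \<open>6 * m\<close>.\<close>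
    also have "\<dots> = 2 ^ Suc k * W * (2 * V + 2 ^ Suc k * W) +
        of_int (6 * m) * (fps_X * (2 ^ Suc k * fps_XD W))"
      unfolding T_def XD by (simp add: U_eq power2_eq_square algebra_simps)
    also have "\<dots> = 2 ^ Suc (Suc k) * (W * (V + 2 ^ k * W) + of_int (3 * m) * (fps_X * fps_XD W))"
      by (simp add: algebra_simps)
    finally have "2 ^ Suc (Suc k) dvd U - T V" by (simp only: dvd_triv_left)
    moreover have "Phi_poly_mod n (T V)" for n
      unfolding T_def power2_eq_square
      by (intro Phi_poly_mod_add Phi_poly_mod_mult Phi_poly_mod_of_int Phi_poly_mod_X
          Phi_poly_mod_XD V)
    ultimately show ?case by blast
  qed
  from this[of N] obtain V where "Phi_poly_mod N V" "2 ^ Suc N dvd U - V" by blast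
  moreover have "(2 :: int fps) ^ N dvd 2 ^ Suc N" by simp
  ultimately show ?thesis using Phi_poly_mod_cong dvd_trans by blast
qed

section \<open>Lowering the degree and returning to Laurent series\<close>

definition Phi_quartic :: "int poly poly" where
  "Phi_quartic = [:[:0, -2, -3:], [:2, 2:], [:-1, 2:], [:-2:], [:1:]:]"

lemma eight_dvd_eval_Phi_quartic: "8 dvd eval_Phi Phi_quartic"
proof -
  have "eval_Phi Phi_quartic = Phi ^ 4 - 2 * Phi ^ 3 - (1 - 2 * fps_X) * Phi\<^sup>2
     + (2 + 2 * fps_X) * Phi - 2 * fps_X - 3 * fps_X\<^sup>2"
    by (simp add: Phi_quartic_def fps_of_poly_pCons numeral_fps_const[symmetric]
        fps_const_neg[symmetric] power2_eq_square power3_eq_cube power4_eq_xxxx algebra_simps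
        del: fps_const_neg)
  then show ?thesis using Phi_quartic_mod_8 by simp
qed

lemma Phi_poly_mod_reduce:
  assumes "Phi_poly_mod (3 * 2 ^ \<alpha>) f"
  shows "\<exists>r. degree r \<le> 2 ^ (\<alpha> + 2) - 1 \<and> 2 ^ (3 * 2 ^ \<alpha>) dvd f - eval_Phi r"
proof -
  let ?Q = "Phi_quartic ^ 2 ^ \<alpha>"
  obtain p where p: "2 ^ (3 * 2 ^ \<alpha>) dvd f - eval_Phi p"
    using assms unfolding Phi_poly_mod_def by blast
  have "lead_coeff Phi_quartic = 1" "degree Phi_quartic = 4"
    by (simp_all add: Phi_quartic_def one_pCons)
  moreover from this have "Phi_quartic \<noteq> 0" by auto
  ultimately have Q: "lead_coeff ?Q = 1" "degree ?Q = 2 ^ (\<alpha> + 2)"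
    by (simp_all only: lead_coeff_power power_one) (simp add: degree_power_eq power_add)
  obtain s r where sr: "p = ?Q * s + r" "r = 0 \<or> degree r < degree ?Q"
    using monic_poly_reduce[OF Q(1)] by blast
  have "8 ^ 2 ^ \<alpha> dvd eval_Phi ?Q"
    unfolding eval_Phi_power by (rule dvd_power_same) (rule eight_dvd_eval_Phi_quartic)
  moreover have "(8 :: int fps) ^ 2 ^ \<alpha> = 2 ^ (3 * 2 ^ \<alpha>)" by (simp add: power_mult)
  ultimately have "2 ^ (3 * 2 ^ \<alpha>) dvd eval_Phi ?Q * eval_Phi s" by simp
  with p have "2 ^ (3 * 2 ^ \<alpha>) dvd (f - eval_Phi p) + eval_Phi ?Q * eval_Phi s" by (rule dvd_add)
  then have "2 ^ (3 * 2 ^ \<alpha>) dvd f - eval_Phi r"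
    by (simp add: sr eval_Phi_add eval_Phi_mult)
  moreover have "degree r \<le> 2 ^ (\<alpha> + 2) - 1" using sr(2) Q(2) by auto
  ultimately show ?thesis by blast
qed

lemma fps_to_fls_sum: "fps_to_fls (sum f A) = (\<Sum>i\<in>A. fps_to_fls (f i :: int fps))"
  by (induction A rule: infinite_finite_induct) auto

lemma laurent_polynomial_shift_poly:
  "laurent_polynomial (fls_X_inv * fps_to_fls (fps_of_poly (p :: int poly)) + of_int c)"
proof -
  have "fls_nth (fls_X_inv * fps_to_fls (fps_of_poly p) + of_int c) k = 0"
    if "k \<notin> {-1..int (degree p)}" for k
    using that by (auto simp: fls_X_inv_times_conv_shift fls_of_int coeff_eq_0)
  then have "{k. fls_nth (fls_X_inv * fps_to_fls (fps_of_poly p) + of_int c) k \<noteq> 0}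
      \<subseteq> {-1..int (degree p)}"
    by blast
  then show ?thesis unfolding laurent_polynomial_def using finite_subset by blast
qed

theorem riccati_Phi_representation:
  fixes G :: "int fps" and m :: int
  assumes G: "G = fps_X * (of_int (6 * m) * fps_XD G + G\<^sup>2 + of_int (6 * m) * G + of_int (5 * m\<^sup>2))"
  shows "\<exists>a :: nat \<Rightarrow> int fls.
    (\<forall>i \<le> 2 ^ (\<alpha> + 2) - 1. laurent_polynomial (a i)) \<and>
    fls_cong (fps_to_fls (1 + G))
      (\<Sum>i = 0..2 ^ (\<alpha> + 2) - 1. a i * fps_to_fls Phi ^ i)
      (2 ^ (3 * 2 ^ \<alpha>))"
proof -
  \<comment> \<open>Multiplication by z merges the terms in \<open>fps_XD G\<close> and in
    \<open>G\<close> into the single term \<open>fps_XD U\<close>.\<close>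
  define U where "U = fps_X * G"
  have XD: "fps_XD U = U + fps_X * fps_XD G"
    unfolding U_def fps_XD_mult by (simp add: fps_XD_def)
  have "U = U\<^sup>2 + of_int (5 * m\<^sup>2) * fps_X\<^sup>2 + of_int (6 * m) * (fps_X * fps_XD U)"
    unfolding XD unfolding U_def using G by algebra
  then have "Phi_poly_mod (3 * 2 ^ \<alpha>) U"
    by (rule Phi_poly_mod_riccati) (simp add: U_def)
  from Phi_poly_mod_reduce[OF this] obtain r where
    r: "degree r \<le> 2 ^ (\<alpha> + 2) - 1" "2 ^ (3 * 2 ^ \<alpha>) dvd U - eval_Phi r" by blast
  \<comment> \<open>\<open>fls_X_inv\<close> undoes the multiplication by z, and the extra 1 at
    \<open>i = 0\<close> is the constant term of \<open>1 + G\<close>.\<close>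
  define a where "a i = fls_X_inv * fps_to_fls (fps_of_poly (coeff r i)) + of_int (if i = 0 then 1 else 0)"
    for i
  have "(\<Sum>i\<le>2 ^ (\<alpha> + 2) - 1. a i * fps_to_fls Phi ^ i) =
    (\<Sum>i\<le>2 ^ (\<alpha> + 2) - 1. fls_X_inv * fps_to_fls (fps_of_poly (coeff r i) * Phi ^ i)
       + (if i = 0 then 1 else 0))"
    by (rule sum.cong) (auto simp: a_def algebra_simps fls_times_fps_to_fls fps_to_fls_power)
  also have "\<dots> = fls_X_inv * fps_to_fls (eval_Phi r) + 1"
    unfolding eval_Phi_altdef[OF r(1)] sum.distrib sum_distrib_left[symmetric] fps_to_fls_sum
    by (simp add: sum.delta)
  finally have sum: "(\<Sum>i = 0..2 ^ (\<alpha> + 2) - 1. a i * fps_to_fls Phi ^ i) =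
      fls_X_inv * fps_to_fls (eval_Phi r) + 1"
    by (simp add: atMost_atLeast0)
  have "fls_X_inv * fps_to_fls U = fps_to_fls G"
    unfolding U_def by (rule fls_eqI) (auto simp: fls_X_inv_times_conv_shift nat_add_distrib)
  then have "fps_to_fls (1 + G) = fls_X_inv * fps_to_fls U + 1" by simp
  then have "fls_cong (fps_to_fls (1 + G)) (fls_X_inv * fps_to_fls (eval_Phi r) + 1) (2 ^ (3 * 2 ^ \<alpha>))"
    using r(2) unfolding two_power_dvd_fps_iff fls_cong_def cong_iff_dvd_diff
    by (auto simp: fls_X_inv_times_conv_shift)
  then show ?thesis
    using laurent_polynomial_shift_poly sum by (intro exI[of _ a]) (simp add: a_def)
qed

section \<open>Free groups are torsion-free\<close>

definition reduced :: "'a gword \<Rightarrow> bool" where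
  "reduced w \<longleftrightarrow> successively (\<lambda>(a, s) (b, t). a = b \<longrightarrow> s = t) w"

lemma reduced_words_altdef: "reduced_words B = {w. set w \<subseteq> B \<times> UNIV \<and> reduced w}"
  by (simp add: reduced_words_def reduced_def)

context group
begin

lemma word_val_Nil [simp]: "word_val G [] = \<one>"
  by (simp add: word_val_def)

lemma word_val_Cons: "word_val G ((a, s) # w) = (if s then a else inv a) \<otimes> word_val G w"
  by (simp add: word_val_def)

lemma word_val_closed [simp]: "set w \<subseteq> carrier G \<times> UNIV \<Longrightarrow> word_val G w \<in> carrier G"
  by (induction w) (auto simp: word_val_Cons)

lemma word_val_append:
  "set u \<subseteq> carrier G \<times> UNIV \<Longrightarrow> set v \<subseteq> carrier G \<times> UNIV \<Longrightarrow>
    word_val G (u @ v) = word_val G u \<otimes> word_val G v"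
  by (induction u) (auto simp: word_val_Cons m_assoc)

lemma word_val_power:
  assumes "set w \<subseteq> carrier G \<times> UNIV"
  shows "word_val G (concat (replicate k w)) = word_val G w [^] k"
proof (induction k)
  case (Suc k)
  have "concat (replicate (Suc k) w) = concat (replicate k w) @ w"
    by (metis append_Nil2 concat.simps concat_append replicate_Suc replicate_append_same)
  moreover have "set (concat (replicate k w)) \<subseteq> carrier G \<times> UNIV" using assms by auto
  ultimately show ?case using Suc assms by (simp add: word_val_append)
qed simp

lemma inv_mult_cancel [simp]:
  assumes "g \<in> carrier G" "h \<in> carrier G"
  shows "inv g \<otimes> (g \<otimes> h) = h" "g \<otimes> (inv g \<otimes> h) = h"
  using assms by (simp_all add: m_assoc[symmetric])

lemma conj_nat_pow:
  assumes "g \<in> carrier G" "h \<in> carrier G"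
  shows "(g \<otimes> h \<otimes> inv g) [^] (k :: nat) = g \<otimes> h [^] k \<otimes> inv g"
proof (induction k)
  case (Suc k)
  then show ?case using assms by (simp add: m_assoc)
qed (use assms in simp)

lemma inv_eq_nat_pow:
  assumes "g \<in> carrier G" "g [^] n = \<one>" "n > (0 :: nat)"
  shows "inv g = g [^] (n - 1)"
proof -
  have "g [^] (n - 1) \<otimes> g = \<one>"
    using assms nat_pow_Suc[of g "n - 1"] by simp
  then show ?thesis using assms(1) by (intro inv_equality) auto
qed

end

text \<open>The third hypothesis says that \<open>w\<close> is cyclically reduced, so nothing
  cancels at the seams between the copies.\<close>

lemma reduced_concat_replicate:
  assumes "reduced w" "w \<noteq> []" "last w \<noteq> (fst (hd w), \<not> snd (hd w))"
  shows "reduced (concat (replicate k w))"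
proof (induction k)
  case (Suc k)
  have "hd (concat (replicate k w)) = hd w" if "k > 0"
    using that assms(2) by (cases k) (auto simp: hd_append)
  moreover have "(\<lambda>(a, s) (b, t). a = b \<longrightarrow> s = t) (last w) (hd w)"
    using assms(3) by (cases "last w"; cases "hd w") auto
  ultimately show ?case
    using Suc assms unfolding reduced_def
    by (cases "k = 0") (auto simp: successively_append_iff)
qed (simp add: reduced_def)

text \<open>A conjugating pair of letters is stripped from the two ends of \<open>w\<close> as long
  as possible. Once \<open>w\<close> is cyclically reduced, its \<open>k\<close>-th power is a
  reduced word with the value of the empty word, so uniqueness of reduced words applies.\<close>

lemma (in group) reduced_torsion_trivial:
  assumes B: "B \<subseteq> carrier G" and inj: "inj_on (word_val G) (reduced_words B)"
    and "w \<in> reduced_words B" "word_val G w [^] k = \<one>" "k > (0 :: nat)"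
  shows "w = []"
  using assms(3,4)
proof (induction "length w" arbitrary: w rule: less_induct)
  case less
  have wB: "set w \<subseteq> B \<times> UNIV" and red: "reduced w"
    using less.prems by (auto simp: reduced_words_altdef)
  then have wG: "set w \<subseteq> carrier G \<times> UNIV" using B by auto
  show ?case
  proof (rule ccontr)
    assume "w \<noteq> []"
    then obtain a s w1 where w: "w = (a, s) # w1" by (metis list.exhaust surj_pair)
    show False
    proof (cases "last w = (a, \<not> s)")
      case True
      then have "w1 \<noteq> []" using w by auto
      with True w have "w1 = butlast w1 @ [(a, \<not> s)]" by (metis append_butlast_last_id last_ConsR)
      then obtain w2 where w2: "w1 = w2 @ [(a, \<not> s)]" by blast
      have a: "a \<in> carrier G" and w2G: "set w2 \<subseteq> carrier G \<times> UNIV" using wG w w2 by auto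
      define g where "g = (if s then a else inv a)"
      have g: "g \<in> carrier G" using a by (simp add: g_def)
      have "word_val G w = g \<otimes> (word_val G w2 \<otimes> inv g)"
        using a w2G by (simp add: w w2 word_val_Cons word_val_append g_def)
      then have "g \<otimes> word_val G w2 [^] k \<otimes> inv g = \<one>"
        using less.prems(2) conj_nat_pow[OF g, of "word_val G w2" k] g w2G by (simp add: m_assoc)
      then have "word_val G w2 [^] k = \<one>"
        using g w2G by (metis inv_closed inv_solve_right l_cancel_one nat_pow_closed one_closed
            r_inv word_val_closed m_closed l_one)
      moreover have "w2 \<in> reduced_words B"
        using wB red by (auto simp: w w2 reduced_words_altdef reduced_def successively_append_iff
            successively_Cons)
      ultimately have "w2 = []" using less.hyps[of w2] w w2 by simp
      \<comment> \<open>With an empty core, \<open>w\<close> would be a letter followed by its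
        inverse.\<close>
      then show False using red by (simp add: w w2 reduced_def)
    next
      case False
      then have "reduced (concat (replicate k w))"
        using red by (intro reduced_concat_replicate) (auto simp: w)
      then have "concat (replicate k w) \<in> reduced_words B"
        using wB by (auto simp: reduced_words_altdef)
      moreover have "[] \<in> reduced_words B" by (simp add: reduced_words_altdef reduced_def)
      moreover have "word_val G (concat (replicate k w)) = word_val G []"
        using less.prems(2) wG by (simp add: word_val_power)
      ultimately have "concat (replicate k w) = []" using inj by (meson inj_onD)
      then show False using \<open>k > 0\<close> by (simp add: w)
    qed
  qed
qed

lemma free_group_torsion_free:
  assumes "free_group G" "g \<in> carrier G" "g [^]\<^bsub>G\<^esub> k = \<one>\<^bsub>G\<^esub>" "k > (0 :: nat)"
  shows "g = \<one>\<^bsub>G\<^esub>"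
proof -
  from assms(1) obtain B where B: "group G" "B \<subseteq> carrier G"
    "bij_betw (word_val G) (reduced_words B) (carrier G)"
    unfolding free_group_def by blast
  interpret group G by (fact B(1))
  obtain w where w: "w \<in> reduced_words B" "word_val G w = g"
    using B(3) assms(2) by (metis bij_betw_iff_bijections)
  then have "w = []"
    using reduced_torsion_trivial[OF B(2) bij_betw_imp_inj_on[OF B(3)]] assms(3,4) by blast
  then show ?thesis using w by simp
qed

section \<open>The group and its permutation representations\<close>

abbreviation Gamma3_rel :: "nat \<Rightarrow> (gen gword \<times> gen gword) set" where
  "Gamma3_rel m \<equiv> {(replicate (2 * m) (Gen_x, True), []),
      (replicate (3 * m) (Gen_y, True), []),
      (replicate 2 (Gen_x, True), replicate 3 (Gen_y, True))}"

definition Gamma3_class :: "nat \<Rightarrow> gen gword \<Rightarrow> gen gword set" where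
  "Gamma3_class m w = {v. pres_eq (Gamma3_rel m) w v}"

abbreviation gx :: "nat \<Rightarrow> gen gword set" where "gx m \<equiv> Gamma3_class m [(Gen_x, True)]"
abbreviation gy :: "nat \<Rightarrow> gen gword set" where "gy m \<equiv> Gamma3_class m [(Gen_y, True)]"

lemma group_Gamma3: "group (Gamma3 m)"
  unfolding Gamma3_def by (rule group_presented_group)

interpretation Gamma3: group "Gamma3 m" for m by (rule group_Gamma3)

lemma Gamma3_class_eq_iff: "Gamma3_class m u = Gamma3_class m v \<longleftrightarrow> pres_eq (Gamma3_rel m) u v"
  unfolding Gamma3_class_def by (rule pres_class_eq_iff)

lemma carrier_Gamma3: "carrier (Gamma3 m) = range (Gamma3_class m)"
  unfolding Gamma3_def carrier_presented_group Gamma3_class_def ..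

lemma Gamma3_class_closed [simp]: "Gamma3_class m w \<in> carrier (Gamma3 m)"
  by (simp add: carrier_Gamma3)

lemma Gamma3_one: "\<one>\<^bsub>Gamma3 m\<^esub> = Gamma3_class m []"
  by (simp add: Gamma3_def one_presented_group Gamma3_class_def)

lemma Gamma3_mult: "Gamma3_class m u \<otimes>\<^bsub>Gamma3 m\<^esub> Gamma3_class m v = Gamma3_class m (u @ v)"
  by (simp add: Gamma3_def mult_presented_group Gamma3_class_def)

lemma Gamma3_class_power:
  "Gamma3_class m [l] [^]\<^bsub>Gamma3 m\<^esub> (k :: nat) = Gamma3_class m (replicate k l)"
  by (induction k) (simp_all add: Gamma3_one Gamma3_mult replicate_append_same)

lemma gx_power_order: "gx m [^]\<^bsub>Gamma3 m\<^esub> (2 * m) = \<one>\<^bsub>Gamma3 m\<^esub>"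
  unfolding Gamma3_class_power Gamma3_one Gamma3_class_eq_iff by (rule pres_rel) simp

lemma gy_power_order: "gy m [^]\<^bsub>Gamma3 m\<^esub> (3 * m) = \<one>\<^bsub>Gamma3 m\<^esub>"
  unfolding Gamma3_class_power Gamma3_one Gamma3_class_eq_iff by (rule pres_rel) simp

lemma gx_square_eq_gy_cube: "gx m [^]\<^bsub>Gamma3 m\<^esub> (2 :: nat) = gy m [^]\<^bsub>Gamma3 m\<^esub> (3 :: nat)"
  unfolding Gamma3_class_power Gamma3_class_eq_iff by (rule pres_rel) simp

lemma Gamma3_inv_letter:
  "Gamma3_class m [(a, False)] = inv\<^bsub>Gamma3 m\<^esub> (Gamma3_class m [(a, True)])"
proof (rule Gamma3.inv_equality[symmetric])
  show "Gamma3_class m [(a, False)] \<otimes>\<^bsub>Gamma3 m\<^esub> Gamma3_class m [(a, True)] = \<one>\<^bsub>Gamma3 m\<^esub>"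
    unfolding Gamma3_mult Gamma3_one Gamma3_class_eq_iff using pres_cancel[of _ a False] by simp
qed simp_all

text \<open>Both generators have finite order, so their inverses are positive powers and induction
  needs only right multiplication by \<open>gx m\<close> and \<open>gy m\<close>.\<close>

lemma Gamma3_induct [consumes 2, case_names one x y]:
  assumes "m \<ge> 1" "g \<in> carrier (Gamma3 m)"
    and one: "P \<one>\<^bsub>Gamma3 m\<^esub>"
    and x: "\<And>g. g \<in> carrier (Gamma3 m) \<Longrightarrow> P g \<Longrightarrow> P (g \<otimes>\<^bsub>Gamma3 m\<^esub> gx m)"
    and y: "\<And>g. g \<in> carrier (Gamma3 m) \<Longrightarrow> P g \<Longrightarrow> P (g \<otimes>\<^bsub>Gamma3 m\<^esub> gy m)"
  shows "P g"
proof -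
  have xk: "P (g \<otimes>\<^bsub>Gamma3 m\<^esub> gx m [^]\<^bsub>Gamma3 m\<^esub> (k :: nat))" if "g \<in> carrier (Gamma3 m)" "P g" for g k
  proof (induction k)
    case (Suc k)
    then show ?case using x[of "g \<otimes>\<^bsub>Gamma3 m\<^esub> gx m [^]\<^bsub>Gamma3 m\<^esub> k"] that by (simp add: Gamma3.m_assoc)
  qed (use that in simp)
  have yk: "P (g \<otimes>\<^bsub>Gamma3 m\<^esub> gy m [^]\<^bsub>Gamma3 m\<^esub> (k :: nat))" if "g \<in> carrier (Gamma3 m)" "P g" for g k
  proof (induction k)
    case (Suc k)
    then show ?case using y[of "g \<otimes>\<^bsub>Gamma3 m\<^esub> gy m [^]\<^bsub>Gamma3 m\<^esub> k"] that by (simp add: Gamma3.m_assoc)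
  qed (use that in simp)
  have inv: "inv\<^bsub>Gamma3 m\<^esub> gx m = gx m [^]\<^bsub>Gamma3 m\<^esub> (2 * m - 1)"
    "inv\<^bsub>Gamma3 m\<^esub> gy m = gy m [^]\<^bsub>Gamma3 m\<^esub> (3 * m - 1)"
    using assms(1) Gamma3.inv_eq_nat_pow[OF _ gx_power_order, of m]
      Gamma3.inv_eq_nat_pow[OF _ gy_power_order, of m] by simp_all
  have "P (Gamma3_class m w)" for w
  proof (induction w rule: rev_induct)
    case Nil
    then show ?case using one by (simp add: Gamma3_one)
  next
    case (snoc l w)
    obtain a s where l: "l = (a, s)" by force
    have "Gamma3_class m (w @ [l]) = Gamma3_class m w \<otimes>\<^bsub>Gamma3 m\<^esub> Gamma3_class m [l]"
      by (simp add: Gamma3_mult)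
    then show ?case
      using snoc x[of "Gamma3_class m w"] y[of "Gamma3_class m w"]
        xk[of "Gamma3_class m w" "2 * m - 1"] yk[of "Gamma3_class m w" "3 * m - 1"]
      by (cases a; cases s) (simp_all add: l Gamma3_inv_letter inv)
  qed
  then show ?thesis using assms(2) by (auto simp: carrier_Gamma3)
qed

definition Gamma3_perms :: "nat \<Rightarrow> ('p \<Rightarrow> 'p) \<Rightarrow> ('p \<Rightarrow> 'p) \<Rightarrow> bool" where
  "Gamma3_perms m X Y \<longleftrightarrow> X ^^ (2 * m) = id \<and> Y ^^ (3 * m) = id \<and> X ^^ 2 = Y ^^ 3"

definition word_act :: "('p \<Rightarrow> 'p) \<Rightarrow> ('p \<Rightarrow> 'p) \<Rightarrow> gen gword \<Rightarrow> 'p \<Rightarrow> 'p" where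
  "word_act X Y = fold (\<lambda>(a, s). let f = case_gen X Y a in if s then f else inv_into UNIV f)"

text \<open>Letters act from left to right, so this is a right action, like the one on right cosets.\<close>

definition Gamma3_act :: "('p \<Rightarrow> 'p) \<Rightarrow> ('p \<Rightarrow> 'p) \<Rightarrow> gen gword set \<Rightarrow> 'p \<Rightarrow> 'p" where
  "Gamma3_act X Y g = word_act X Y (SOME w. w \<in> g)"

lemma funpow_id_imp_bij:
  assumes "f ^^ n = id" "n > 0"
  shows "bij f"
proof -
  obtain k where n: "n = Suc k" using assms(2) gr0_implies_Suc by blast
  show ?thesis
  proof (rule o_bij)
    show "(f ^^ k) \<circ> f = id" using assms(1) unfolding n by (metis funpow_Suc_right)
    show "f \<circ> (f ^^ k) = id" using assms(1) unfolding n by simp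
  qed
qed

context
  fixes m :: nat and X Y :: "'p \<Rightarrow> 'p"
  assumes m: "m \<ge> 1" and XY: "Gamma3_perms m X Y"
begin

lemma Gamma3_perms_bij: "bij X" "bij Y"
  using XY m unfolding Gamma3_perms_def by (auto intro: funpow_id_imp_bij)

lemma word_act_cong: "pres_eq (Gamma3_rel m) u v \<Longrightarrow> word_act X Y u = word_act X Y v"
proof (induction rule: pres_eq.induct)
  case (pres_rel u v)
  have rep: "fold f (replicate n c) = f c ^^ n" for f :: "gen \<times> bool \<Rightarrow> 'p \<Rightarrow> 'p" and c n
    by (induction n) (simp_all add: funpow_Suc_right del: funpow.simps)
  from pres_rel XY show ?case
    unfolding Gamma3_perms_def by (auto simp: word_act_def rep id_def simp del: replicate.simps)
next
  case (pres_cancel a s)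
  have "bij (case_gen X Y a)" using Gamma3_perms_bij by (cases a) auto
  then show ?case
    by (cases s) (auto simp: word_act_def Let_def fun_eq_iff bij_is_inj bij_is_surj surj_f_inv_f)
qed (auto simp: word_act_def)

lemma Gamma3_act_class: "Gamma3_act X Y (Gamma3_class m w) = word_act X Y w"
proof -
  have "w \<in> Gamma3_class m w" by (simp add: Gamma3_class_def pres_refl)
  then have "(SOME v. v \<in> Gamma3_class m w) \<in> Gamma3_class m w" by (rule someI)
  then show ?thesis
    unfolding Gamma3_act_def using word_act_cong by (auto simp: Gamma3_class_def)
qed

lemma Gamma3_act_one: "Gamma3_act X Y \<one>\<^bsub>Gamma3 m\<^esub> = id"
  unfolding Gamma3_one Gamma3_act_class by (auto simp: word_act_def)

lemma Gamma3_act_mult: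
  "g \<in> carrier (Gamma3 m) \<Longrightarrow> h \<in> carrier (Gamma3 m) \<Longrightarrow>
    Gamma3_act X Y (g \<otimes>\<^bsub>Gamma3 m\<^esub> h) = Gamma3_act X Y h \<circ> Gamma3_act X Y g"
  by (auto simp: carrier_Gamma3 Gamma3_mult Gamma3_act_class word_act_def)

lemma Gamma3_act_gens: "Gamma3_act X Y (gx m) = X" "Gamma3_act X Y (gy m) = Y"
  by (simp_all add: Gamma3_act_class word_act_def)

lemma Gamma3_act_inv:
  assumes "g \<in> carrier (Gamma3 m)"
  shows "Gamma3_act X Y (inv\<^bsub>Gamma3 m\<^esub> g) (Gamma3_act X Y g p) = p"
    "Gamma3_act X Y g (Gamma3_act X Y (inv\<^bsub>Gamma3 m\<^esub> g) p) = p"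
  using assms Gamma3_act_mult[of g "inv\<^bsub>Gamma3 m\<^esub> g"] Gamma3_act_mult[of "inv\<^bsub>Gamma3 m\<^esub> g" g]
  by (simp_all add: Gamma3_act_one fun_eq_iff)

lemma Gamma3_act_power:
  assumes "g \<in> carrier (Gamma3 m)"
  shows "Gamma3_act X Y (g [^]\<^bsub>Gamma3 m\<^esub> (k :: nat)) = Gamma3_act X Y g ^^ k"
  by (induction k) (use assms in \<open>simp_all add: Gamma3_act_one Gamma3_act_mult\<close>)

end

text \<open>The orders are read off from the homomorphism to the integers modulo \<open>6 m\<close> sending
  \<open>x\<close> to 3 and \<open>y\<close> to 2.\<close>

lemma gens_order:
  assumes "m \<ge> 1"
  shows "gx m [^]\<^bsub>Gamma3 m\<^esub> (i :: nat) = \<one>\<^bsub>Gamma3 m\<^esub> \<longleftrightarrow> 2 * m dvd i"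
    and "gy m [^]\<^bsub>Gamma3 m\<^esub> (i :: nat) = \<one>\<^bsub>Gamma3 m\<^esub> \<longleftrightarrow> 3 * m dvd i"
proof -
  \<comment> \<open>The translations modulo \<open>6 * m\<close> are continued by the identity
    because \<open>Gamma3_perms\<close> asks for equations between functions on the whole
    type.\<close>
  define X where "X = (\<lambda>k. if k < 6 * m then (k + 3) mod (6 * m) else k)"
  define Y where "Y = (\<lambda>k. if k < 6 * m then (k + 2) mod (6 * m) else k)"
  have X: "(X ^^ i) k = (if k < 6 * m then (k + i * 3) mod (6 * m) else k)" for i k
    by (cases "k < 6 * m"; induction i) (use assms in \<open>auto simp: X_def mod_simps algebra_simps\<close>)
  have Y: "(Y ^^ i) k = (if k < 6 * m then (k + i * 2) mod (6 * m) else k)" for i k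
    by (cases "k < 6 * m"; induction i) (use assms in \<open>auto simp: Y_def mod_simps algebra_simps\<close>)
  have XY: "Gamma3_perms m X Y"
    unfolding Gamma3_perms_def fun_eq_iff X Y by (auto simp: algebra_simps)
  show "gx m [^]\<^bsub>Gamma3 m\<^esub> i = \<one>\<^bsub>Gamma3 m\<^esub> \<longleftrightarrow> 2 * m dvd i"
  proof
    assume "gx m [^]\<^bsub>Gamma3 m\<^esub> i = \<one>\<^bsub>Gamma3 m\<^esub>"
    then have "(X ^^ i) 0 = 0"
      using Gamma3_act_power[OF assms XY, of "gx m" i] Gamma3_act_gens[OF assms XY]
        Gamma3_act_one[OF assms XY] by simp
    then have "3 * (2 * m) dvd 3 * i" using assms by (simp add: X mod_eq_0_iff_dvd mult.commute)
    then show "2 * m dvd i" by (rule dvd_times_left_cancel_iff[THEN iffD1, rotated]) simp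
  next
    assume "2 * m dvd i"
    then obtain j where "i = 2 * m * j" by (elim dvdE)
    then show "gx m [^]\<^bsub>Gamma3 m\<^esub> i = \<one>\<^bsub>Gamma3 m\<^esub>"
      using gx_power_order[of m] Gamma3.nat_pow_pow[of "gx m" m "2 * m" j] by simp
  qed
  show "gy m [^]\<^bsub>Gamma3 m\<^esub> i = \<one>\<^bsub>Gamma3 m\<^esub> \<longleftrightarrow> 3 * m dvd i"
  proof
    assume "gy m [^]\<^bsub>Gamma3 m\<^esub> i = \<one>\<^bsub>Gamma3 m\<^esub>"
    then have "(Y ^^ i) 0 = 0"
      using Gamma3_act_power[OF assms XY, of "gy m" i] Gamma3_act_gens[OF assms XY]
        Gamma3_act_one[OF assms XY] by simp
    then have "2 * (3 * m) dvd 2 * i" using assms by (simp add: Y mod_eq_0_iff_dvd mult.commute)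
    then show "3 * m dvd i" by (rule dvd_times_left_cancel_iff[THEN iffD1, rotated]) simp
  next
    assume "3 * m dvd i"
    then obtain j where "i = 3 * m * j" by (elim dvdE)
    then show "gy m [^]\<^bsub>Gamma3 m\<^esub> i = \<one>\<^bsub>Gamma3 m\<^esub>"
      using gy_power_order[of m] Gamma3.nat_pow_pow[of "gy m" m "3 * m" j] by simp
  qed
qed

section \<open>Free subgroups and semiregular permutations\<close>

text \<open>All cycles on \<open>S\<close> have length exactly \<open>r\<close>. For a generator of
  order \<open>r\<close> acting on the cosets of a subgroup, this says that no conjugate of a
  nontrivial power of it lies in the subgroup. Being the identity off \<open>S\<close> makes such
  functions countable.\<close>

definition semireg :: "nat \<Rightarrow> 'p set \<Rightarrow> ('p \<Rightarrow> 'p) \<Rightarrow> bool" where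
  "semireg r S f \<longleftrightarrow> f permutes S \<and> (\<forall>s\<in>S. \<forall>i. (f ^^ i) s = s \<longleftrightarrow> r dvd i)"

lemma funpow_outside: "f permutes S \<Longrightarrow> s \<notin> S \<Longrightarrow> (f ^^ i) s = s"
  by (induction i) (auto simp: permutes_not_in)

lemma funpow_permutes_in: "f permutes S \<Longrightarrow> (f ^^ i) s \<in> S \<longleftrightarrow> s \<in> S"
  by (induction i) (auto simp: permutes_in_image)

lemma semireg_funpow_id: "semireg r S f \<Longrightarrow> r dvd i \<Longrightarrow> f ^^ i = id"
  unfolding semireg_def fun_eq_iff id_apply using funpow_outside by metis

lemma semireg_funpow_mod:
  assumes "semireg r S f"
  shows "f ^^ (i mod r) = f ^^ i"
proof -
  have "f ^^ i = f ^^ (i mod r + r * (i div r))" by simp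
  also have "\<dots> = f ^^ (i mod r)"
    unfolding funpow_add using semireg_funpow_id[OF assms] by simp
  finally show ?thesis ..
qed

lemma semireg_funpow_eq_iff:
  assumes "semireg r S f" "s \<in> S"
  shows "(f ^^ i) s = (f ^^ j) s \<longleftrightarrow> i mod r = j mod r"
proof
  have *: "i mod r = j mod r" if le: "i \<le> j" and eq: "(f ^^ i) s = (f ^^ j) s" for i j
  proof -
    have "bij f" using assms(1) by (auto simp: semireg_def permutes_bij)
    then have "inj (f ^^ i)" by (simp add: bij_is_inj bij_fn)
    moreover have "(f ^^ j) s = (f ^^ i) ((f ^^ (j - i)) s)"
      using le by (metis comp_apply funpow_add le_add_diff_inverse)
    ultimately have "(f ^^ (j - i)) s = s" using eq by (metis injD)
    then have "r dvd j - i" using assms by (auto simp: semireg_def)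
    then show ?thesis using le by (metis mod_eq_dvd_iff_nat)
  qed
  assume "(f ^^ i) s = (f ^^ j) s"
  then show "i mod r = j mod r" using *[of i j] *[of j i] by (metis nat_le_linear)
qed (metis semireg_funpow_mod[OF assms(1)])

definition good :: "nat \<Rightarrow> 'p set \<Rightarrow> ('p \<Rightarrow> 'p) \<Rightarrow> ('p \<Rightarrow> 'p) \<Rightarrow> bool" where
  "good m S X Y \<longleftrightarrow> semireg (2 * m) S X \<and> semireg (3 * m) S Y \<and> X ^^ 2 = Y ^^ 3"

lemma good_imp_Gamma3_perms: "good m S X Y \<Longrightarrow> Gamma3_perms m X Y"
  by (auto simp: good_def Gamma3_perms_def semireg_funpow_id)

section \<open>The action on right cosets\<close>

abbreviation cosets3 :: "nat \<Rightarrow> gen gword set set \<Rightarrow> gen gword set set set" where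
  "cosets3 m H \<equiv> rcosets\<^bsub>Gamma3 m\<^esub> H"

definition coset_perm :: "nat \<Rightarrow> gen gword set set \<Rightarrow> gen gword set \<Rightarrow> gen gword set set \<Rightarrow> gen gword set set" where
  "coset_perm m H a C = (if C \<in> cosets3 m H then C #>\<^bsub>Gamma3 m\<^esub> a else C)"

context
  fixes m :: nat and H :: "gen gword set set"
  assumes m: "m \<ge> 1" and H: "subgroup H (Gamma3 m)"
begin

lemma cosets3_altdef: "cosets3 m H = (\<lambda>g. H #>\<^bsub>Gamma3 m\<^esub> g) ` carrier (Gamma3 m)"
  by (auto simp: RCOSETS_def)

lemma H_in_cosets3: "H \<in> cosets3 m H"
  unfolding cosets3_altdef
  by (rule image_eqI[of _ _ "\<one>\<^bsub>Gamma3 m\<^esub>"])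
    (simp_all add: Gamma3.coset_mult_one subgroup.subset[OF H])

lemma coset_perm_coset:
  "a \<in> carrier (Gamma3 m) \<Longrightarrow> g \<in> carrier (Gamma3 m) \<Longrightarrow>
    coset_perm m H a (H #>\<^bsub>Gamma3 m\<^esub> g) = H #>\<^bsub>Gamma3 m\<^esub> (g \<otimes>\<^bsub>Gamma3 m\<^esub> a)"
  by (auto simp: coset_perm_def cosets3_altdef Gamma3.coset_mult_assoc subgroup.subset[OF H])

lemma coset_perm_funpow:
  assumes "a \<in> carrier (Gamma3 m)"
  shows "(coset_perm m H a ^^ i) C = (if C \<in> cosets3 m H then C #>\<^bsub>Gamma3 m\<^esub> (a [^]\<^bsub>Gamma3 m\<^esub> i) else C)"
proof (cases "C \<in> cosets3 m H")
  case True
  then obtain g where g: "g \<in> carrier (Gamma3 m)" "C = H #>\<^bsub>Gamma3 m\<^esub> g" by (auto simp: cosets3_altdef)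
  have "(coset_perm m H a ^^ i) C = H #>\<^bsub>Gamma3 m\<^esub> (g \<otimes>\<^bsub>Gamma3 m\<^esub> a [^]\<^bsub>Gamma3 m\<^esub> i)"
    by (induction i)
      (use assms g in \<open>simp_all add: coset_perm_coset Gamma3.m_assoc\<close>)
  then show ?thesis using True assms g by (simp add: Gamma3.coset_mult_assoc subgroup.subset[OF H])
next
  case False
  then have "(coset_perm m H a ^^ i) C = C" by (induction i) (auto simp: coset_perm_def)
  then show ?thesis using False by simp
qed

lemma coset_perm_permutes:
  assumes "a \<in> carrier (Gamma3 m)"
  shows "coset_perm m H a permutes cosets3 m H"
proof (rule bij_imp_permutes)
  show "bij_betw (coset_perm m H a) (cosets3 m H) (cosets3 m H)"
  proof (rule bij_betw_byWitness[where f' = "coset_perm m H (inv\<^bsub>Gamma3 m\<^esub> a)"])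
    show "\<forall>C\<in>cosets3 m H. coset_perm m H (inv\<^bsub>Gamma3 m\<^esub> a) (coset_perm m H a C) = C"
      "\<forall>C\<in>cosets3 m H. coset_perm m H a (coset_perm m H (inv\<^bsub>Gamma3 m\<^esub> a) C) = C"
      unfolding cosets3_altdef using assms by (auto simp: coset_perm_coset Gamma3.m_assoc)
    show "coset_perm m H a ` cosets3 m H \<subseteq> cosets3 m H"
      "coset_perm m H (inv\<^bsub>Gamma3 m\<^esub> a) ` cosets3 m H \<subseteq> cosets3 m H"
      unfolding cosets3_altdef using assms by (auto simp: coset_perm_coset)
  qed
qed (simp add: coset_perm_def)

lemma coset_perms_Gamma3_perms: "Gamma3_perms m (coset_perm m H (gx m)) (coset_perm m H (gy m))"
proof -
  have "C #>\<^bsub>Gamma3 m\<^esub> \<one>\<^bsub>Gamma3 m\<^esub> = C" if "C \<in> cosets3 m H" for C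
    using that unfolding cosets3_altdef
    by (auto simp: Gamma3.coset_mult_assoc subgroup.subset[OF H])
  then show ?thesis
    unfolding Gamma3_perms_def fun_eq_iff
    by (simp add: coset_perm_funpow gx_power_order gy_power_order gx_square_eq_gy_cube)
qed

text \<open>If a power of a generator fixes a coset \<open>H g\<close>, then its conjugate by
  \<open>g\<close> lies in \<open>H\<close> and has finite order, hence is trivial because
  \<open>H\<close> is torsion-free.\<close>

lemma free_imp_good:
  assumes free: "free_group (Gamma3 m \<lparr>carrier := H\<rparr>)"
  shows "good m (cosets3 m H) (coset_perm m H (gx m)) (coset_perm m H (gy m))"
proof -
  have reg: "semireg r (cosets3 m H) (coset_perm m H a)"
    if a: "a \<in> carrier (Gamma3 m)" and ord: "\<And>i. a [^]\<^bsub>Gamma3 m\<^esub> (i :: nat) = \<one>\<^bsub>Gamma3 m\<^esub> \<longleftrightarrow> r dvd i"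
      and r: "r > 0" for a r
    unfolding semireg_def
  proof (intro conjI ballI allI)
    show "coset_perm m H a permutes cosets3 m H" using a by (rule coset_perm_permutes)
    fix C and i :: nat assume "C \<in> cosets3 m H"
    then obtain g where g: "g \<in> carrier (Gamma3 m)" "C = H #>\<^bsub>Gamma3 m\<^esub> g"
      by (auto simp: cosets3_altdef)
    define b where "b = g \<otimes>\<^bsub>Gamma3 m\<^esub> a [^]\<^bsub>Gamma3 m\<^esub> i \<otimes>\<^bsub>Gamma3 m\<^esub> inv\<^bsub>Gamma3 m\<^esub> g"
    have it: "(coset_perm m H a ^^ i) C = H #>\<^bsub>Gamma3 m\<^esub> (g \<otimes>\<^bsub>Gamma3 m\<^esub> a [^]\<^bsub>Gamma3 m\<^esub> i)"
      using a g \<open>C \<in> cosets3 m H\<close>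
      by (simp add: coset_perm_funpow Gamma3.coset_mult_assoc subgroup.subset[OF H])
    show "(coset_perm m H a ^^ i) C = C \<longleftrightarrow> r dvd i"
    proof
      assume "r dvd i"
      then have "a [^]\<^bsub>Gamma3 m\<^esub> i = \<one>\<^bsub>Gamma3 m\<^esub>" using ord by simp
      then show "(coset_perm m H a ^^ i) C = C" unfolding it using g by simp
    next
      assume "(coset_perm m H a ^^ i) C = C"
      then have "H #>\<^bsub>Gamma3 m\<^esub> (g \<otimes>\<^bsub>Gamma3 m\<^esub> a [^]\<^bsub>Gamma3 m\<^esub> i) = H #>\<^bsub>Gamma3 m\<^esub> g"
        using it g(2) by metis
      then have "H #>\<^bsub>Gamma3 m\<^esub> b = H"
        unfolding b_def using a g(1) subgroup.subset[OF H] by (intro Gamma3.coset_mult_inv2) auto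
      moreover have bG: "b \<in> carrier (Gamma3 m)" using a g(1) by (simp add: b_def)
      ultimately have bH: "b \<in> H" using H by (rule Gamma3.coset_join1)
      have "b [^]\<^bsub>Gamma3 m\<^esub> r = g \<otimes>\<^bsub>Gamma3 m\<^esub> (a [^]\<^bsub>Gamma3 m\<^esub> i) [^]\<^bsub>Gamma3 m\<^esub> r \<otimes>\<^bsub>Gamma3 m\<^esub> inv\<^bsub>Gamma3 m\<^esub> g"
        unfolding b_def using a g(1) by (simp add: Gamma3.conj_nat_pow)
      also have "(a [^]\<^bsub>Gamma3 m\<^esub> i) [^]\<^bsub>Gamma3 m\<^esub> r = \<one>\<^bsub>Gamma3 m\<^esub>"
        using a by (simp add: Gamma3.nat_pow_pow ord)
      finally have "b [^]\<^bsub>Gamma3 m\<^esub> r = \<one>\<^bsub>Gamma3 m\<^esub>" using g(1) by simp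
      then have "b [^]\<^bsub>Gamma3 m \<lparr>carrier := H\<rparr>\<^esub> r = \<one>\<^bsub>Gamma3 m \<lparr>carrier := H\<rparr>\<^esub>"
        using Gamma3.nat_pow_consistent[of m b r H] by simp
      then have "b = \<one>\<^bsub>Gamma3 m\<^esub>" using free_group_torsion_free[OF free, of b r] bH r by simp
      moreover have "g \<otimes>\<^bsub>Gamma3 m\<^esub> a [^]\<^bsub>Gamma3 m\<^esub> i = b \<otimes>\<^bsub>Gamma3 m\<^esub> g"
        using a g(1) by (simp add: b_def Gamma3.m_assoc)
      ultimately have "inv\<^bsub>Gamma3 m\<^esub> g \<otimes>\<^bsub>Gamma3 m\<^esub> (g \<otimes>\<^bsub>Gamma3 m\<^esub> a [^]\<^bsub>Gamma3 m\<^esub> i) = \<one>\<^bsub>Gamma3 m\<^esub>"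
        using g(1) by simp
      then have "a [^]\<^bsub>Gamma3 m\<^esub> i = \<one>\<^bsub>Gamma3 m\<^esub>" using a g(1) by simp
      then show "r dvd i" using ord by simp
    qed
  qed
  show ?thesis
    unfolding good_def
    using reg[of "gx m" "2 * m"] reg[of "gy m" "3 * m"] gens_order[OF m] m
      coset_perms_Gamma3_perms by (auto simp: Gamma3_perms_def)
qed

end

section \<open>Left multiplication by a letter on reduced words of a free group\<close>

fun letter_push :: "'a \<times> bool \<Rightarrow> 'a gword \<Rightarrow> 'a gword" where
  "letter_push (a, s) w = (if w \<noteq> [] \<and> hd w = (a, \<not> s) then tl w else (a, s) # w)"

lemma reduced_Cons: "reduced (l # w) \<longleftrightarrow> reduced w \<and> (w = [] \<or> hd w \<noteq> (fst l, \<not> snd l))"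
  by (cases l; cases w) (auto simp: reduced_def)

lemma reduced_append_single:
  "reduced (w @ [l]) \<longleftrightarrow> reduced w \<and> (w = [] \<or> last w \<noteq> (fst l, \<not> snd l))"
  by (cases l; cases "last w") (auto simp: reduced_def successively_append_iff)

lemma reduced_push: "reduced w \<Longrightarrow> reduced (letter_push l w)"
  by (cases l; cases w) (auto simp: reduced_Cons)

lemma push_push_cancel: "reduced w \<Longrightarrow> letter_push (a, \<not> s) (letter_push (a, s) w) = w"
  by (cases w) (auto simp: reduced_Cons)

text \<open>Along a reduced word no push cancels, and pushing to the front reverses the order. Thus
  a reduced word can be recovered from its action on the empty word.\<close>

lemma fold_push_reduced: "reduced w \<Longrightarrow> fold letter_push w [] = rev w"
proof (induction w rule: rev_induct)
  case (snoc l w)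
  then show ?case by (cases l) (auto simp: reduced_append_single hd_rev)
qed simp

declare letter_push.simps [simp del]

section \<open>Spanning tree of the coset graph and a basis of the subgroup\<close>

locale good_cosets =
  fixes m :: nat and H :: "gen gword set set"
  assumes m: "m \<ge> 1" and H: "subgroup H (Gamma3 m)"
    and fin: "finite (cosets3 m H)"
    and good: "good m (cosets3 m H) (coset_perm m H (gx m)) (coset_perm m H (gy m))"
begin

abbreviation S where "S \<equiv> cosets3 m H"
abbreviation X where "X \<equiv> coset_perm m H (gx m)"
abbreviation Y where "Y \<equiv> coset_perm m H (gy m)"
abbreviation mul (infixl "\<bullet>" 70) where "g \<bullet> h \<equiv> g \<otimes>\<^bsub>Gamma3 m\<^esub> h"
abbreviation act (infixl "#\<bullet>" 70) where "C #\<bullet> h \<equiv> C #>\<^bsub>Gamma3 m\<^esub> h"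
abbreviation pow (infixr "^\<bullet>" 75) where "g ^\<bullet> (i :: nat) \<equiv> g [^]\<^bsub>Gamma3 m\<^esub> i"
abbreviation G where "G \<equiv> carrier (Gamma3 m)"

lemma X_reg: "semireg (2 * m) S X" and Y_reg: "semireg (3 * m) S Y" and XY: "X ^^ 2 = Y ^^ 3"
  using good by (auto simp: good_def)

lemma XX: "X (X s) = Y (Y (Y s))"
  using XY by (simp add: fun_eq_iff numeral_2_eq_2 numeral_3_eq_3)

lemma X_in: "X s \<in> S \<longleftrightarrow> s \<in> S" and Y_in: "Y s \<in> S \<longleftrightarrow> s \<in> S"
  using X_reg Y_reg by (auto simp: semireg_def permutes_in_image)

lemma X_iter_in: "(X ^^ i) s \<in> S \<longleftrightarrow> s \<in> S" and Y_iter_in: "(Y ^^ i) s \<in> S \<longleftrightarrow> s \<in> S"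
  using X_reg Y_reg by (auto simp: semireg_def funpow_permutes_in)

lemma HG: "H \<subseteq> G" by (rule subgroup.subset[OF H])

lemma H_in: "H \<in> S" by (rule H_in_cosets3[OF m H])

text \<open>A partial spanning tree of the coset graph: \<open>t\<close> is a transversal on the set \<open>V\<close> of
  cosets, compatible with \<open>y\<close> everywhere and with \<open>x\<close> on the set \<open>T\<close> of tree edges.\<close>

definition tree :: "gen gword set set set \<Rightarrow> (gen gword set set \<Rightarrow> gen gword set) \<Rightarrow> gen gword set set set \<Rightarrow> bool" where
  "tree V t T \<longleftrightarrow> H \<in> V \<and> V \<subseteq> S \<and> T \<subseteq> V \<and> t H = \<one>\<^bsub>Gamma3 m\<^esub> \<and>
    (\<forall>s\<in>V. Y s \<in> V \<and> t s \<in> G \<and> H #\<bullet> t s = s \<and> t (Y s) = t s \<bullet> gy m \<and>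
       (H, s) \<in> {(a, b). b = Y a \<or> a \<in> T \<and> b = X a}\<^sup>*) \<and>
    (\<forall>s\<in>T. X s \<in> T \<and> t (X s) = t s \<bullet> gx m)"

lemma power_mod_order:
  "gx m ^\<bullet> i = gx m ^\<bullet> (i mod (2 * m))" "gy m ^\<bullet> i = gy m ^\<bullet> (i mod (3 * m))"
proof -
  have *: "g ^\<bullet> i = g ^\<bullet> (i mod r)" if "g \<in> G" "g ^\<bullet> r = \<one>\<^bsub>Gamma3 m\<^esub>" for g r
  proof -
    have "g ^\<bullet> i = g ^\<bullet> (i mod r + r * (i div r))" by simp
    also have "\<dots> = g ^\<bullet> (i mod r) \<bullet> (g ^\<bullet> r) ^\<bullet> (i div r)"
      using that(1) by (simp only: Gamma3.nat_pow_mult[symmetric] Gamma3.nat_pow_pow)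
    finally show ?thesis using that by simp
  qed
  show "gx m ^\<bullet> i = gx m ^\<bullet> (i mod (2 * m))" "gy m ^\<bullet> i = gy m ^\<bullet> (i mod (3 * m))"
    using *[OF _ gx_power_order] *[OF _ gy_power_order] by simp_all
qed

text \<open>A point of the \<open>Y\<close>-cycle of \<open>u\<close> determines the exponent modulo
  \<open>3 * m\<close>, by semiregularity, and this determines the power of
  \<open>gy m\<close>.\<close>

lemma orbit_section:
  assumes "u \<in> S"
  shows "\<exists>\<tau>. \<forall>i. \<tau> ((Y ^^ i) u) = g \<bullet> gy m ^\<bullet> i"
proof (intro exI allI)
  fix i
  let ?P = "\<lambda>j. (Y ^^ i) u = (Y ^^ j) u"
  have "?P (SOME j. ?P j)" by (rule someI[of ?P i]) simp
  then have "gy m ^\<bullet> (SOME j. ?P j) = gy m ^\<bullet> i"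
    using semireg_funpow_eq_iff[OF Y_reg assms] power_mod_order(2) by metis
  then show "(\<lambda>s. g \<bullet> gy m ^\<bullet> (SOME j. s = (Y ^^ j) u)) ((Y ^^ i) u) = g \<bullet> gy m ^\<bullet> i" by simp
qed

lemma coset_Y: "g \<in> G \<Longrightarrow> H #\<bullet> g = s \<Longrightarrow> H #\<bullet> (g \<bullet> gy m) = Y s"
  using coset_perm_coset[OF m H, of "gy m" g] by simp

lemma coset_X: "g \<in> G \<Longrightarrow> H #\<bullet> g = s \<Longrightarrow> H #\<bullet> (g \<bullet> gx m) = X s"
  using coset_perm_coset[OF m H, of "gx m" g] by simp

lemma coset_Y_iter: "g \<in> G \<Longrightarrow> H #\<bullet> g = s \<Longrightarrow> H #\<bullet> (g \<bullet> gy m ^\<bullet> i) = (Y ^^ i) s"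
proof (induction i)
  case (Suc i)
  then show ?case using coset_Y[of "g \<bullet> gy m ^\<bullet> i"] by (simp add: Gamma3.m_assoc)
qed simp

lemma reach_Y_iter:
  "(a, s) \<in> {(a, b). b = Y a \<or> a \<in> T \<and> b = X a}\<^sup>* \<Longrightarrow>
   (a, (Y ^^ i) s) \<in> {(a, b). b = Y a \<or> a \<in> T \<and> b = X a}\<^sup>*"
  by (induction i) (auto intro: rtrancl_into_rtrancl)

lemma tree_start: "\<exists>V t. tree V t {}"
proof -
  obtain \<tau> where \<tau>: "\<And>i. \<tau> ((Y ^^ i) H) = \<one>\<^bsub>Gamma3 m\<^esub> \<bullet> gy m ^\<bullet> i"
    using orbit_section[OF H_in] by blast
  have "Y ((Y ^^ i) H) = (Y ^^ Suc i) H" for i by simp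
  moreover have "\<tau> H = \<one>\<^bsub>Gamma3 m\<^esub>" using \<tau>[of 0] by simp
  ultimately have "tree {s. \<exists>i. s = (Y ^^ i) H} \<tau> {}"
    unfolding tree_def
    using \<tau> H_in Y_iter_in coset_Y_iter[of "\<one>\<^bsub>Gamma3 m\<^esub>" H] reach_Y_iter[of H H "{}"]
      Gamma3.coset_mult_one[OF HG]
    by (auto simp del: funpow.simps intro: exI[of _ 0])
  then show ?thesis by blast
qed

text \<open>The whole \<open>Y\<close>-cycle of \<open>X s\<close> is added at once, and the whole
  \<open>X\<close>-cycle of \<open>s\<close> becomes a tree edge. The values forced by
  \<open>y\<close> and those forced by \<open>x\<close> agree because \<open>x^2 = y^3\<close> holds
  in the group as well as for the permutations.\<close>

lemma tree_extend:
  assumes tr: "tree V t T" and s: "s \<in> V" "X s \<notin> V"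
  shows "\<exists>V' t' T'. tree V' t' T' \<and> V \<subset> V'"
proof -
  have V: "V \<subseteq> S" "\<And>a. a \<in> V \<Longrightarrow> Y a \<in> V" "\<And>a. a \<in> V \<Longrightarrow> t a \<in> G" "\<And>a. a \<in> V \<Longrightarrow> H #\<bullet> t a = a"
    "\<And>a. a \<in> V \<Longrightarrow> t (Y a) = t a \<bullet> gy m" "H \<in> V" "T \<subseteq> V" "t H = \<one>\<^bsub>Gamma3 m\<^esub>"
    "\<And>a. a \<in> V \<Longrightarrow> (H, a) \<in> {(a, b). b = Y a \<or> a \<in> T \<and> b = X a}\<^sup>*"
    "\<And>a. a \<in> T \<Longrightarrow> X a \<in> T" "\<And>a. a \<in> T \<Longrightarrow> t (X a) = t a \<bullet> gx m"
    using tr unfolding tree_def by auto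
  have YV: "(Y ^^ i) a \<in> V" if "a \<in> V" for i a by (induction i) (use that V(2) in auto)
  have tY: "t ((Y ^^ i) a) = t a \<bullet> gy m ^\<bullet> i" if "a \<in> V" for i a
    by (induction i) (use that V(3,5) YV in \<open>auto simp: Gamma3.m_assoc\<close>)
  define u where "u = X s"
  have u: "u \<in> S" using s V(1) X_in by (auto simp: u_def)
  \<comment> \<open>\<open>V\<close> is closed under \<open>Y\<close> and hence under the inverse
    \<open>Y ^^ (3 * m - 1)\<close>; a common point would pull \<open>u\<close> back into
    \<open>V\<close>.\<close>
  have uY: "(Y ^^ i) u \<notin> V" for i
  proof
    assume "(Y ^^ i) u \<in> V"
    then have "(Y ^^ (i * (3 * m - 1))) ((Y ^^ i) u) \<in> V" by (rule YV)
    moreover have "(Y ^^ (i * (3 * m - 1))) ((Y ^^ i) u) = (Y ^^ (i * (3 * m))) u"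
    proof -
      have "i * (3 * m) = i * (3 * m - 1) + i" using m by (simp add: diff_mult_distrib2)
      then show ?thesis by (simp only: funpow_add comp_apply)
    qed
    moreover have "(Y ^^ (i * (3 * m))) u = u" using semireg_funpow_id[OF Y_reg, of "i * (3 * m)"] by simp
    ultimately show False using s by (simp add: u_def)
  qed
  obtain \<tau> where \<tau>: "\<And>i. \<tau> ((Y ^^ i) u) = t s \<bullet> gx m \<bullet> gy m ^\<bullet> i"
    using orbit_section[OF u] by blast
  define t' where "t' a = (if a \<in> V then t a else \<tau> a)" for a
  define V' where "V' = V \<union> {a. \<exists>i. a = (Y ^^ i) u}"
  define T' where "T' = T \<union> {a. \<exists>i. a = (X ^^ i) s}"
  have tsG: "t s \<in> G" using s V(3) by blast
  have t'u: "t' ((Y ^^ i) u) = t s \<bullet> gx m \<bullet> gy m ^\<bullet> i" for i using \<tau> uY by (simp add: t'_def)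
  \<comment> \<open>Even points of the \<open>X\<close>-cycle of \<open>s\<close> lie on the
    \<open>Y\<close>-cycle of \<open>s\<close>, odd points on that of \<open>u\<close>.\<close>
  have Xev: "(X ^^ (2 * j)) a = (Y ^^ (3 * j)) a" for j a
    using XY by (simp add: funpow_mult[symmetric])
  have Xod: "(X ^^ Suc (2 * j)) s = (Y ^^ (3 * j)) u" for j
    using Xev[of j "X s"] by (simp add: u_def funpow_Suc_right del: funpow.simps)
  have pw: "gx m ^\<bullet> (2 * j) = gy m ^\<bullet> (3 * j)" for j
    using gx_square_eq_gy_cube[of m] by (simp add: Gamma3.nat_pow_pow[symmetric])
  have t'X: "(X ^^ i) s \<in> V' \<and> t' ((X ^^ i) s) = t s \<bullet> gx m ^\<bullet> i" for i
  proof (cases "even i")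
    case True
    then obtain j where i: "i = 2 * j" by (elim evenE)
    show ?thesis unfolding i Xev pw using s(1) YV tY by (auto simp: V'_def t'_def)
  next
    case False
    then obtain j where i: "i = Suc (2 * j)" by (auto elim: oddE)
    have "gx m ^\<bullet> Suc (2 * j) = gx m \<bullet> gy m ^\<bullet> (3 * j)"
      using Gamma3.nat_pow_Suc2[of "gx m" m "2 * j"] pw by simp
    then show ?thesis unfolding i Xod t'u using tsG by (auto simp: V'_def Gamma3.m_assoc)
  qed
  have mono: "{(a, b). b = Y a \<or> a \<in> T \<and> b = X a}\<^sup>* \<subseteq> {(a, b). b = Y a \<or> a \<in> T' \<and> b = X a}\<^sup>*"
    by (rule rtrancl_mono) (auto simp: T'_def)
  have "(H, s) \<in> {(a, b). b = Y a \<or> a \<in> T' \<and> b = X a}\<^sup>*" using V(9) s(1) mono by blast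
  moreover have "s \<in> T'" unfolding T'_def by (auto intro: exI[of _ 0])
  ultimately have Hu: "(H, u) \<in> {(a, b). b = Y a \<or> a \<in> T' \<and> b = X a}\<^sup>*"
    unfolding u_def by (auto intro: rtrancl_into_rtrancl)
  have "tree V' t' T'"
    unfolding tree_def
  proof (intro conjI ballI)
    show "H \<in> V'" "V' \<subseteq> S" "t' H = \<one>\<^bsub>Gamma3 m\<^esub>"
      using V(1,6,8) u Y_iter_in by (auto simp: V'_def t'_def)
    show "T' \<subseteq> V'" using t'X V(7) by (auto simp: T'_def V'_def)
  next
    fix a assume "a \<in> V'"
    then consider "a \<in> V" | i where "a = (Y ^^ i) u" by (auto simp: V'_def)
    then have "Y a \<in> V' \<and> t' a \<in> G \<and> H #\<bullet> t' a = a \<and> t' (Y a) = t' a \<bullet> gy m \<and>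
        (H, a) \<in> {(a, b). b = Y a \<or> a \<in> T' \<and> b = X a}\<^sup>*"
    proof cases
      case 1
      then show ?thesis using V mono by (auto simp: V'_def t'_def)
    next
      case 2
      have Ya: "Y a = (Y ^^ Suc i) u" by (simp add: 2)
      have "H #\<bullet> (t s \<bullet> gx m) = u" unfolding u_def using s V by (intro coset_X) auto
      then have "H #\<bullet> t' a = a" unfolding 2 t'u using tsG by (intro coset_Y_iter) auto
      moreover have "t' (Y a) = t' a \<bullet> gy m"
        unfolding Ya unfolding 2 t'u using tsG by (simp add: Gamma3.m_assoc)
      moreover have "Y a \<in> V'" unfolding Ya V'_def by blast
      moreover have "t' a \<in> G" unfolding 2 t'u using tsG by simp
      ultimately show ?thesis using reach_Y_iter[OF Hu] 2 by blast
    qed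
    then show "Y a \<in> V'" "t' a \<in> G" "H #\<bullet> t' a = a" "t' (Y a) = t' a \<bullet> gy m"
      "(H, a) \<in> {(a, b). b = Y a \<or> a \<in> T' \<and> b = X a}\<^sup>*" by blast+
  next
    fix a assume "a \<in> T'"
    then consider "a \<in> T" | i where "a = (X ^^ i) s" by (auto simp: T'_def)
    then have "X a \<in> T' \<and> t' (X a) = t' a \<bullet> gx m"
    proof cases
      case 1
      then show ?thesis using V(7,10,11) by (auto simp: T'_def t'_def)
    next
      case 2
      have Xa: "X a = (X ^^ Suc i) s" by (simp add: 2)
      show ?thesis
        unfolding Xa unfolding 2 using t'X tsG by (auto simp: Gamma3.m_assoc T'_def simp del: funpow.simps)
    qed
    then show "X a \<in> T'" "t' (X a) = t' a \<bullet> gx m" by blast+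
  qed
  moreover have "u \<in> V' - V" using uY[of 0] by (auto simp: V'_def intro: exI[of _ 0])
  then have "V \<subset> V'" by (auto simp: V'_def)
  ultimately show ?thesis by blast
qed

lemma closed_eq_cosets:
  assumes "H \<in> V" "\<And>s. s \<in> V \<Longrightarrow> X s \<in> V" "\<And>s. s \<in> V \<Longrightarrow> Y s \<in> V"
  shows "S \<subseteq> V"
proof -
  have "H #\<bullet> g \<in> V" if "g \<in> G" for g
    using m that
  proof (induction rule: Gamma3_induct)
    case one
    show ?case using assms(1) Gamma3.coset_mult_one[OF HG] by simp
  qed (use assms coset_X coset_Y in metis)+
  then show ?thesis using cosets3_altdef[OF m H] by auto
qed

lemma spanning_tree: "\<exists>t T. tree S t T"
proof -
  have "\<exists>t T. tree S t T" if "tree V t T" for V t T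
    using that
  proof (induction "card (S - V)" arbitrary: V t T rule: less_induct)
    case less
    show ?case
    proof (cases "\<exists>s\<in>V. X s \<notin> V")
      case True
      then obtain V' t' T' where *: "tree V' t' T'" "V \<subset> V'" using tree_extend[OF less.prems] by blast
      then have "V' \<subseteq> S" by (simp add: tree_def)
      then have "card (S - V') < card (S - V)" using * fin by (intro psubset_card_mono) auto
      then show ?thesis using less.hyps * by blast
    next
      case False
      then have "S \<subseteq> V" using less.prems by (intro closed_eq_cosets) (auto simp: tree_def)
      then have "V = S" using less.prems by (auto simp: tree_def)
      then show ?thesis using less.prems by blast
    qed
  qed
  then show ?thesis using tree_start by blast
qed

text \<open>With the edges outside the tree labelled by free generators, \<open>H\<close> acts on
  cosets times reduced words; this identifies \<open>H\<close> with the free group on these edges.\<close>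

lemma tree_imp_free:
  assumes tr: "tree S t T"
  shows "free_group (Gamma3 m \<lparr>carrier := H\<rparr>)"
proof -
  have V: "\<And>a. a \<in> S \<Longrightarrow> t a \<in> G" "\<And>a. a \<in> S \<Longrightarrow> H #\<bullet> t a = a"
    "\<And>a. a \<in> S \<Longrightarrow> t (Y a) = t a \<bullet> gy m" "T \<subseteq> S" "t H = \<one>\<^bsub>Gamma3 m\<^esub>"
    "\<And>a. a \<in> S \<Longrightarrow> (H, a) \<in> {(a, b). b = Y a \<or> a \<in> T \<and> b = X a}\<^sup>*"
    "\<And>a. a \<in> T \<Longrightarrow> X a \<in> T" "\<And>a. a \<in> T \<Longrightarrow> t (X a) = t a \<bullet> gx m"
    using tr unfolding tree_def by auto
  have X2m: "(X ^^ (2 * m * i)) s = s" for i s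
    using semireg_funpow_id[OF X_reg, of "2 * m * i"] by simp
  have T_iter: "(X ^^ i) a \<in> T" if "a \<in> T" for i a by (induction i) (use that V(7) in auto)
  have X_back: "(X ^^ ((2 * m - 1) * i)) ((X ^^ i) s) = s" for i s
  proof -
    have "2 * m * i = (2 * m - 1) * i + i" using m by (simp add: diff_mult_distrib)
    then show ?thesis using X2m[of i s] by (simp only: funpow_add comp_apply)
  qed
  have XT: "(X ^^ i) a \<in> T \<longleftrightarrow> a \<in> T" for i a using T_iter X_back by metis
  \<comment> \<open>A representative of the \<open>X\<close>-cycle. The choice depends only on the
    set of iterates, so it is the same along the cycle.\<close>
  define \<rho> where "\<rho> s = (SOME r. \<exists>i. r = (X ^^ i) s)" for s
  have \<rho>_ex: "\<exists>i. \<rho> s = (X ^^ i) s" for s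
    unfolding \<rho>_def by (rule someI[of _ s]) (auto intro: exI[of _ 0])
  have \<rho>_X: "\<rho> (X s) = \<rho> s" for s
  proof -
    have "(\<exists>i. r = (X ^^ i) (X s)) \<longleftrightarrow> (\<exists>i. r = (X ^^ i) s)" for r
    proof
      assume "\<exists>i. r = (X ^^ i) (X s)"
      then obtain i where "r = (X ^^ i) (X s)" by blast
      then have "r = (X ^^ Suc i) s" by (simp add: funpow_swap1)
      then show "\<exists>i. r = (X ^^ i) s" by blast
    next
      assume "\<exists>i. r = (X ^^ i) s"
      then obtain i where "r = (X ^^ i) s" by blast
      also have "s = (X ^^ (2 * m - 1)) (X s)" using X_back[of 1 s] by simp
      also have "(X ^^ i) \<dots> = (X ^^ (i + (2 * m - 1))) (X s)" by (simp add: funpow_add)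
      finally show "\<exists>i. r = (X ^^ i) (X s)" by blast
    qed
    then show ?thesis unfolding \<rho>_def by presburger
  qed
  have \<rho>_iter: "\<rho> ((X ^^ i) s) = \<rho> s" for i s by (induction i) (auto simp: \<rho>_X)
  have from_\<rho>: "\<exists>k. s = (X ^^ k) (\<rho> s)" for s using \<rho>_ex[of s] X_back by metis
  have \<rho>_S: "\<rho> s \<in> S" if "s \<in> S" for s using \<rho>_ex[of s] that by (metis X_iter_in)
  have \<rho>_T: "\<rho> s \<in> T \<longleftrightarrow> s \<in> T" for s using \<rho>_ex[of s] by (metis XT)
  \<comment> \<open>An \<open>X\<close>-cycle is one edge crossed back and forth; the parity of the
    distance from the representative tells the direction. It is well defined because the cycle
    length \<open>2 * m\<close> is even.\<close>
  define sg where "sg s = (\<exists>j. s = (X ^^ (2 * j)) (\<rho> s))" for s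
  have sg: "sg s \<longleftrightarrow> even k" if "s \<in> S" "s = (X ^^ k) (\<rho> s)" for s k
  proof
    assume "sg s"
    then obtain j where "s = (X ^^ (2 * j)) (\<rho> s)" unfolding sg_def by blast
    then have "(X ^^ (2 * j)) (\<rho> s) = (X ^^ k) (\<rho> s)" using that(2) by simp
    then have "2 * j mod (2 * m) = k mod (2 * m)"
      using semireg_funpow_eq_iff[OF X_reg \<rho>_S[OF that(1)]] by blast
    then have "2 * j mod (2 * m) mod 2 = k mod (2 * m) mod 2" by simp
    then show "even k" by (simp add: mod_mod_cancel even_iff_mod_2_eq_zero)
  next
    assume "even k"
    then show "sg s" unfolding sg_def using that(2) by (auto elim!: evenE)
  qed
  have sg_X: "sg (X s) \<longleftrightarrow> \<not> sg s" if s: "s \<in> S" for s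
  proof -
    obtain k where k: "s = (X ^^ k) (\<rho> s)" using from_\<rho> by blast
    have "X s = (X ^^ Suc k) (\<rho> (X s))" unfolding \<rho>_X using k by simp
    then show ?thesis using sg[OF s k] sg[of "X s" "Suc k"] s X_in by auto
  qed
  define \<alpha> where "\<alpha> s = (\<rho> s, sg s)" for s
  \<comment> \<open>The lifted action pushes the oriented label of an edge whenever it crosses one
    outside the tree. Elsewhere it is the identity, so that the relations hold on the whole
    type.\<close>
  define X' where "X' = (\<lambda>(s, w). if s \<in> S \<and> reduced w
    then (X s, if s \<in> T then w else letter_push (\<alpha> s) w) else (s, w))"
  define Y' where "Y' = (\<lambda>(s, w :: gen gword set set gword). if s \<in> S \<and> reduced w then (Y s, w) else (s, w))"
  have X'_app: "X' (s, w) = (X s, if s \<in> T then w else letter_push (\<alpha> s) w)"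
    and Y'_app: "Y' (s, w) = (Y s, w)" if "s \<in> S" "reduced w" for s w
    using that by (simp_all add: X'_def Y'_def)
  have Y'_iter: "(Y' ^^ i) (s, w) = (if s \<in> S \<and> reduced w then ((Y ^^ i) s, w) else (s, w))" for i s w
    by (induction i) (auto simp: Y'_def Y_iter_in)
  \<comment> \<open>Two steps of \<open>X'\<close> cross the same edge in opposite directions, so
    the labels cancel. Since \<open>Y'\<close> does not touch the word, the relation
    \<open>x^2 = y^3\<close> survives the lifting.\<close>
  have X'X': "X' (X' (s, w)) = (if s \<in> S \<and> reduced w then (X (X s), w) else (s, w))" for s w
  proof (cases "s \<in> S \<and> reduced w")
    case True
    show ?thesis
    proof (cases "s \<in> T")
      case False
      then have "X s \<notin> T" using XT[of 1 s] by simp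
      moreover have "\<alpha> (X s) = (\<rho> s, \<not> sg s)" using True sg_X by (simp add: \<alpha>_def \<rho>_X)
      moreover have "\<alpha> s = (\<rho> s, sg s)" by (simp add: \<alpha>_def)
      ultimately show ?thesis
        using True False X_in push_push_cancel[of w "\<rho> s" "sg s"]
        by (simp add: X'_def reduced_push)
    qed (use True V(7) X_in in \<open>simp add: X'_def\<close>)
  next
    case False
    then show ?thesis by (auto simp: X'_def)
  qed
  have "(X' ^^ 2) (s, w) = (Y' ^^ 3) (s, w)" for s w
    unfolding Y'_iter by (simp add: numeral_2_eq_2 numeral_3_eq_3 X'X' XX)
  then have "X' ^^ 2 = Y' ^^ 3" by auto
  moreover have Y'id: "Y' ^^ (3 * m) = id"
    using semireg_funpow_id[OF Y_reg, of "3 * m"] by (auto simp: fun_eq_iff Y'_iter)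
  moreover have "X' ^^ (2 * m) = id"
    using Y'id \<open>X' ^^ 2 = Y' ^^ 3\<close> by (metis funpow_mult)
  ultimately have rel: "Gamma3_perms m X' Y'" by (simp add: Gamma3_perms_def)
  note act_mult = Gamma3_act_mult[OF m rel]
  note act_gens = Gamma3_act_gens[OF m rel]
  note act_one = Gamma3_act_one[OF m rel]
  note act_inv = Gamma3_act_inv[OF m rel]
  define A where "A = Gamma3_act X' Y'"
  \<comment> \<open>The path from \<open>H\<close> to \<open>s\<close> uses only \<open>Y\<close>
    and tree edges, none of which pushes a letter.\<close>
  have A_t: "A (t s) (H, w) = (s, w)" if "s \<in> S" "reduced w" for s w
  proof -
    have "a \<in> S \<and> A (t a) (H, w) = (a, w)"
      if "(H, a) \<in> {(a, b). b = Y a \<or> a \<in> T \<and> b = X a}\<^sup>*" for a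
      using that
    proof (induction rule: rtrancl_induct)
      case base
      then show ?case using V(5) H_in by (simp add: A_def act_one)
    next
      case (step a b)
      then consider "b = Y a" | "a \<in> T" "b = X a" by blast
      then show ?case
      proof cases
        case 1
        then show ?thesis using step.IH \<open>reduced w\<close> V(1,3) Y_in
          by (simp add: A_def act_mult act_gens Y'_app)
      next
        case 2
        then show ?thesis using step.IH \<open>reduced w\<close> V(1,8) X_in
          by (simp add: A_def act_mult act_gens X'_app V(4)[THEN subsetD])
      qed
    qed
    then show ?thesis using V(6)[OF \<open>s \<in> S\<close>] by blast
  qed
  \<comment> \<open>The Schreier generators for \<open>x\<close>. They are trivial on tree edges,
    and those for \<open>y\<close> are trivial because \<open>t\<close> is compatible with
    \<open>Y\<close> everywhere.\<close>
  define \<beta> where "\<beta> s = t s \<bullet> gx m \<bullet> inv\<^bsub>Gamma3 m\<^esub> t (X s)" for s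
  have tX: "t s \<in> G" "t (X s) \<in> G" if "s \<in> S" for s using V(1) X_in that by auto
  have \<beta>G: "\<beta> s \<in> G" if "s \<in> S" for s using tX[OF that] by (simp add: \<beta>_def)
  have \<beta>H: "\<beta> s \<in> H" if s: "s \<in> S" for s
  proof (rule Gamma3.coset_join1)
    have "H #\<bullet> (t s \<bullet> gx m) = H #\<bullet> t (X s)"
      using coset_X[of "t s" s] V(2) tX[OF s] s X_in by simp
    then show "H #\<bullet> \<beta> s = H"
      unfolding \<beta>_def using tX[OF s] HG by (intro Gamma3.coset_mult_inv2) auto
  qed (use \<beta>G[OF s] H in auto)
  define R where "R = \<rho> ` (S - T)"
  have R: "r \<in> S" "r \<notin> T" "\<rho> r = r" "sg r" if r: "r \<in> R" for r
  proof -
    obtain s where s: "s \<in> S - T" "r = \<rho> s" using r by (auto simp: R_def)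
    show "r \<in> S" "r \<notin> T" using s \<rho>_S \<rho>_T by auto
    show "\<rho> r = r" using s(2) \<rho>_ex[of s] \<rho>_iter by metis
    then show "sg r" using sg[of r 0] \<open>r \<in> S\<close> by simp
  qed
  \<comment> \<open>Out along the tree, across the edge of \<open>r\<close>, and back along the
    tree: exactly one letter is pushed.\<close>
  have A_\<beta>: "A (\<beta> r) (H, w) = (H, letter_push (r, True) w)" if r: "r \<in> R" and w: "reduced w" for r w
  proof -
    have "A (\<beta> r) (H, w) = A (inv\<^bsub>Gamma3 m\<^esub> t (X r)) (X' (A (t r) (H, w)))"
      using tX[OF R(1)[OF r]] by (simp add: \<beta>_def A_def act_mult act_gens)
    also have "X' (A (t r) (H, w)) = (X r, letter_push (r, True) w)"
      using A_t[OF R(1)[OF r] w] R[OF r] w by (simp add: X'_app \<alpha>_def)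
    also have "\<dots> = A (t (X r)) (H, letter_push (r, True) w)"
      using A_t[of "X r"] R(1)[OF r] X_in reduced_push[OF w] by simp
    also have "A (inv\<^bsub>Gamma3 m\<^esub> t (X r)) \<dots> = (H, letter_push (r, True) w)"
      using tX[OF R(1)[OF r]] by (simp add: A_def act_inv)
    finally show ?thesis .
  qed
  have A_\<beta>_inv: "A (inv\<^bsub>Gamma3 m\<^esub> \<beta> r) (H, w) = (H, letter_push (r, False) w)"
    if r: "r \<in> R" and w: "reduced w" for r w
  proof -
    have "A (\<beta> r) (H, letter_push (r, False) w) = (H, w)"
      using A_\<beta>[OF r reduced_push[OF w]] push_push_cancel[OF w, of r False]
      by (simp)
    then show ?thesis using act_inv(1)[OF \<beta>G[OF R(1)[OF r]]] unfolding A_def by metis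
  qed
  define lab where "lab = map (\<lambda>(r, s :: bool). (\<beta> r, s))"
  define val where "val v = word_val (Gamma3 m) (lab v)" for v
  have labG: "set (lab v) \<subseteq> G \<times> UNIV" if "set v \<subseteq> R \<times> UNIV" for v
    using that \<beta>G R(1) by (auto simp: lab_def)
  have val_Nil: "val [] = \<one>\<^bsub>Gamma3 m\<^esub>" by (simp add: val_def lab_def)
  have val_Cons: "val ((r, s) # v) = (if s then \<beta> r else inv\<^bsub>Gamma3 m\<^esub> \<beta> r) \<bullet> val v" for r s v
    by (simp add: val_def lab_def Gamma3.word_val_Cons)
  have valG: "val v \<in> G" if "set v \<subseteq> R \<times> UNIV" for v
    unfolding val_def using labG[OF that] by (rule Gamma3.word_val_closed)
  have A_val: "A (val v) (H, w) = (H, fold letter_push v w)"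
    if "set v \<subseteq> R \<times> UNIV" "reduced w" for v w
    using that
  proof (induction v arbitrary: w)
    case Nil
    then show ?case by (simp add: val_Nil A_def act_one)
  next
    case (Cons l v)
    obtain r s where l: "l = (r, s)" by force
    have r: "r \<in> R" and v: "set v \<subseteq> R \<times> UNIV" using Cons.prems l by auto
    have "A (val (l # v)) (H, w) = A (val v) (A (if s then \<beta> r else inv\<^bsub>Gamma3 m\<^esub> \<beta> r) (H, w))"
      using \<beta>G[OF R(1)[OF r]] valG[OF v] by (simp add: l val_Cons A_def act_mult)
    also have "A (if s then \<beta> r else inv\<^bsub>Gamma3 m\<^esub> \<beta> r) (H, w) = (H, letter_push l w)"
      using A_\<beta>[OF r Cons.prems(2)] A_\<beta>_inv[OF r Cons.prems(2)] l by (cases s) auto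
    finally show ?case using Cons.IH[OF v reduced_push[OF Cons.prems(2)]] by simp
  qed
  \<comment> \<open>The reversed word is visible in the action of its value, so distinct reduced
    words have distinct values.\<close>
  have A_val_reduced: "A (val v) (H, []) = (H, rev v)" if "set v \<subseteq> R \<times> UNIV" "reduced v" for v
    using A_val[OF that(1), of "[]"] fold_push_reduced[OF that(2)] by (simp add: reduced_def)
  \<comment> \<open>Injectivity allows the representatives in \<open>R\<close> to serve as names of
    the basis elements, with the same notion of reduced word.\<close>
  have \<beta>_inj: "inj_on \<beta> R"
  proof (rule inj_onI)
    fix r r' assume r: "r \<in> R" "r' \<in> R" "\<beta> r = \<beta> r'"
    have "A (\<beta> q) (H, []) = (H, [(q, True)])" if "q \<in> R" for q
      using A_\<beta>[OF that, of "[]"] by (simp add: reduced_def letter_push.simps)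
    from this[OF r(1)] this[OF r(2)] show "r = r'" unfolding r(3) by simp
  qed
  have red_lab: "reduced (lab v) \<longleftrightarrow> reduced v" if "set v \<subseteq> R \<times> UNIV" for v
  proof -
    have "successively (\<lambda>p q. \<beta> (fst p) = \<beta> (fst q) \<longrightarrow> snd p = snd q) v =
      successively (\<lambda>p q. fst p = fst q \<longrightarrow> snd p = snd q) v"
    proof (rule successively_cong)
      fix p q assume "p \<in> set v" "q \<in> set v"
      then have "fst p \<in> R" "fst q \<in> R" using that by auto
      then show "(\<beta> (fst p) = \<beta> (fst q) \<longrightarrow> snd p = snd q) = (fst p = fst q \<longrightarrow> snd p = snd q)"
        using inj_onD[OF \<beta>_inj] by metis
    qed simp
    then show ?thesis by (simp add: reduced_def lab_def successively_map case_prod_unfold)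
  qed
  have unlab: "\<exists>v. set v \<subseteq> R \<times> UNIV \<and> reduced v \<and> lab v = w" if "w \<in> reduced_words (\<beta> ` R)" for w
  proof -
    define v where "v = map (\<lambda>(b, s :: bool). (inv_into R \<beta> b, s)) w"
    have w: "set w \<subseteq> \<beta> ` R \<times> UNIV" "reduced w" using that by (auto simp: reduced_words_altdef)
    have "set v \<subseteq> R \<times> UNIV" unfolding v_def using w(1) by (auto intro: inv_into_into)
    moreover have "lab v = w"
      unfolding lab_def v_def map_map
      by (rule map_idI) (use w(1) in \<open>auto simp: f_inv_into_f\<close>)
    ultimately show ?thesis using w(2) red_lab by blast
  qed
  \<comment> \<open>Right multiplication by a basis element or its inverse either cancels the last
    letter or appends one, so values of reduced words are closed under it.\<close>
  have val_append: "\<exists>v'. set v' \<subseteq> R \<times> UNIV \<and> reduced v' \<and>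
      val v' = val v \<bullet> (if s then \<beta> r else inv\<^bsub>Gamma3 m\<^esub> \<beta> r)"
    if v: "set v \<subseteq> R \<times> UNIV" "reduced v" and r: "r \<in> R" for v r s
  proof (cases "v \<noteq> [] \<and> last v = (r, \<not> s)")
    case True
    then obtain u where u: "v = u @ [(r, \<not> s)]" by (metis append_butlast_last_id)
    have uR: "set u \<subseteq> R \<times> UNIV" using v u by auto
    have "val v = val u \<bullet> val [(r, \<not> s)]"
      using labG[OF uR] labG[of "[(r, \<not> s)]"] r
      by (simp add: u val_def lab_def Gamma3.word_val_append)
    also have "val [(r, \<not> s)] = (if s then inv\<^bsub>Gamma3 m\<^esub> \<beta> r else \<beta> r)"
      using \<beta>G[OF R(1)[OF r]] by (simp add: val_Cons val_Nil)
    finally have "val u = val v \<bullet> (if s then \<beta> r else inv\<^bsub>Gamma3 m\<^esub> \<beta> r)"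
      using valG[OF uR] \<beta>G[OF R(1)[OF r]] by (auto simp: Gamma3.m_assoc)
    then show ?thesis using uR v(2) by (intro exI[of _ u]) (simp add: u reduced_append_single)
  next
    case False
    have "val (v @ [(r, s)]) = val v \<bullet> val [(r, s)]"
      using labG[OF v(1)] labG[of "[(r, s)]"] r
      by (simp add: val_def lab_def Gamma3.word_val_append)
    also have "val [(r, s)] = (if s then \<beta> r else inv\<^bsub>Gamma3 m\<^esub> \<beta> r)"
      using \<beta>G[OF R(1)[OF r]] by (simp add: val_Cons val_Nil)
    finally show ?thesis
      using v r False by (intro exI[of _ "v @ [(r, s)]"]) (auto simp: reduced_append_single)
  qed
  \<comment> \<open>The next point of the \<open>X\<close>-cycle crosses the same edge backwards;
    after two steps the transversal has changed by \<open>y^3 = x^2\<close>. Hence one generator for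
    each \<open>X\<close>-cycle outside the tree is enough.\<close>
  have \<beta>_X: "\<beta> (X s) = inv\<^bsub>Gamma3 m\<^esub> \<beta> s" if s: "s \<in> S" for s
  proof (rule Gamma3.inv_equality[symmetric])
    have "t (X (X s)) = t s \<bullet> gy m ^\<bullet> 3"
      unfolding XX using s Y_in V(1,3) by (simp add: numeral_3_eq_3 Gamma3.m_assoc)
    also have "\<dots> = t s \<bullet> gx m \<bullet> gx m"
      using tX[OF s] by (simp add: gx_square_eq_gy_cube[symmetric] numeral_2_eq_2 Gamma3.m_assoc)
    finally have "\<beta> s \<bullet> \<beta> (X s) = \<one>\<^bsub>Gamma3 m\<^esub>"
      using tX[OF s] by (simp add: \<beta>_def Gamma3.m_assoc Gamma3.inv_mult_group)
    then show "\<beta> (X s) \<bullet> \<beta> s = \<one>\<^bsub>Gamma3 m\<^esub>"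
      using \<beta>G s X_in Gamma3.inv_comm by metis
  qed (use \<beta>G s X_in in auto)
  have \<beta>_iter: "\<beta> ((X ^^ k) r) = (if even k then \<beta> r else inv\<^bsub>Gamma3 m\<^esub> \<beta> r)" if "r \<in> S" for k r
    by (induction k) (use that \<beta>_X X_iter_in \<beta>G in auto)
  \<comment> \<open>Schreier rewriting: every group element is a word in the generators times a
    transversal element. For elements of \<open>H\<close> the latter is \<open>t H\<close>, which is
    the identity.\<close>
  have gen: "\<exists>v. set v \<subseteq> R \<times> UNIV \<and> reduced v \<and> g = val v \<bullet> t (H #\<bullet> g)" if "g \<in> G" for g
    using m that
  proof (induction rule: Gamma3_induct)
    case one
    then show ?case
      using V(5) HG by (intro exI[of _ "[]"]) (simp add: reduced_def val_Nil Gamma3.coset_mult_one)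
  next
    case (x g)
    then obtain v where v: "set v \<subseteq> R \<times> UNIV" "reduced v" "g = val v \<bullet> t (H #\<bullet> g)" by blast
    define s where "s = H #\<bullet> g"
    have s: "s \<in> S" using x(1) HG by (simp add: s_def Gamma3.rcosetsI)
    have Xs: "H #\<bullet> (g \<bullet> gx m) = X s" using x(1) by (simp add: coset_X s_def)
    have g: "g \<bullet> gx m = val v \<bullet> (t s \<bullet> gx m)"
      using v(3) tX[OF s] valG[OF v(1)] s_def by (metis Gamma3.m_assoc Gamma3_class_closed)
    show ?case
    proof (cases "s \<in> T")
      case True
      then show ?thesis using v(1,2) g V(8) unfolding Xs by metis
    next
      case False
      have r: "\<rho> s \<in> R" using s False by (simp add: R_def)
      obtain k where k: "s = (X ^^ k) (\<rho> s)" using from_\<rho> by blast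
      have "\<beta> s = (if sg s then \<beta> (\<rho> s) else inv\<^bsub>Gamma3 m\<^esub> \<beta> (\<rho> s))"
        using \<beta>_iter[OF R(1)[OF r], of k] sg[OF s k] k by simp
      with val_append[OF v(1,2) r, of "sg s"] obtain v' where
        v': "set v' \<subseteq> R \<times> UNIV" "reduced v'" "val v' = val v \<bullet> \<beta> s" by auto
      have "g \<bullet> gx m = val v' \<bullet> t (X s)"
        unfolding g v'(3) using valG[OF v(1)] tX[OF s] by (simp add: \<beta>_def Gamma3.m_assoc)
      then show ?thesis using v'(1,2) unfolding Xs by blast
    qed
  next
    case (y g)
    then obtain v where v: "set v \<subseteq> R \<times> UNIV" "reduced v" "g = val v \<bullet> t (H #\<bullet> g)" by blast
    define s where "s = H #\<bullet> g"
    have s: "s \<in> S" using y(1) HG by (simp add: s_def Gamma3.rcosetsI)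
    have Ys: "H #\<bullet> (g \<bullet> gy m) = Y s" using y(1) by (simp add: coset_Y s_def)
    have "g \<bullet> gy m = val v \<bullet> (t s \<bullet> gy m)"
      using v(3) tX[OF s] valG[OF v(1)] s_def by (metis Gamma3.m_assoc Gamma3_class_closed)
    then show ?case using v(1,2) V(3)[OF s] unfolding Ys by metis
  qed
  have word_val_H: "word_val (Gamma3 m \<lparr>carrier := H\<rparr>) w = word_val (Gamma3 m) w"
    if "set w \<subseteq> H \<times> UNIV" for w
    using that by (induction w) (auto simp: word_val_def Gamma3.m_inv_consistent[OF H])
  have B: "\<beta> ` R \<subseteq> H" using \<beta>H R(1) by auto
  have "bij_betw (word_val (Gamma3 m)) (reduced_words (\<beta> ` R)) H"
  proof (rule bij_betw_imageI)
    show "inj_on (word_val (Gamma3 m)) (reduced_words (\<beta> ` R))"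
    proof (rule inj_onI)
      fix w w' assume w: "w \<in> reduced_words (\<beta> ` R)" "w' \<in> reduced_words (\<beta> ` R)"
        and eq: "word_val (Gamma3 m) w = word_val (Gamma3 m) w'"
      obtain v where v: "set v \<subseteq> R \<times> UNIV" "reduced v" "lab v = w" using unlab[OF w(1)] by blast
      obtain v' where v': "set v' \<subseteq> R \<times> UNIV" "reduced v'" "lab v' = w'" using unlab[OF w(2)] by blast
      have "val v = val v'" using eq by (simp add: val_def v v')
      from A_val_reduced[OF v(1,2)] A_val_reduced[OF v'(1,2)] have "rev v = rev v'"
        unfolding \<open>val v = val v'\<close> by simp
      then show "w = w'" using v v' by simp
    qed
    show "word_val (Gamma3 m) ` reduced_words (\<beta> ` R) = H"
    proof (intro equalityI subsetI)
      fix h assume "h \<in> word_val (Gamma3 m) ` reduced_words (\<beta> ` R)"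
      then obtain w where w: "w \<in> reduced_words (\<beta> ` R)" "h = word_val (Gamma3 m) w" by blast
      have "set w \<subseteq> H \<times> UNIV" using w(1) B by (auto simp: reduced_words_altdef)
      then have "word_val (Gamma3 m \<lparr>carrier := H\<rparr>) w \<in> H"
        using group.word_val_closed[OF Gamma3.subgroup_imp_group[OF H], of w] by simp
      then show "h \<in> H" using w(2) word_val_H \<open>set w \<subseteq> H \<times> UNIV\<close> by simp
    next
      fix h assume h: "h \<in> H"
      then have hG: "h \<in> G" using HG by blast
      then obtain v where v: "set v \<subseteq> R \<times> UNIV" "reduced v" "h = val v \<bullet> t (H #\<bullet> h)" using gen by blast
      have "H #\<bullet> h = H" using Gamma3.coset_join2[OF hG H h] .
      with v(3) have "h = val v \<bullet> t H" by metis
      also have "\<dots> = word_val (Gamma3 m) (lab v)" using valG[OF v(1)] V(5) by (simp add: val_def)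
      finally have "h = word_val (Gamma3 m) (lab v)" .
      moreover have "lab v \<in> reduced_words (\<beta> ` R)"
        using v red_lab by (auto simp: reduced_words_altdef) (auto simp: lab_def)
      ultimately show "h \<in> word_val (Gamma3 m) ` reduced_words (\<beta> ` R)" by blast
    qed
  qed
  moreover have "bij_betw (word_val (Gamma3 m \<lparr>carrier := H\<rparr>)) (reduced_words (\<beta> ` R)) H =
      bij_betw (word_val (Gamma3 m)) (reduced_words (\<beta> ` R)) H"
    by (rule bij_betw_cong) (use B in \<open>auto simp: reduced_words_altdef intro!: word_val_H\<close>)
  ultimately show ?thesis
    unfolding free_group_def using Gamma3.subgroup_imp_group[OF H] B by auto
qed

lemma free: "free_group (Gamma3 m \<lparr>carrier := H\<rparr>)"
  using spanning_tree tree_imp_free by blast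

end

section \<open>Counting roots of semiregular permutations\<close>

text \<open>The permutation property follows because \<open>f ^^ r\<close> is the identity both on
  \<open>S\<close> and off it.\<close>

lemma semiregI:
  assumes "r > 0" "\<And>s. s \<notin> S \<Longrightarrow> f s = s" "\<And>s i. s \<in> S \<Longrightarrow> (f ^^ i) s = s \<longleftrightarrow> r dvd i"
  shows "semireg r S f"
proof -
  have "(f ^^ r) s = s" for s
  proof (cases "s \<in> S")
    case False
    then have "(f ^^ i) s = s" for i by (induction i) (use assms(2) in auto)
    then show ?thesis .
  qed (use assms(3) in simp)
  then have "bij f" using assms(1) by (intro funpow_id_imp_bij[of r]) auto
  then have "f permutes S" using assms(2) by (simp add: permutes_def bij_iff)
  then show ?thesis using assms(3) by (auto simp: semireg_def)
qed

section \<open>Cutting and gluing semiregular permutations\<close>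

definition restr :: "('p \<Rightarrow> 'p) \<Rightarrow> 'p set \<Rightarrow> 'p \<Rightarrow> 'p" where
  "restr f T s = (if s \<in> T then f s else s)"

definition join :: "'p set \<Rightarrow> ('p \<Rightarrow> 'p) \<Rightarrow> ('p \<Rightarrow> 'p) \<Rightarrow> 'p \<Rightarrow> 'p" where
  "join T f g s = (if s \<in> T then f s else g s)"

lemma funpow_cong_closed:
  assumes "\<And>s. s \<in> T \<Longrightarrow> f s = g s" "\<And>s. s \<in> T \<Longrightarrow> f s \<in> T" "s \<in> T"
  shows "(g ^^ i) s = (f ^^ i) s \<and> (f ^^ i) s \<in> T"
  using assms by (induction i) auto

lemma semireg_restr:
  assumes "semireg r S f" "r > 0" "T \<subseteq> S" "\<And>s. s \<in> T \<Longrightarrow> f s \<in> T"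
  shows "semireg r T (restr f T)"
proof (rule semiregI)
  fix s i assume s: "s \<in> T"
  have "(restr f T ^^ i) s = (f ^^ i) s"
    using funpow_cong_closed[of T f "restr f T" s i] assms(4) s by (simp add: restr_def)
  then show "(restr f T ^^ i) s = s \<longleftrightarrow> r dvd i" using assms s by (auto simp: semireg_def)
qed (use assms(2) in \<open>auto simp: restr_def\<close>)

text \<open>The inverse of \<open>f\<close> is the power \<open>f ^^ (r - 1)\<close>, so a set
  closed under \<open>f\<close> is also closed under the inverse.\<close>

lemma semireg_closed_compl:
  assumes "semireg r S f" "r > 0" "\<And>s. s \<in> T \<Longrightarrow> f s \<in> T" "s \<in> S - T"
  shows "f s \<in> S - T"
proof -
  have f: "f permutes S" using assms(1) by (simp add: semireg_def)
  have "s \<in> T" if "f s \<in> T"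
  proof -
    have "(f ^^ (r - 1)) (f s) \<in> T"
      using funpow_cong_closed[of T f f "f s"] assms(3) that by blast
    moreover have "(f ^^ (r - 1)) (f s) = (f ^^ r) s"
      using assms(2) by (cases r) (simp_all add: funpow_swap1)
    ultimately show ?thesis using semireg_funpow_id[OF assms(1), of r] by simp
  qed
  then show ?thesis using assms(4) f by (auto simp: permutes_in_image)
qed

lemma semireg_join:
  assumes "semireg r T f" "semireg r U g" "r > 0" "T \<inter> U = {}"
  shows "semireg r (T \<union> U) (join T f g)"
proof (rule semiregI)
  have f: "f permutes T" and g: "g permutes U" using assms by (simp_all add: semireg_def)
  fix s i assume s: "s \<in> T \<union> U"
  show "(join T f g ^^ i) s = s \<longleftrightarrow> r dvd i"
  proof (cases "s \<in> T")
    case True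
    have "(join T f g ^^ i) s = (f ^^ i) s"
      using funpow_cong_closed[of T f "join T f g" s i] f True by (simp add: join_def permutes_in_image)
    then show ?thesis using assms(1) True by (auto simp: semireg_def)
  next
    case False
    then have sU: "s \<in> U" using s by blast
    have "u \<notin> T" if "u \<in> U" for u using that assms(4) by blast
    then have "(join T f g ^^ i) s = (g ^^ i) s"
      using funpow_cong_closed[of U g "join T f g" s i] g sU by (simp add: join_def permutes_in_image)
    then show ?thesis using assms(2) sU by (auto simp: semireg_def)
  qed
qed (use assms in \<open>auto simp: join_def semireg_def permutes_not_in\<close>)

section \<open>Cycles of a semiregular permutation\<close>

definition orb :: "('p \<Rightarrow> 'p) \<Rightarrow> 'p \<Rightarrow> 'p set" where
  "orb f s = range (\<lambda>i. (f ^^ i) s)"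

lemma orb_closed: "a \<in> orb f s \<Longrightarrow> (f ^^ i) a \<in> orb f s"
  unfolding orb_def by (auto simp: funpow_add[THEN fun_cong, simplified, symmetric])

context
  fixes r :: nat and S :: "'p set" and f :: "'p \<Rightarrow> 'p"
  assumes f: "semireg r S f" and r: "r > 0"
begin

lemma orb_eq_image: "orb f s = (\<lambda>i. (f ^^ i) s) ` {..<r}"
proof -
  have "(f ^^ i) s \<in> (\<lambda>i. (f ^^ i) s) ` {..<r}" for i
    using semireg_funpow_mod[OF f, of i] r by (intro image_eqI[of _ _ "i mod r"]) auto
  then show ?thesis by (auto simp: orb_def)
qed

lemma card_orb: "s \<in> S \<Longrightarrow> card (orb f s) = r"
  unfolding orb_eq_image using semireg_funpow_eq_iff[OF f]
  by (subst card_image) (auto simp: inj_on_def)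

lemma finite_orb: "finite (orb f s)"
  unfolding orb_eq_image by simp

lemma orb_subset: "s \<in> S \<Longrightarrow> orb f s \<subseteq> S"
  using f by (auto simp: orb_def semireg_def funpow_permutes_in)

lemma orb_sym:
  assumes "a \<in> orb f s"
  shows "s \<in> orb f a"
proof -
  obtain i where i: "a = (f ^^ i) s" using assms by (auto simp: orb_def)
  have "(f ^^ ((r - 1) * i)) a = (f ^^ ((r - 1) * i + i)) s" by (simp add: i funpow_add)
  also have "(r - 1) * i + i = r * i" using r by (simp add: diff_mult_distrib)
  also have "(f ^^ (r * i)) s = s" using semireg_funpow_id[OF f, of "r * i"] by simp
  finally show ?thesis unfolding orb_def by (metis rangeI)
qed

end

lemma orb_trans:
  assumes "a \<in> orb f s" "b \<in> orb f a"
  shows "b \<in> orb f s"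
proof -
  obtain i where "b = (f ^^ i) a" using assms(2) by (auto simp: orb_def)
  then show ?thesis using orb_closed[OF assms(1)] by simp
qed

lemma semireg_dvd_card:
  assumes "finite S" "semireg r S f" "r > 0"
  shows "r dvd card S"
  using assms
proof (induction "card S" arbitrary: S f rule: less_induct)
  case less
  show ?case
  proof (cases "S = {}")
    case False
    then obtain s where s: "s \<in> S" by blast
    note sr = less.prems(2,3)
    have sub: "orb f s \<subseteq> S" by (rule orb_subset[OF sr s])
    have cl: "\<And>a. a \<in> orb f s \<Longrightarrow> f a \<in> orb f s" using orb_closed[of _ f s 1] by simp
    have "semireg r (S - orb f s) (restr f (S - orb f s))"
      using semireg_closed_compl[OF sr cl] by (intro semireg_restr[OF sr]) auto
    moreover have card: "card S = card (S - orb f s) + r"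
      using card_orb[OF sr s] sub finite_orb[OF sr] card_mono[OF less.prems(1) sub]
      by (simp add: card_Diff_subset)
    ultimately have "r dvd card (S - orb f s)"
      using less.hyps[of "S - orb f s"] less.prems(1,3) by simp
    then show ?thesis unfolding card by simp
  qed simp
qed

text \<open>Both permutations of a pair are counted this way: \<open>Y\<close> as a root of order
  \<open>3 * m\<close> of the identity, with parameter 1 for \<open>m\<close>, and then
  \<open>X\<close> as a square root of \<open>Y ^^ 3\<close>.\<close>

definition roots :: "nat \<Rightarrow> nat \<Rightarrow> ('p \<Rightarrow> 'p) \<Rightarrow> 'p set \<Rightarrow> ('p \<Rightarrow> 'p) set" where
  "roots r m c S = {Y. semireg (r * m) S Y \<and> Y ^^ r = c}"

lemma finite_roots: "finite S \<Longrightarrow> finite (roots r m c S)"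
  by (rule finite_subset[OF _ finite_permutations[of S]]) (auto simp: roots_def semireg_def)

definition orbs :: "('p \<Rightarrow> 'p) \<Rightarrow> 'p list \<Rightarrow> 'p set" where
  "orbs c p = (\<Union>q\<in>set p. orb c q)"

text \<open>The possible beginnings \<open>s0, Y s0, \<dots>, Y\<^bsup>l\<^esup> s0\<close> of the orbit of \<open>s0\<close> under a root of \<open>c\<close>.\<close>

fun root_starts :: "('p \<Rightarrow> 'p) \<Rightarrow> 'p set \<Rightarrow> 'p \<Rightarrow> nat \<Rightarrow> 'p list set" where
  "root_starts c S s0 0 = {[s0]}"
| "root_starts c S s0 (Suc l) = (\<Union>p\<in>root_starts c S s0 l. (\<lambda>q. p @ [q]) ` (S - orbs c p))"

section \<open>Building a root from the beginning of one cycle\<close>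

context
  fixes m :: nat and S :: "'p set" and c :: "'p \<Rightarrow> 'p" and s0 :: 'p
  assumes c: "semireg m S c" and m: "m > 0" and S: "finite S" and s0: "s0 \<in> S"
begin

lemma root_starts_props:
  assumes "p \<in> root_starts c S s0 l"
  shows "length p = Suc l \<and> p ! 0 = s0 \<and> set p \<subseteq> S \<and> card (orbs c p) = Suc l * m \<and>
    (\<forall>i j. i < j \<longrightarrow> j \<le> l \<longrightarrow> p ! j \<notin> orb c (p ! i))"
  using assms
proof (induction l arbitrary: p)
  case 0
  then show ?case using s0 card_orb[OF c m s0] by (auto simp: orbs_def)
next
  case (Suc l)
  then obtain p' q where p: "p = p' @ [q]" "p' \<in> root_starts c S s0 l" "q \<in> S - orbs c p'" by auto
  from Suc.IH[OF p(2)] have IH: "length p' = Suc l" "p' ! 0 = s0" "set p' \<subseteq> S"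
    "card (orbs c p') = Suc l * m" and IH': "\<And>i j. i < j \<Longrightarrow> j \<le> l \<Longrightarrow> p' ! j \<notin> orb c (p' ! i)"
    by blast+
  have "orbs c p = orbs c p' \<union> orb c q" by (auto simp: p(1) orbs_def)
  moreover have "orbs c p' \<inter> orb c q = {}"
  proof (rule equals0I)
    fix x assume "x \<in> orbs c p' \<inter> orb c q"
    then obtain a where a: "a \<in> set p'" "x \<in> orb c a" "x \<in> orb c q" by (auto simp: orbs_def)
    then have "q \<in> orb c a" using orb_trans orb_sym[OF c m a(3)] by fast
    then have "q \<in> orbs c p'" unfolding orbs_def using a(1) by blast
    then show False using p(3) by blast
  qed
  moreover have "finite (orbs c p')" by (auto simp: orbs_def finite_orb[OF c m])
  ultimately have "card (orbs c p) = Suc (Suc l) * m"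
    using IH card_orb[OF c m, of q] p(3) by (simp add: card_Un_disjoint finite_orb[OF c m])
  moreover have "p ! j \<notin> orb c (p ! i)" if ij: "i < j" "j \<le> Suc l" for i j
  proof (cases "j = Suc l")
    case True
    have "p' ! i \<in> set p'" using IH ij by auto
    then have "q \<notin> orb c (p' ! i)" using p(3) by (auto simp: orbs_def)
    then show ?thesis using True ij IH(1) by (simp add: p(1) nth_append)
  next
    case False
    then show ?thesis using IH(1) IH'[of i j] ij by (simp add: p(1) nth_append)
  qed
  ultimately show ?case using IH p(3) by (auto simp: p(1) nth_append)
qed

lemma orbs_subset: "set p \<subseteq> S \<Longrightarrow> orbs c p \<subseteq> S"
  using orb_subset[OF c m] by (auto simp: orbs_def)

lemma finite_root_starts: "finite (root_starts c S s0 l)"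
  by (induction l) (use S in auto)

text \<open>The next point must avoid the cycles of \<open>c\<close> used so far. These cover the
  same number of points whatever the earlier choices were, so the choices multiply.\<close>

lemma card_root_starts: "card (root_starts c S s0 l) = (\<Prod>j\<in>{1..l}. card S - j * m)"
proof (induction l)
  case (Suc l)
  have "card (root_starts c S s0 (Suc l)) =
      (\<Sum>p\<in>root_starts c S s0 l. card ((\<lambda>q. p @ [q]) ` (S - orbs c p)))"
    unfolding root_starts.simps
    by (rule card_UN_disjoint) (use finite_root_starts S in auto)
  also have "\<dots> = (\<Sum>p\<in>root_starts c S s0 l. card S - Suc l * m)"
  proof (rule sum.cong)
    fix p assume "p \<in> root_starts c S s0 l"
    from root_starts_props[OF this] show "card ((\<lambda>q. p @ [q]) ` (S - orbs c p)) = card S - Suc l * m"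
      using orbs_subset[of p] S finite_subset[of "orbs c p" S]
      by (subst card_image) (auto simp: inj_on_def card_Diff_subset)
  qed simp
  finally show ?case using Suc by (simp add: mult.commute)
qed simp

context
  fixes r :: nat and p :: "'p list"
  assumes r: "r > 0" and p: "p \<in> root_starts c S s0 (r - 1)"
begin

lemma p_props: "length p = r" "p ! 0 = s0" "set p \<subseteq> S"
  "\<And>i j. i < j \<Longrightarrow> j < r \<Longrightarrow> p ! j \<notin> orb c (p ! i)"
  using root_starts_props[OF p] r by auto

text \<open>The cycle of the root interleaves \<open>r\<close> cycles of \<open>c\<close>: position
  \<open>k\<close> lies \<open>k div r\<close> steps of \<open>c\<close> beyond the starting point
  with index \<open>k mod r\<close>.\<close>

definition cyc :: "nat \<Rightarrow> 'p" where
  "cyc k = (c ^^ (k div r)) (p ! (k mod r))"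

lemma cyc_eq_iff: "cyc k = cyc l \<longleftrightarrow> k mod (r * m) = l mod (r * m)"
proof
  assume eq: "cyc k = cyc l"
  have in_orb: "p ! (k mod r) \<in> orb c (p ! (l mod r))" if "cyc k = cyc l" for k l
  proof -
    have "cyc k \<in> orb c (p ! (l mod r))" using that unfolding cyc_def orb_def by auto
    moreover have "p ! (k mod r) \<in> orb c (cyc k)"
      by (rule orb_sym[OF c m]) (auto simp: cyc_def orb_def)
    ultimately show ?thesis using orb_trans by fast
  qed
  have mod: "k mod r = l mod r"
  proof (rule ccontr)
    assume "k mod r \<noteq> l mod r"
    then consider "k mod r < l mod r" | "l mod r < k mod r" by linarith
    then show False using p_props(4) in_orb[OF eq] in_orb[OF eq[symmetric]] r by cases auto
  qed
  have "p ! (k mod r) \<in> S" using p_props(1,3) r by (auto simp: subset_iff)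
  then have "(k div r) mod m = (l div r) mod m"
    using eq mod semireg_funpow_eq_iff[OF c] by (simp add: cyc_def)
  then show "k mod (r * m) = l mod (r * m)" using mod by (simp add: mod_mult2_eq)
next
  assume eq: "k mod (r * m) = l mod (r * m)"
  have k: "k mod (r * m) mod r = k mod r" "(k mod (r * m)) div r = k div r mod m" for k
    using r by (simp_all add: mod_mult2_eq mod_mod_cancel)
  have "k mod r = l mod r" "k div r mod m = l div r mod m"
    using k[of k] k[of l] eq by simp_all
  then show "cyc k = cyc l"
    unfolding cyc_def using semireg_funpow_mod[OF c] by metis
qed

lemma cyc_range: "range cyc = orbs c p"
proof (intro equalityI subsetI)
  fix a assume "a \<in> range cyc"
  then obtain k where "a = cyc k" by blast
  moreover have "p ! (k mod r) \<in> set p" using p_props(1) r by simp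
  ultimately show "a \<in> orbs c p" by (auto simp: orbs_def orb_def cyc_def)
next
  fix a assume "a \<in> orbs c p"
  then obtain i q where "q \<in> set p" "a = (c ^^ i) q" by (auto simp: orbs_def orb_def)
  then obtain j where "j < r" "a = (c ^^ i) (p ! j)"
    using p_props(1) by (metis in_set_conv_nth)
  then have "a = cyc (i * r + j)" by (simp add: cyc_def)
  then show "a \<in> range cyc" by blast
qed

definition cyc_perm :: "'p \<Rightarrow> 'p" where
  "cyc_perm s = (if s \<in> orbs c p then cyc (Suc (SOME k. s = cyc k)) else s)"

lemma cyc_perm_cyc: "cyc_perm (cyc k) = cyc (Suc k)"
proof -
  have "cyc k = cyc (SOME l. cyc k = cyc l)" by (rule someI[of _ k]) simp
  then have "(Suc k) mod (r * m) = Suc (SOME l. cyc k = cyc l) mod (r * m)"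
    unfolding cyc_eq_iff by (metis mod_Suc_eq)
  moreover have "cyc k \<in> orbs c p" using cyc_range by blast
  ultimately show ?thesis unfolding cyc_perm_def using cyc_eq_iff by auto
qed

lemma cyc_perm_iter: "(cyc_perm ^^ i) (cyc k) = cyc (k + i)"
  by (induction i) (simp_all add: cyc_perm_cyc)

lemma cyc_perm_semireg: "semireg (r * m) (orbs c p) cyc_perm"
proof (rule semiregI)
  fix s i assume "s \<in> orbs c p"
  then obtain k where k: "s = cyc k" using cyc_range by blast
  have "(k + i) mod (r * m) = k mod (r * m) \<longleftrightarrow> r * m dvd i"
    using mod_eq_dvd_iff_nat[of k "k + i" "r * m"] by simp
  then show "(cyc_perm ^^ i) s = s \<longleftrightarrow> r * m dvd i" unfolding k cyc_perm_iter cyc_eq_iff .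
qed (use r m in \<open>auto simp: cyc_perm_def\<close>)

lemma cyc_step: "cyc (k + r) = c (cyc k)"
  using r by (simp add: cyc_def)

lemma c_orbs: "s \<in> orbs c p \<Longrightarrow> c s \<in> orbs c p"
  using orb_closed[of s c _ 1] by (auto simp: orbs_def)

text \<open>The equation \<open>Y ^^ r = c\<close> together with the start forces \<open>Y\<close>
  to be \<open>cyc_perm\<close> on the cycle of \<open>s0\<close>. On the complement
  \<open>Y\<close> is an arbitrary root of the restriction of \<open>c\<close>.\<close>

lemma card_roots_fibre:
  "card {Y \<in> roots r m c S. map (\<lambda>j. (Y ^^ j) s0) [0..<r] = p} =
    card (roots r m (restr c (S - orbs c p)) (S - orbs c p))"
proof -
  define T where "T = orbs c p"
  define U where "U = S - T"
  have rm: "r * m > 0" using r m by simp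
  have TS: "T \<subseteq> S" unfolding T_def by (rule orbs_subset) (rule p_props)
  let ?A = "{Y \<in> roots r m c S. map (\<lambda>j. (Y ^^ j) s0) [0..<r] = p}"
  let ?B = "roots r m (restr c U) U"
  have on_T: "Y s = cyc_perm s \<and> Y s \<in> T" if Y: "Y \<in> ?A" and s: "s \<in> T" for Y s
  proof -
    have "(Y ^^ k) s0 = cyc k" for k
    proof -
      have "(Y ^^ (k mod r)) s0 = p ! (k mod r)"
      proof -
        have "map (\<lambda>j. (Y ^^ j) s0) [0..<r] ! (k mod r) = p ! (k mod r)" using Y by simp
        then show ?thesis using r by simp
      qed
      moreover have "Y ^^ (k div r * r) = c ^^ (k div r)"
        using Y by (simp add: roots_def mult.commute funpow_mult[symmetric])
      moreover have "(Y ^^ k) s0 = (Y ^^ (k div r * r)) ((Y ^^ (k mod r)) s0)"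
        by (metis comp_apply div_mult_mod_eq funpow_add)
      ultimately show ?thesis by (simp add: cyc_def)
    qed
    note Yk = this
    obtain k where k: "s = cyc k" using s cyc_range unfolding T_def by blast
    have "Y s = cyc (Suc k)" unfolding k using Yk[of k] Yk[of "Suc k"] by simp
    then show ?thesis using cyc_perm_cyc k cyc_range by (auto simp: T_def)
  qed
  have "bij_betw (\<lambda>Y. restr Y U) ?A ?B"
  proof (rule bij_betw_byWitness[where f' = "join T cyc_perm"])
    show "\<forall>Y\<in>?A. join T cyc_perm (restr Y U) = Y"
    proof
      fix Y assume Y: "Y \<in> ?A"
      then have "Y permutes S" by (auto simp: roots_def semireg_def)
      then show "join T cyc_perm (restr Y U) = Y"
        using on_T[OF Y] TS by (auto simp: fun_eq_iff join_def restr_def U_def permutes_not_in)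
    qed
    show "\<forall>Z\<in>?B. restr (join T cyc_perm Z) U = Z"
    proof
      fix Z assume "Z \<in> ?B"
      then have "Z permutes U" by (auto simp: roots_def semireg_def)
      then show "restr (join T cyc_perm Z) U = Z"
        by (auto simp: fun_eq_iff join_def restr_def U_def permutes_not_in)
    qed
    show "(\<lambda>Y. restr Y U) ` ?A \<subseteq> ?B"
    proof safe
      fix Y assume Y: "Y \<in> roots r m c S" "p = map (\<lambda>j. (Y ^^ j) s0) [0..<r]"
      then have YA: "Y \<in> ?A" by auto
      have sr: "semireg (r * m) S Y" and Yr: "Y ^^ r = c" using Y by (auto simp: roots_def)
      have "\<And>s. s \<in> T \<Longrightarrow> Y s \<in> T" using on_T[OF YA] by blast
      then have YU: "Y s \<in> U" if "s \<in> U" for s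
        using semireg_closed_compl[OF sr rm, of T] that unfolding U_def by blast
      have "(restr Y U ^^ r) s = restr c U s" for s
      proof (cases "s \<in> U")
        case True
        then show ?thesis
          using funpow_cong_closed[of U Y "restr Y U" s r] YU Yr by (auto simp: restr_def)
      next
        case False
        then have "(restr Y U ^^ i) s = s" for i by (induction i) (auto simp: restr_def)
        then show ?thesis using False by (simp add: restr_def)
      qed
      then show "restr Y U \<in> ?B"
        using semireg_restr[OF sr rm, of U] YU by (auto simp: roots_def U_def fun_eq_iff)
    qed
    show "join T cyc_perm ` ?B \<subseteq> ?A"
    proof safe
      fix Z assume Z: "Z \<in> ?B"
      let ?Y = "join T cyc_perm Z"
      have srZ: "semireg (r * m) U Z" and Zr: "Z ^^ r = restr c U" using Z by (auto simp: roots_def)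
      have "semireg (r * m) (T \<union> U) ?Y"
        using cyc_perm_semireg srZ rm by (intro semireg_join) (auto simp: T_def U_def)
      then have srY: "semireg (r * m) S ?Y" using TS by (simp add: U_def Un_absorb1)
      have iterT: "(?Y ^^ i) (cyc k) = cyc (k + i)" for i k
      proof (induction i)
        case (Suc i)
        have "cyc (k + i) \<in> T" using cyc_range by (auto simp: T_def)
        then show ?case using Suc cyc_perm_cyc by (simp add: join_def)
      qed simp
      have "(?Y ^^ r) s = c s" for s
      proof -
        consider "s \<in> T" | "s \<in> U" | "s \<notin> S" by (auto simp: U_def)
        then show ?thesis
        proof cases
          case 1
          then obtain k where "s = cyc k" using cyc_range by (auto simp: T_def)
          then show ?thesis using iterT cyc_step by simp
        next
          case 2
          have ZU: "Z u \<in> U" if "u \<in> U" for u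
            using srZ that by (simp add: semireg_def permutes_in_image)
          have "u \<notin> T" if "u \<in> U" for u using that by (simp add: U_def)
          then have "(?Y ^^ r) s = (Z ^^ r) s"
            using funpow_cong_closed[of U Z ?Y s r] ZU 2 by (simp add: join_def)
          then show ?thesis using Zr 2 by (simp add: restr_def)
        next
          case 3
          then show ?thesis
            using srY c funpow_outside[of ?Y S s r] by (auto simp: semireg_def permutes_not_in)
        qed
      qed
      then show "?Y \<in> roots r m c S" using srY by (auto simp: roots_def)
      have "(?Y ^^ j) s0 = p ! j" if "j < r" for j
      proof -
        have "s0 = cyc 0" using p_props(2) r by (simp add: cyc_def)
        then show ?thesis using iterT[of j 0] that by (simp add: cyc_def)
      qed
      then show "map (\<lambda>j. (?Y ^^ j) s0) [0..<r] = p"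
        using p_props(1) by (intro nth_equalityI) auto
    qed
  qed
  then show ?thesis unfolding U_def T_def by (rule bij_betw_same_card)
qed

end

lemma root_start_mem:
  assumes Y: "Y \<in> roots r m c S" and "l < r"
  shows "map (\<lambda>j. (Y ^^ j) s0) [0..<Suc l] \<in> root_starts c S s0 l"
  using assms(2)
proof (induction l)
  case (Suc l)
  have sr: "semireg (r * m) S Y" and Yr: "Y ^^ r = c" using Y by (auto simp: roots_def)
  let ?p = "map (\<lambda>j. (Y ^^ j) s0) [0..<Suc l]"
  have "(Y ^^ Suc l) s0 \<in> S" using sr s0 by (simp add: semireg_def funpow_permutes_in del: funpow.simps)
  moreover have "(Y ^^ Suc l) s0 \<notin> orbs c ?p"
  proof
    assume "(Y ^^ Suc l) s0 \<in> orbs c ?p"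
    then obtain i j where j: "j < Suc l" and eq: "(Y ^^ Suc l) s0 = (c ^^ i) ((Y ^^ j) s0)"
      by (auto simp: orbs_def orb_def simp del: funpow.simps upt_Suc)
    \<comment> \<open>As \<open>c\<close> is \<open>Y ^^ r\<close>, a coincidence would give
      \<open>Suc l\<close> and \<open>j\<close> the same residue modulo \<open>r\<close>, which is
      impossible for \<open>j < Suc l < r\<close>.\<close>
    have "(c ^^ i) ((Y ^^ j) s0) = (Y ^^ (r * i + j)) s0"
      unfolding Yr[symmetric] by (simp add: funpow_add funpow_mult)
    then have "Suc l mod (r * m) = (r * i + j) mod (r * m)"
      using eq semireg_funpow_eq_iff[OF sr s0] by metis
    then have "Suc l mod (r * m) mod r = (r * i + j) mod (r * m) mod r" by simp
    then have "Suc l mod r = j mod r" by (simp add: mod_mod_cancel)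
    then show False using j Suc.prems by simp
  qed
  moreover have "map (\<lambda>j. (Y ^^ j) s0) [0..<Suc (Suc l)] = ?p @ [(Y ^^ Suc l) s0]" by simp
  ultimately show ?case using Suc by (auto simp del: upt_Suc funpow.simps)
qed simp

end

text \<open>The factor with index \<open>i\<close> belongs to the stage at which
  \<open>r * m * i\<close> points remain: after \<open>j\<close> points of a start are placed,
  \<open>j * m\<close> points are excluded for the next one. The cycles of \<open>c\<close> all have
  length \<open>m\<close>, so nothing else about \<open>c\<close> matters.\<close>

definition root_number :: "nat \<Rightarrow> nat \<Rightarrow> nat \<Rightarrow> nat" where
  "root_number r m k = (\<Prod>i\<in>{1..k}. \<Prod>j\<in>{1..r - 1}. r * m * i - j * m)"

lemma card_roots:
  assumes "finite S" "semireg m S c" "m > 0" "r > 0" "card S = r * m * k"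
  shows "card (roots r m c S) = root_number r m k"
  using assms
proof (induction k arbitrary: S c)
  case 0
  then have S: "S = {}" by simp
  have "roots r m c S = {id}"
    using 0 by (auto simp: roots_def semireg_def S permutes_empty)
  then show ?case by (simp add: root_number_def)
next
  case (Suc k)
  note c = Suc.prems(2,3)
  have "S \<noteq> {}" using Suc.prems by auto
  then obtain s0 where s0: "s0 \<in> S" by blast
  note ctx = c Suc.prems(1) s0
  let ?P = "root_starts c S s0 (r - 1)"
  let ?F = "\<lambda>p. {Y \<in> roots r m c S. map (\<lambda>j. (Y ^^ j) s0) [0..<r] = p}"
  have "roots r m c S = (\<Union>p\<in>?P. ?F p)"
    using root_start_mem[OF ctx, of _ r "r - 1"] Suc.prems(4) by auto
  then have "card (roots r m c S) = card (\<Union>p\<in>?P. ?F p)" by (rule arg_cong)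
  also have "\<dots> = (\<Sum>p\<in>?P. card (?F p))"
    by (rule card_UN_disjoint) (use finite_root_starts[OF ctx] finite_roots[OF Suc.prems(1)] in auto)
  also have "\<dots> = (\<Sum>p\<in>?P. root_number r m k)"
  proof (rule sum.cong)
    fix p assume p: "p \<in> ?P"
    have pS: "set p \<subseteq> S" and cp: "card (orbs c p) = r * m"
      using root_starts_props[OF ctx p] Suc.prems(4) by auto
    have sub: "orbs c p \<subseteq> S" by (rule orbs_subset[OF ctx pS])
    have "card (S - orbs c p) = r * m * k"
      using cp Suc.prems(1,5) sub finite_subset[OF sub] by (simp add: card_Diff_subset algebra_simps)
    moreover have "semireg m (S - orbs c p) (restr c (S - orbs c p))"
      using semireg_closed_compl[OF c, of "orbs c p"] c_orbs[OF ctx Suc.prems(4) p]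
      by (intro semireg_restr[OF c]) blast+
    ultimately have "card (roots r m (restr c (S - orbs c p)) (S - orbs c p)) = root_number r m k"
      using Suc.prems by (intro Suc.IH) auto
    then show "card (?F p) = root_number r m k"
      using card_roots_fibre[OF ctx Suc.prems(4) p] by simp
  qed simp
  also have "\<dots> = root_number r m (Suc k)"
    using card_root_starts[OF ctx] Suc.prems(5) by (simp add: root_number_def mult.commute)
  finally show ?case .
qed

section \<open>Counting free subgroups by permutation pairs\<close>

text \<open>Forward steps alone give the orbit of \<open>s0\<close> for the pairs considered later,
  because those permutations have finite order.\<close>

definition reach :: "'p \<Rightarrow> ('p \<Rightarrow> 'p) \<Rightarrow> ('p \<Rightarrow> 'p) \<Rightarrow> 'p set" where
  "reach s0 X Y = {s. (s0, s) \<in> {(a, b). b = X a \<or> b = Y a}\<^sup>*}"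

lemma reach_start: "s0 \<in> reach s0 X Y"
  by (simp add: reach_def)

lemma reach_step: "s \<in> reach s0 X Y \<Longrightarrow> X s \<in> reach s0 X Y \<and> Y s \<in> reach s0 X Y"
  by (auto simp: reach_def intro: rtrancl_into_rtrancl)

lemma reach_least:
  assumes "s0 \<in> V" "\<And>s. s \<in> V \<Longrightarrow> X s \<in> V \<and> Y s \<in> V"
  shows "reach s0 X Y \<subseteq> V"
proof
  fix s assume "s \<in> reach s0 X Y"
  then have "(s0, s) \<in> {(a, b). b = X a \<or> b = Y a}\<^sup>*" by (simp add: reach_def)
  then show "s \<in> V" by (induction rule: rtrancl_induct) (use assms in auto)
qed

lemma reach_cong:
  assumes "s0 \<in> T" "\<And>s. s \<in> T \<Longrightarrow> X s = X' s \<and> Y s = Y' s \<and> X s \<in> T \<and> Y s \<in> T"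
  shows "reach s0 X Y = reach s0 X' Y'"
proof
  have "reach s0 X Y \<subseteq> reach s0 X' Y' \<inter> T"
  proof (rule reach_least)
    fix s assume "s \<in> reach s0 X' Y' \<inter> T"
    then show "X s \<in> reach s0 X' Y' \<inter> T \<and> Y s \<in> reach s0 X' Y' \<inter> T"
      using assms(2)[of s] reach_step[of s s0 X' Y'] by (metis Int_iff)
  qed (use assms(1) reach_start in auto)
  then show "reach s0 X Y \<subseteq> reach s0 X' Y'" by blast
  have "reach s0 X' Y' \<subseteq> reach s0 X Y \<inter> T"
  proof (rule reach_least)
    fix s assume "s \<in> reach s0 X Y \<inter> T"
    then show "X' s \<in> reach s0 X Y \<inter> T \<and> Y' s \<in> reach s0 X Y \<inter> T"
      using assms(2)[of s] reach_step[of s s0 X Y] by (metis Int_iff)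
  qed (use assms(1) reach_start in auto)
  then show "reach s0 X' Y' \<subseteq> reach s0 X Y" by blast
qed

section \<open>Splitting off the component of a point\<close>

definition good_pairs :: "nat \<Rightarrow> 'p set \<Rightarrow> (('p \<Rightarrow> 'p) \<times> ('p \<Rightarrow> 'p)) set" where
  "good_pairs m S = {(X, Y). good m S X Y}"

definition trans_pairs :: "nat \<Rightarrow> 'p set \<Rightarrow> 'p \<Rightarrow> (('p \<Rightarrow> 'p) \<times> ('p \<Rightarrow> 'p)) set" where
  "trans_pairs m S s0 = {(X, Y). good m S X Y \<and> reach s0 X Y = S}"

definition free_subgroups :: "nat \<Rightarrow> nat \<Rightarrow> gen gword set set set" where
  "free_subgroups m n = {H. subgroup H (Gamma3 m) \<and> free_group (Gamma3 m \<lparr>carrier := H\<rparr>) \<and>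
     card (cosets3 m H) = n}"

lemma finite_good_pairs: "finite S \<Longrightarrow> finite (good_pairs m S)"
  by (rule finite_subset[of _ "{p. p permutes S} \<times> {p. p permutes S}"])
    (auto simp: good_pairs_def good_def semireg_def finite_permutations)

lemma trans_pairs_subset: "trans_pairs m S s0 \<subseteq> good_pairs m S"
  by (auto simp: trans_pairs_def good_pairs_def)

lemma good_permutes: "good m S X Y \<Longrightarrow> X permutes S \<and> Y permutes S"
  by (simp add: good_def semireg_def)

lemma good_closed: "good m S X Y \<Longrightarrow> s \<in> S \<Longrightarrow> X s \<in> S \<and> Y s \<in> S"
  using good_permutes permutes_in_image by metis

lemma good_relation: "good m S X Y \<Longrightarrow> X (X s) = Y (Y (Y s))"
  by (simp add: good_def fun_eq_iff numeral_2_eq_2 numeral_3_eq_3)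

lemma goodI:
  assumes "semireg (2 * m) S X" "semireg (3 * m) S Y" "\<And>s. X (X s) = Y (Y (Y s))"
  shows "good m S X Y"
  using assms by (simp add: good_def fun_eq_iff numeral_2_eq_2 numeral_3_eq_3)

lemma good_restr:
  assumes "m \<ge> 1" "good m S X Y" "T \<subseteq> S" "\<And>s. s \<in> T \<Longrightarrow> X s \<in> T \<and> Y s \<in> T"
  shows "good m T (restr X T) (restr Y T)"
  using assms good_relation[OF assms(2)]
  by (intro goodI semireg_restr[of _ S]) (auto simp: good_def restr_def)

lemma good_join:
  assumes "m \<ge> 1" "good m T X Y" "good m U X' Y'" "T \<inter> U = {}"
  shows "good m (T \<union> U) (join T X X') (join T Y Y')"
proof (intro goodI semireg_join)
  fix s
  have U: "X' s \<notin> T" "Y' s \<notin> T" if "s \<notin> T" for s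
    using good_closed[OF assms(3)] good_permutes[OF assms(3)] assms(4) that
    by (metis disjoint_iff permutes_not_in)+
  show "join T X X' (join T X X' s) = join T Y Y' (join T Y Y' (join T Y Y' s))"
    using good_relation[OF assms(2)] good_relation[OF assms(3)] good_closed[OF assms(2)] U
    by (simp add: join_def)
qed (use assms in \<open>auto simp: good_def\<close>)

lemma reach_subset: "good m S X Y \<Longrightarrow> s0 \<in> S \<Longrightarrow> reach s0 X Y \<subseteq> S"
  using good_closed by (intro reach_least) fast+

text \<open>The component \<open>T\<close> of \<open>s0\<close> is closed under both permutations,
  and by semiregularity so is its complement. A pair thus splits into a transitive one on
  \<open>T\<close> and an arbitrary one on the rest.\<close>

lemma card_good_pairs_fibre:
  assumes m: "m \<ge> 1" and T: "s0 \<in> T" "T \<subseteq> S"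
  shows "card {p \<in> good_pairs m S. reach s0 (fst p) (snd p) = T} =
    card (trans_pairs m T s0) * card (good_pairs m (S - T))"
proof -
  define U where "U = S - T"
  let ?A = "{p \<in> good_pairs m S. reach s0 (fst p) (snd p) = T}"
  let ?B = "trans_pairs m T s0 \<times> good_pairs m U"
  let ?f = "\<lambda>(X, Y). ((restr X T, restr Y T), (restr X U, restr Y U))"
  let ?g = "\<lambda>((X, Y), (X', Y')). (join T X X', join T Y Y')"
  have TU: "T \<union> U = S" "T \<inter> U = {}" using T by (auto simp: U_def)
  have "bij_betw ?f ?A ?B"
  proof (rule bij_betw_byWitness[where f' = ?g])
    show "\<forall>p\<in>?A. ?g (?f p) = p"
    proof
      fix p assume p: "p \<in> ?A"
      obtain X Y where XY: "p = (X, Y)" by force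
      then have "X permutes S" "Y permutes S" using p good_permutes by (auto simp: good_pairs_def)
      then show "?g (?f p) = p"
        by (auto simp: XY fun_eq_iff join_def restr_def U_def permutes_not_in)
    qed
    show "\<forall>q\<in>?B. ?f (?g q) = q"
    proof
      fix q assume q: "q \<in> ?B"
      obtain X Y X' Y' where XY: "q = ((X, Y), (X', Y'))" by (metis surj_pair)
      then have "X permutes T" "Y permutes T" "X' permutes U" "Y' permutes U"
        using q good_permutes by (auto simp: good_pairs_def trans_pairs_def)
      then show "?f (?g q) = q"
        using TU by (auto simp: XY fun_eq_iff join_def restr_def U_def permutes_not_in)
    qed
    show "?f ` ?A \<subseteq> ?B"
    proof
      fix q assume "q \<in> ?f ` ?A"
      then obtain X Y where q: "q = ?f (X, Y)" and XY: "good m S X Y" "reach s0 X Y = T"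
        by (auto simp: good_pairs_def)
      have Tcl: "X s \<in> T \<and> Y s \<in> T" if "s \<in> T" for s
        using that XY(2) reach_step[of s s0 X Y] by simp
      have srX: "semireg (2 * m) S X" and srY: "semireg (3 * m) S Y" using XY(1) by (auto simp: good_def)
      have Ucl: "X s \<in> U \<and> Y s \<in> U" if "s \<in> U" for s
        using semireg_closed_compl[OF srX, of T s] semireg_closed_compl[OF srY, of T s] Tcl m that
        unfolding U_def by simp
      have "good m T (restr X T) (restr Y T)" using good_restr[OF m XY(1) T(2)] Tcl by blast
      moreover have "good m U (restr X U) (restr Y U)"
        using good_restr[OF m XY(1), of U] Ucl unfolding U_def by blast
      moreover have "reach s0 (restr X T) (restr Y T) = T"
        using reach_cong[of s0 T X "restr X T" Y "restr Y T"] T(1) Tcl XY(2) by (simp add: restr_def)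
      ultimately show "q \<in> ?B" by (simp add: q trans_pairs_def good_pairs_def)
    qed
    show "?g ` ?B \<subseteq> ?A"
    proof
      fix p assume "p \<in> ?g ` ?B"
      then obtain X Y X' Y' where p: "p = (join T X X', join T Y Y')" and
        XY: "good m T X Y" "reach s0 X Y = T" and XY': "good m U X' Y'"
        by (auto simp: trans_pairs_def good_pairs_def)
      have "good m S (join T X X') (join T Y Y')" using good_join[OF m XY(1) XY' TU(2)] TU(1) by simp
      moreover have "reach s0 (join T X X') (join T Y Y') = T"
        using reach_cong[of s0 T X "join T X X'" Y "join T Y Y'"] T(1) good_closed[OF XY(1)] XY(2)
        by (simp add: join_def)
      ultimately show "p \<in> ?A" by (simp add: p good_pairs_def)
    qed
  qed
  then have "card ?A = card ?B" by (rule bij_betw_same_card)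
  then show ?thesis by (simp add: U_def card_cartesian_product)
qed

lemma card_good_pairs_decompose:
  assumes m: "m \<ge> 1" and S: "finite S" and s0: "s0 \<in> S"
  shows "card (good_pairs m S) =
    (\<Sum>T\<in>{T. s0 \<in> T \<and> T \<subseteq> S}. card (trans_pairs m T s0) * card (good_pairs m (S - T)))"
proof -
  let ?I = "{T. s0 \<in> T \<and> T \<subseteq> S}"
  let ?F = "\<lambda>T. {p \<in> good_pairs m S. reach s0 (fst p) (snd p) = T}"
  have "good_pairs m S = (\<Union>T\<in>?I. ?F T)"
    using reach_subset s0 reach_start by (fastforce simp: good_pairs_def)
  then have "card (good_pairs m S) = card (\<Union>T\<in>?I. ?F T)" by (rule arg_cong)
  also have "\<dots> = (\<Sum>T\<in>?I. card (?F T))"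
    by (rule card_UN_disjoint) (use S finite_good_pairs[OF S] in auto)
  also have "\<dots> = (\<Sum>T\<in>?I. card (trans_pairs m T s0) * card (good_pairs m (S - T)))"
    by (rule sum.cong) (use card_good_pairs_fibre[OF m] in auto)
  finally show ?thesis .
qed

lemma good_card_dvd:
  assumes "m \<ge> 1" "finite S" "good m S X Y"
  shows "6 * m dvd card S"
proof -
  have "2 * m dvd card S" "3 * m dvd card S"
    using assms semireg_dvd_card[of S "2 * m" X] semireg_dvd_card[of S "3 * m" Y]
    by (auto simp: good_def)
  then obtain k l where "card S = 2 * m * k" "card S = 3 * m * l" by (elim dvdE)
  then have k: "card S = m * (2 * k)" and "card S = m * (3 * l)" by (simp_all add: mult_ac)
  then have "m * (2 * k) = m * (3 * l)" by metis
  then have "2 * k = 3 * l" using assms(1) by simp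
  then have "6 dvd 2 * k" by presburger
  then show ?thesis using k by (metis mult.commute mult_dvd_mono dvd_refl)
qed

text \<open>\<open>Y\<close> is chosen first. Its cube has all cycles of length \<open>m\<close>, so
  the number of square roots \<open>X\<close> does not depend on the choice.\<close>

lemma card_good_pairs:
  assumes m: "m \<ge> 1" and S: "finite S" "card S = 6 * m * l"
  shows "card (good_pairs m S) = root_number (3 * m) 1 (2 * l) * root_number 2 m (3 * l)"
proof -
  have Y_roots: "Y \<in> roots (3 * m) 1 id S \<longleftrightarrow> semireg (3 * m) S Y" for Y
    by (auto simp: roots_def semireg_funpow_id)
  have X_roots: "X \<in> roots 2 m c S \<longleftrightarrow> semireg (2 * m) S X \<and> X ^^ 2 = c" for X c
    by (auto simp: roots_def)
  have cube: "semireg m S (Y ^^ 3)" if "semireg (3 * m) S Y" for Y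
  proof (rule semiregI)
    fix s i assume "s \<in> S"
    then have "((Y ^^ 3) ^^ i) s = s \<longleftrightarrow> 3 * m dvd 3 * i"
      using that by (simp add: funpow_mult semireg_def)
    then show "((Y ^^ 3) ^^ i) s = s \<longleftrightarrow> m dvd i" by simp
  qed (use m that funpow_outside in \<open>auto simp: semireg_def\<close>)
  have "good_pairs m S = (\<lambda>(Y, X). (X, Y)) ` (SIGMA Y:roots (3 * m) 1 id S. roots 2 m (Y ^^ 3) S)"
    unfolding good_pairs_def good_def by (auto simp: Y_roots[simplified] X_roots image_iff)
  also have "card \<dots> = card (SIGMA Y:roots (3 * m) 1 id S. roots 2 m (Y ^^ 3) S)"
    by (rule card_image) (auto simp: inj_on_def)
  also have "\<dots> = (\<Sum>Y\<in>roots (3 * m) 1 id S. card (roots 2 m (Y ^^ 3) S))"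
    using finite_roots[OF S(1)] by (intro card_SigmaI) auto
  also have "\<dots> = (\<Sum>Y\<in>roots (3 * m) 1 id S. root_number 2 m (3 * l))"
    by (rule sum.cong) (use m S cube Y_roots[simplified] in \<open>auto intro!: card_roots\<close>)
  also have "card (roots (3 * m) 1 id S) = root_number (3 * m) 1 (2 * l)"
  proof (rule card_roots)
    show "semireg 1 S id" by (rule semiregI) auto
  qed (use m S in auto)
  then have "(\<Sum>Y\<in>roots (3 * m) 1 id S. root_number 2 m (3 * l)) =
      root_number (3 * m) 1 (2 * l) * root_number 2 m (3 * l)" by simp
  finally show ?thesis .
qed

section \<open>Transitive pairs and point stabilizers\<close>

definition stabilizer3 :: "nat \<Rightarrow> ('p \<Rightarrow> 'p) \<Rightarrow> ('p \<Rightarrow> 'p) \<Rightarrow> 'p \<Rightarrow> gen gword set set" where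
  "stabilizer3 m X Y s0 = {g \<in> carrier (Gamma3 m). Gamma3_act X Y g s0 = s0}"

text \<open>An isomorphism of pointed actions from the cosets of \<open>H\<close> to
  \<open>S\<close>.\<close>

definition coset_iso :: "nat \<Rightarrow> gen gword set set \<Rightarrow> 'p set \<Rightarrow> 'p \<Rightarrow> ('p \<Rightarrow> 'p) \<Rightarrow> ('p \<Rightarrow> 'p) \<Rightarrow>
    (gen gword set set \<Rightarrow> 'p) \<Rightarrow> bool" where
  "coset_iso m H S s0 X Y e \<longleftrightarrow> bij_betw e (cosets3 m H) S \<and> e H = s0 \<and>
     (\<forall>C\<in>cosets3 m H. e (coset_perm m H (gx m) C) = X (e C) \<and> e (coset_perm m H (gy m) C) = Y (e C))"

lemma semireg_transport:
  assumes e: "bij_betw e A B" and f: "f permutes A"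
    and out: "\<And>b. b \<notin> B \<Longrightarrow> f' b = b" and eq: "\<And>a. a \<in> A \<Longrightarrow> e (f a) = f' (e a)" and r: "r > 0"
  shows "semireg r B f' \<longleftrightarrow> semireg r A f"
proof -
  have iter: "(f' ^^ i) (e a) = e ((f ^^ i) a)" if "a \<in> A" for a i
    by (induction i) (use that f eq in \<open>auto simp: funpow_permutes_in\<close>)
  have "(f' ^^ i) (e a) = e a \<longleftrightarrow> (f ^^ i) a = a" if "a \<in> A" for a i
    using iter[OF that] bij_betw_imp_inj_on[OF e] that f
    by (metis funpow_permutes_in inj_on_eq_iff)
  then have *: "(\<forall>b\<in>B. \<forall>i. (f' ^^ i) b = b \<longleftrightarrow> r dvd i) \<longleftrightarrow> (\<forall>a\<in>A. \<forall>i. (f ^^ i) a = a \<longleftrightarrow> r dvd i)"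
    using bij_betw_imp_surj_on[OF e] by auto
  show ?thesis
  proof
    assume "semireg r B f'"
    then show "semireg r A f" using * f by (simp add: semireg_def)
  next
    assume "semireg r A f"
    then have "\<forall>b\<in>B. \<forall>i. (f' ^^ i) b = b \<longleftrightarrow> r dvd i" using * by (simp add: semireg_def)
    then show "semireg r B f'" using r out by (intro semiregI) auto
  qed
qed

context
  fixes m :: nat
  assumes m: "m \<ge> 1"
begin

lemma coset_iso_good:
  assumes H: "subgroup H (Gamma3 m)" and iso: "coset_iso m H S s0 X Y e"
    and out: "\<And>s. s \<notin> S \<Longrightarrow> X s = s \<and> Y s = s"
  shows "good m S X Y \<longleftrightarrow> good m (cosets3 m H) (coset_perm m H (gx m)) (coset_perm m H (gy m))"
proof -
  let ?x = "coset_perm m H (gx m)" and ?y = "coset_perm m H (gy m)"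
  have e: "bij_betw e (cosets3 m H) S" and eq: "\<And>C. C \<in> cosets3 m H \<Longrightarrow> e (?x C) = X (e C)"
    "\<And>C. C \<in> cosets3 m H \<Longrightarrow> e (?y C) = Y (e C)"
    using iso by (auto simp: coset_iso_def)
  have perm: "?x permutes cosets3 m H" "?y permutes cosets3 m H"
    using coset_perm_permutes[OF m H] by auto
  have rel: "?x ^^ 2 = ?y ^^ 3"
    using coset_perms_Gamma3_perms[OF m H] by (simp add: Gamma3_perms_def)
  have "X (X s) = Y (Y (Y s))" for s
  proof (cases "s \<in> S")
    case True
    then obtain C where C: "C \<in> cosets3 m H" "s = e C" using bij_betw_imp_surj_on[OF e] by blast
    have "e (?x (?x C)) = e (?y (?y (?y C)))"
      using rel by (simp add: fun_eq_iff numeral_2_eq_2 numeral_3_eq_3)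
    then show ?thesis using C eq perm by (simp add: permutes_in_image)
  next
    case False
    then show ?thesis using out by simp
  qed
  then have "X ^^ 2 = Y ^^ 3" by (simp add: fun_eq_iff numeral_2_eq_2 numeral_3_eq_3)
  moreover have "semireg (2 * m) S X \<longleftrightarrow> semireg (2 * m) (cosets3 m H) ?x"
    "semireg (3 * m) S Y \<longleftrightarrow> semireg (3 * m) (cosets3 m H) ?y"
    using semireg_transport[OF e perm(1)] semireg_transport[OF e perm(2)] out eq m by simp_all
  ultimately show ?thesis using rel by (simp add: good_def)
qed

lemma coset_iso_act:
  assumes H: "subgroup H (Gamma3 m)" and iso: "coset_iso m H S s0 X Y e"
    and XY: "Gamma3_perms m X Y" and g: "g \<in> carrier (Gamma3 m)"
  shows "e (H #>\<^bsub>Gamma3 m\<^esub> g) = Gamma3_act X Y g s0"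
  using m g
proof (induction rule: Gamma3_induct)
  case one
  then show ?case
    using iso Gamma3.coset_mult_one[OF subgroup.subset[OF H]]
    by (simp add: Gamma3_act_one[OF m XY] coset_iso_def)
next
  case (x g)
  have "H #>\<^bsub>Gamma3 m\<^esub> g \<in> cosets3 m H" using x(1) cosets3_altdef[OF m H] by blast
  then have "e (coset_perm m H (gx m) (H #>\<^bsub>Gamma3 m\<^esub> g)) = X (e (H #>\<^bsub>Gamma3 m\<^esub> g))"
    using iso by (simp add: coset_iso_def)
  then show ?case
    using x by (simp add: coset_perm_coset[OF m H] Gamma3_act_mult[OF m XY] Gamma3_act_gens[OF m XY])
next
  case (y g)
  have "H #>\<^bsub>Gamma3 m\<^esub> g \<in> cosets3 m H" using y(1) cosets3_altdef[OF m H] by blast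
  then have "e (coset_perm m H (gy m) (H #>\<^bsub>Gamma3 m\<^esub> g)) = Y (e (H #>\<^bsub>Gamma3 m\<^esub> g))"
    using iso by (simp add: coset_iso_def)
  then show ?case
    using y by (simp add: coset_perm_coset[OF m H] Gamma3_act_mult[OF m XY] Gamma3_act_gens[OF m XY])
qed

lemma coset_iso_reach:
  assumes H: "subgroup H (Gamma3 m)" and iso: "coset_iso m H S s0 X Y e"
    and XY: "Gamma3_perms m X Y"
  shows "reach s0 X Y = S" "stabilizer3 m X Y s0 = H"
proof -
  have e: "bij_betw e (cosets3 m H) S" "e H = s0" using iso by (auto simp: coset_iso_def)
  have HC: "H \<in> cosets3 m H" by (rule H_in_cosets3[OF m H])
  have perm: "coset_perm m H (gx m) permutes cosets3 m H" "coset_perm m H (gy m) permutes cosets3 m H"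
    using coset_perm_permutes[OF m H] by auto
  have "Gamma3_act X Y g s0 \<in> reach s0 X Y" if "g \<in> carrier (Gamma3 m)" for g
    using m that
    by (induction rule: Gamma3_induct)
      (simp_all add: Gamma3_act_one[OF m XY] Gamma3_act_mult[OF m XY] Gamma3_act_gens[OF m XY]
        reach_start reach_step)
  then have "e C \<in> reach s0 X Y" if "C \<in> cosets3 m H" for C
    using that coset_iso_act[OF H iso XY] cosets3_altdef[OF m H] by auto
  then have "S \<subseteq> reach s0 X Y" using bij_betw_imp_surj_on[OF e(1)] by blast
  moreover have "reach s0 X Y \<subseteq> S"
  proof (rule reach_least)
    show "s0 \<in> S" using e HC bij_betw_apply by metis
    fix s assume "s \<in> S"
    then obtain C where C: "C \<in> cosets3 m H" "s = e C" using bij_betw_imp_surj_on[OF e(1)] by blast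
    then have "X s = e (coset_perm m H (gx m) C)" "Y s = e (coset_perm m H (gy m) C)"
      using iso by (auto simp: coset_iso_def)
    then show "X s \<in> S \<and> Y s \<in> S" using C perm e(1) bij_betw_apply permutes_in_image by metis
  qed
  ultimately show "reach s0 X Y = S" by blast
  have "g \<in> H \<longleftrightarrow> Gamma3_act X Y g s0 = s0" if g: "g \<in> carrier (Gamma3 m)" for g
  proof -
    have "Gamma3_act X Y g s0 = s0 \<longleftrightarrow> e (H #>\<^bsub>Gamma3 m\<^esub> g) = e H"
      using coset_iso_act[OF H iso XY g] e(2) by simp
    also have "\<dots> \<longleftrightarrow> H #>\<^bsub>Gamma3 m\<^esub> g = H"
      using bij_betw_imp_inj_on[OF e(1)] HC g cosets3_altdef[OF m H] by (auto dest: inj_onD)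
    also have "\<dots> \<longleftrightarrow> g \<in> H" using Gamma3.coset_join1[OF _ g H] Gamma3.coset_join2[OF g H] by blast
    finally show ?thesis by blast
  qed
  then show "stabilizer3 m X Y s0 = H"
    using subgroup.subset[OF H] by (auto simp: stabilizer3_def)
qed

lemma stabilizer3_subgroup:
  assumes XY: "Gamma3_perms m X Y"
  shows "subgroup (stabilizer3 m X Y s0) (Gamma3 m)"
proof (rule Gamma3.subgroupI)
  show "stabilizer3 m X Y s0 \<noteq> {}"
    by (auto simp: stabilizer3_def intro!: exI[of _ "\<one>\<^bsub>Gamma3 m\<^esub>"] simp: Gamma3_act_one[OF m XY])
  fix g assume g: "g \<in> stabilizer3 m X Y s0"
  then show "inv\<^bsub>Gamma3 m\<^esub> g \<in> stabilizer3 m X Y s0"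
    using Gamma3_act_inv(1)[OF m XY, of g s0] by (auto simp: stabilizer3_def)
  fix h assume "h \<in> stabilizer3 m X Y s0"
  then show "g \<otimes>\<^bsub>Gamma3 m\<^esub> h \<in> stabilizer3 m X Y s0"
    using g by (auto simp: stabilizer3_def Gamma3_act_mult[OF m XY])
qed (auto simp: stabilizer3_def)

text \<open>The equivariant orbit-stabilizer correspondence, sending the coset of \<open>g\<close>
  to the image of \<open>s0\<close> under \<open>g\<close>.\<close>

lemma ex_coset_iso:
  assumes XY: "Gamma3_perms m X Y" and tr: "reach s0 X Y = S"
  shows "\<exists>e. coset_iso m (stabilizer3 m X Y s0) S s0 X Y e"
proof -
  define H where "H = stabilizer3 m X Y s0"
  have H: "subgroup H (Gamma3 m)" unfolding H_def by (rule stabilizer3_subgroup[OF XY])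
  let ?a = "\<lambda>g. Gamma3_act X Y g s0"
  have inj: "?a g = ?a h \<longleftrightarrow> H #>\<^bsub>Gamma3 m\<^esub> g = H #>\<^bsub>Gamma3 m\<^esub> h"
    if gh: "g \<in> carrier (Gamma3 m)" "h \<in> carrier (Gamma3 m)" for g h
  proof -
    have "?a g = ?a h \<longleftrightarrow> ?a (g \<otimes>\<^bsub>Gamma3 m\<^esub> inv\<^bsub>Gamma3 m\<^esub> h) = s0"
      using gh Gamma3_act_inv[OF m XY, of h] by (simp add: Gamma3_act_mult[OF m XY]) metis
    also have "\<dots> \<longleftrightarrow> g \<otimes>\<^bsub>Gamma3 m\<^esub> inv\<^bsub>Gamma3 m\<^esub> h \<in> H" using gh by (simp add: H_def stabilizer3_def)
    also have "\<dots> \<longleftrightarrow> H #>\<^bsub>Gamma3 m\<^esub> (g \<otimes>\<^bsub>Gamma3 m\<^esub> inv\<^bsub>Gamma3 m\<^esub> h) = H"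
      using gh Gamma3.coset_join1[OF _ _ H] Gamma3.coset_join2[OF _ H]
      by (metis Gamma3.inv_closed Gamma3.m_closed)
    also have "\<dots> \<longleftrightarrow> H #>\<^bsub>Gamma3 m\<^esub> g = H #>\<^bsub>Gamma3 m\<^esub> h"
      using gh subgroup.subset[OF H] Gamma3.coset_mult_inv1 Gamma3.coset_mult_inv2 by metis
    finally show ?thesis .
  qed
  define e where "e C = ?a (SOME g. g \<in> carrier (Gamma3 m) \<and> C = H #>\<^bsub>Gamma3 m\<^esub> g)" for C
  have e: "e (H #>\<^bsub>Gamma3 m\<^esub> g) = ?a g" if g: "g \<in> carrier (Gamma3 m)" for g
  proof -
    let ?P = "\<lambda>h. h \<in> carrier (Gamma3 m) \<and> H #>\<^bsub>Gamma3 m\<^esub> g = H #>\<^bsub>Gamma3 m\<^esub> h"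
    define h where "h = (SOME h. ?P h)"
    have "?P h" unfolding h_def by (rule someI[of ?P g]) (use g in simp)
    then have "?a h = ?a g" using inj[of h g] g by simp
    then show ?thesis unfolding e_def h_def .
  qed
  have cos: "cosets3 m H = (\<lambda>g. H #>\<^bsub>Gamma3 m\<^esub> g) ` carrier (Gamma3 m)" by (rule cosets3_altdef[OF m H])
  have "S \<subseteq> ?a ` carrier (Gamma3 m)"
    unfolding tr[symmetric]
  proof (rule reach_least)
    show "s0 \<in> ?a ` carrier (Gamma3 m)"
      by (rule image_eqI[of _ _ "\<one>\<^bsub>Gamma3 m\<^esub>"]) (simp_all add: Gamma3_act_one[OF m XY])
    fix s assume "s \<in> ?a ` carrier (Gamma3 m)"
    then obtain g where g: "g \<in> carrier (Gamma3 m)" "s = ?a g" by blast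
    then have "X s = ?a (g \<otimes>\<^bsub>Gamma3 m\<^esub> gx m)" "Y s = ?a (g \<otimes>\<^bsub>Gamma3 m\<^esub> gy m)"
      by (simp_all add: Gamma3_act_mult[OF m XY] Gamma3_act_gens[OF m XY])
    then show "X s \<in> ?a ` carrier (Gamma3 m) \<and> Y s \<in> ?a ` carrier (Gamma3 m)" using g by simp
  qed
  moreover have "?a g \<in> S" if "g \<in> carrier (Gamma3 m)" for g
    using m that unfolding tr[symmetric]
    by (induction rule: Gamma3_induct)
      (simp_all add: Gamma3_act_one[OF m XY] Gamma3_act_mult[OF m XY] Gamma3_act_gens[OF m XY]
        reach_start reach_step)
  ultimately have "e ` cosets3 m H = S" unfolding cos image_image using e by auto
  moreover have "inj_on e (cosets3 m H)"
    unfolding cos by (rule inj_onI) (use e inj in auto)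
  moreover have "e H = s0"
    using e[of "\<one>\<^bsub>Gamma3 m\<^esub>"] Gamma3.coset_mult_one[OF subgroup.subset[OF H]]
    by (simp add: Gamma3_act_one[OF m XY])
  moreover have "e (coset_perm m H (gx m) C) = X (e C) \<and> e (coset_perm m H (gy m) C) = Y (e C)"
    if "C \<in> cosets3 m H" for C
    using that unfolding cos
    by (auto simp: coset_perm_coset[OF m H] e Gamma3_act_mult[OF m XY] Gamma3_act_gens[OF m XY])
  ultimately have "coset_iso m H S s0 X Y e" by (simp add: coset_iso_def bij_betw_def)
  then show ?thesis unfolding H_def by blast
qed

definition transport :: "gen gword set set \<Rightarrow> 'p set \<Rightarrow> (gen gword set set \<Rightarrow> 'p) \<Rightarrow> gen gword set \<Rightarrow> 'p \<Rightarrow> 'p" where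
  "transport H S e a s = (if s \<in> S then e (coset_perm m H a (inv_into (cosets3 m H) e s)) else s)"

lemma coset_iso_transport:
  assumes "bij_betw e (cosets3 m H) S" "e H = s0"
  shows "coset_iso m H S s0 (transport H S e (gx m)) (transport H S e (gy m)) e"
  using assms bij_betw_apply[OF assms(1)]
  by (auto simp: coset_iso_def transport_def bij_betw_inv_into_left)

lemma coset_iso_unique:
  assumes "coset_iso m H S s0 X Y e" "\<And>s. s \<notin> S \<Longrightarrow> X s = s \<and> Y s = s"
  shows "X = transport H S e (gx m)" "Y = transport H S e (gy m)"
  using assms
  by (auto simp: coset_iso_def transport_def fun_eq_iff bij_betw_inv_into_right inv_into_into bij_betw_def)

text \<open>Such pairs correspond to labellings of the cosets of \<open>H\<close> by
  \<open>S\<close> in which \<open>H\<close> receives the label \<open>s0\<close>. Different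
  labellings give different pairs, since an isomorphism of transitive actions is determined by the
  image of one point.\<close>

lemma card_trans_pairs_stabilizer:
  assumes S: "finite S" "s0 \<in> S" and Hf: "H \<in> free_subgroups m (card S)"
  shows "card {p \<in> trans_pairs m S s0. stabilizer3 m (fst p) (snd p) s0 = H} = fact (card S - 1)"
proof -
  have H: "subgroup H (Gamma3 m)" and free: "free_group (Gamma3 m \<lparr>carrier := H\<rparr>)"
    and cardH: "card (cosets3 m H) = card S" using Hf by (auto simp: free_subgroups_def)
  have goodH: "good m (cosets3 m H) (coset_perm m H (gx m)) (coset_perm m H (gy m))"
    by (rule free_imp_good[OF m H free])
  have HC: "H \<in> cosets3 m H" by (rule H_in_cosets3[OF m H])
  have "card S > 0" using S card_gt_0_iff by blast
  then have finC: "finite (cosets3 m H)" using cardH by (metis card_gt_0_iff)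
  have "card (cosets3 m H - {H}) = card (S - {s0})" using cardH HC S finC by simp
  then obtain b where b: "bij_betw b (cosets3 m H - {H}) (S - {s0})"
    using finC S(1) by (metis finite_Diff finite_same_card_bij)
  \<comment> \<open>A reference labelling; every other admissible one differs from it by a
    permutation of \<open>S - {s0}\<close>.\<close>
  define e0 where "e0 = b(H := s0)"
  have "bij_betw e0 (cosets3 m H - {H}) (S - {s0})"
    using b by (rule bij_betw_cong[THEN iffD1, rotated]) (simp add: e0_def)
  then have "bij_betw e0 (insert H (cosets3 m H - {H})) (insert (e0 H) (S - {s0}))"
    using notIn_Un_bij_betw3[of H "cosets3 m H - {H}" e0 "S - {s0}"] by (simp add: e0_def)
  then have e0: "bij_betw e0 (cosets3 m H) S" "e0 H = s0"
    using HC S(2) by (simp_all add: e0_def insert_absorb)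
  let ?Q = "{\<pi>. \<pi> permutes (S - {s0})}"
  let ?A = "{p \<in> trans_pairs m S s0. stabilizer3 m (fst p) (snd p) s0 = H}"
  let ?\<Theta> = "\<lambda>\<pi>. (transport H S (\<pi> \<circ> e0) (gx m), transport H S (\<pi> \<circ> e0) (gy m))"
  have pe0: "bij_betw (\<pi> \<circ> e0) (cosets3 m H) S" "(\<pi> \<circ> e0) H = s0" if "\<pi> \<in> ?Q" for \<pi>
  proof -
    have "\<pi> permutes S" using that permutes_subset[of \<pi> "S - {s0}" S] by auto
    then show "bij_betw (\<pi> \<circ> e0) (cosets3 m H) S"
      using e0(1) bij_betw_trans permutes_imp_bij by metis
    show "(\<pi> \<circ> e0) H = s0" using that e0(2) by (simp add: permutes_not_in)
  qed
  have iso: "coset_iso m H S s0 (fst (?\<Theta> \<pi>)) (snd (?\<Theta> \<pi>)) (\<pi> \<circ> e0)" if "\<pi> \<in> ?Q" for \<pi>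
    using coset_iso_transport[OF pe0[OF that]] by (simp only: fst_conv snd_conv)
  have out: "fst (?\<Theta> \<pi>) s = s \<and> snd (?\<Theta> \<pi>) s = s" if "s \<notin> S" for s \<pi>
    using that by (simp add: transport_def)
  have good: "good m S (fst (?\<Theta> \<pi>)) (snd (?\<Theta> \<pi>))" if "\<pi> \<in> ?Q" for \<pi>
    using coset_iso_good[OF H iso[OF that] out] goodH by blast
  have "bij_betw ?\<Theta> ?Q ?A"
  proof (rule bij_betw_imageI)
    show "inj_on ?\<Theta> ?Q"
    proof (rule inj_onI)
      fix \<pi> \<pi>' assume \<pi>: "\<pi> \<in> ?Q" "\<pi>' \<in> ?Q" and eq: "?\<Theta> \<pi> = ?\<Theta> \<pi>'"
      have "\<pi> s = \<pi>' s" for s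
      proof (cases "s \<in> S")
        case True
        then obtain g where g: "g \<in> carrier (Gamma3 m)" "s = e0 (H #>\<^bsub>Gamma3 m\<^esub> g)"
          using bij_betw_imp_surj_on[OF e0(1)] cosets3_altdef[OF m H] by auto
        have "(\<pi> \<circ> e0) (H #>\<^bsub>Gamma3 m\<^esub> g) = (\<pi>' \<circ> e0) (H #>\<^bsub>Gamma3 m\<^esub> g)"
          using coset_iso_act[OF H iso[OF \<pi>(1)] good_imp_Gamma3_perms[OF good[OF \<pi>(1)]] g(1)]
            coset_iso_act[OF H iso[OF \<pi>(2)] good_imp_Gamma3_perms[OF good[OF \<pi>(2)]] g(1)]
          unfolding eq by simp
        then show ?thesis using g by simp
      next
        case False
        then show ?thesis using \<pi> by (simp add: permutes_not_in)
      qed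
      then show "\<pi> = \<pi>'" by blast
    qed
    show "?\<Theta> ` ?Q = ?A"
    proof (intro equalityI subsetI)
      fix p assume "p \<in> ?\<Theta> ` ?Q"
      then obtain \<pi> where \<pi>: "\<pi> \<in> ?Q" "p = ?\<Theta> \<pi>" by blast
      show "p \<in> ?A"
        using coset_iso_reach[OF H iso[OF \<pi>(1)] good_imp_Gamma3_perms[OF good[OF \<pi>(1)]]] good[OF \<pi>(1)]
        unfolding \<pi>(2) by (simp add: trans_pairs_def)
    next
      fix p assume p: "p \<in> ?A"
      obtain X Y where XY: "p = (X, Y)" by force
      have gXY: "good m S X Y" "reach s0 X Y = S" "stabilizer3 m X Y s0 = H"
        using p by (auto simp: XY trans_pairs_def)
      obtain e where e: "coset_iso m H S s0 X Y e"
        using ex_coset_iso[OF good_imp_Gamma3_perms[OF gXY(1)] gXY(2)] gXY(3) by blast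
      then have be: "bij_betw e (cosets3 m H) S" "e H = s0" by (auto simp: coset_iso_def)
      \<comment> \<open>The change of labelling from \<open>e0\<close> to \<open>e\<close>,
        continued by the identity.\<close>
      define \<pi> where "\<pi> s = (if s \<in> S then e (inv_into (cosets3 m H) e0 s) else s)" for s
      have "bij_betw (e \<circ> inv_into (cosets3 m H) e0) S S"
        using bij_betw_trans[OF bij_betw_inv_into[OF e0(1)] be(1)] .
      then have "bij_betw \<pi> S S"
        by (rule bij_betw_cong[THEN iffD1, rotated]) (simp add: \<pi>_def)
      then have "\<pi> permutes S" by (rule bij_imp_permutes) (simp add: \<pi>_def)
      moreover have "inv_into (cosets3 m H) e0 s0 = H"
        using bij_betw_inv_into_left[OF e0(1) HC] e0(2) by simp
      then have "\<pi> s0 = s0" using S(2) be(2) by (simp add: \<pi>_def)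
      ultimately have \<pi>: "\<pi> \<in> ?Q"
        using permutes_superset[of \<pi> S "S - {s0}"] by auto
      have "(\<pi> \<circ> e0) C = e C" if "C \<in> cosets3 m H" for C
        using that e0(1) bij_betw_apply[OF e0(1)] by (simp add: \<pi>_def bij_betw_inv_into_left)
      then have "coset_iso m H S s0 X Y (\<pi> \<circ> e0)"
        using e pe0[OF \<pi>] coset_perm_permutes[OF m H] unfolding coset_iso_def
        by (simp add: permutes_in_image)
      moreover have "X s = s \<and> Y s = s" if "s \<notin> S" for s
        using good_permutes[OF gXY(1)] that by (auto simp: permutes_not_in)
      ultimately have "X = fst (?\<Theta> \<pi>)" "Y = snd (?\<Theta> \<pi>)"
        using coset_iso_unique[of H S s0 X Y "\<pi> \<circ> e0"] by simp_all
      then have "p = ?\<Theta> \<pi>" unfolding XY by (simp only: fst_conv snd_conv)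
      then show "p \<in> ?\<Theta> ` ?Q" using \<pi> by blast
    qed
  qed
  then have "card ?Q = card ?A" by (rule bij_betw_same_card)
  moreover have "card ?Q = fact (card (S - {s0}))"
    by (rule card_permutations[OF refl]) (use S(1) in simp)
  ultimately show ?thesis using S by simp
qed

lemma stabilizer3_free:
  assumes "(X, Y) \<in> trans_pairs m S s0" and S: "finite S" "s0 \<in> S"
  shows "stabilizer3 m X Y s0 \<in> free_subgroups m (card S)"
proof -
  have XY: "good m S X Y" "reach s0 X Y = S" using assms(1) by (auto simp: trans_pairs_def)
  define H where "H = stabilizer3 m X Y s0"
  note perms = good_imp_Gamma3_perms[OF XY(1)]
  have H: "subgroup H (Gamma3 m)" unfolding H_def by (rule stabilizer3_subgroup[OF perms])
  obtain e where e: "coset_iso m H S s0 X Y e"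
    using ex_coset_iso[OF perms XY(2)] unfolding H_def by blast
  have be: "bij_betw e (cosets3 m H) S" using e by (simp add: coset_iso_def)
  have "X s = s \<and> Y s = s" if "s \<notin> S" for s
    using good_permutes[OF XY(1)] that by (auto simp: permutes_not_in)
  then have "good m (cosets3 m H) (coset_perm m H (gx m)) (coset_perm m H (gy m))"
    using coset_iso_good[OF H e] XY(1) by blast
  moreover have "finite (cosets3 m H)" using be S(1) bij_betw_finite by metis
  ultimately have free: "free_group (Gamma3 m \<lparr>carrier := H\<rparr>)"
    using m H by (intro good_cosets.free good_cosets.intro)
  have "card (cosets3 m H) = card S" using be by (rule bij_betw_same_card)
  then show ?thesis using free H unfolding H_def by (simp add: free_subgroups_def)
qed

lemma card_trans_pairs:
  assumes S: "finite S" "s0 \<in> S"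
  shows "card (trans_pairs m S s0) = fact (card S - 1) * card (free_subgroups m (card S))"
proof -
  let ?FS = "free_subgroups m (card S)"
  let ?F = "\<lambda>H. {p \<in> trans_pairs m S s0. stabilizer3 m (fst p) (snd p) s0 = H}"
  have fin: "finite (trans_pairs m S s0)"
    using finite_subset[OF trans_pairs_subset finite_good_pairs[OF S(1)]] .
  \<comment> \<open>Finiteness of the set of subgroups must be secured, as \<open>card\<close> gives
    0 on infinite sets. Each \<open>H\<close> is the stabilizer of some pair because its fibre has a
    factorial, hence positive, number of elements.\<close>
  have "H \<in> (\<lambda>p. stabilizer3 m (fst p) (snd p) s0) ` trans_pairs m S s0" if "H \<in> ?FS" for H
  proof -
    have "?F H \<noteq> {}" using card_trans_pairs_stabilizer[OF S that] by (metis card.empty fact_nonzero)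
    then show ?thesis by blast
  qed
  then have finFS: "finite ?FS" using fin by (meson finite_surj subsetI)
  have "trans_pairs m S s0 = (\<Union>H\<in>?FS. ?F H)" using stabilizer3_free[OF _ S] by auto
  then have "card (trans_pairs m S s0) = card (\<Union>H\<in>?FS. ?F H)" by (rule arg_cong)
  also have "\<dots> = (\<Sum>H\<in>?FS. card (?F H))" by (rule card_UN_disjoint) (use fin finFS in auto)
  also have "\<dots> = (\<Sum>H\<in>?FS. fact (card S - 1))"
    by (rule sum.cong) (use card_trans_pairs_stabilizer[OF S] in auto)
  finally show ?thesis by simp
qed

end

section \<open>The Riccati equation\<close>

text \<open>Removing \<open>s0\<close> turns the sets of size \<open>d * k\<close> into arbitrary
  subsets of \<open>S - {s0}\<close> of size \<open>d * k - 1\<close>; this is where the shifted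
  binomial comes from.\<close>

lemma sum_supersets_by_card:
  fixes S :: "'p set" and g :: "'p set \<Rightarrow> nat" and c :: "nat \<Rightarrow> nat"
  assumes S: "finite S" "s0 \<in> S" "card S = d * l" and d: "d > 0"
    and zero: "\<And>T. s0 \<in> T \<Longrightarrow> T \<subseteq> S \<Longrightarrow> \<not> d dvd card T \<Longrightarrow> g T = 0"
    and val: "\<And>T k. s0 \<in> T \<Longrightarrow> T \<subseteq> S \<Longrightarrow> card T = d * k \<Longrightarrow> g T = c k"
  shows "(\<Sum>T\<in>{T. s0 \<in> T \<and> T \<subseteq> S}. g T) = (\<Sum>k\<in>{1..l}. ((d * l - 1) choose (d * k - 1)) * c k)"
proof -
  let ?I = "{T. s0 \<in> T \<and> T \<subseteq> S}"
  let ?J = "{T \<in> ?I. d dvd card T}"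
  have fin: "finite ?I" using S(1) by simp
  have T_fin: "finite T" "card T > 0" "card T \<le> card S" if "T \<in> ?I" for T
    using that S(1) finite_subset[of T S] card_mono[of S T] by (auto simp: card_gt_0_iff)
  have "(\<Sum>T\<in>?I. g T) = (\<Sum>T\<in>?J. g T)"
    by (rule sum.mono_neutral_right) (use fin zero in auto)
  also have "\<dots> = (\<Sum>k\<in>{1..l}. \<Sum>T\<in>{T \<in> ?J. card T div d = k}. g T)"
  proof (rule sum.group[symmetric])
    show "(\<lambda>T. card T div d) ` ?J \<subseteq> {1..l}"
    proof safe
      fix T assume T: "s0 \<in> T" "T \<subseteq> S" "d dvd card T"
      then obtain k where k: "card T = d * k" by (elim dvdE)
      then have "k \<ge> 1" "k \<le> l" using T_fin[of T] T S(3) d by (auto intro: Suc_leI gr0I)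
      then show "card T div d \<in> {1..l}" using k d by simp
    qed
    show "finite ?J" by (rule finite_subset[OF _ fin]) auto
  qed simp
  also have "\<dots> = (\<Sum>k\<in>{1..l}. ((d * l - 1) choose (d * k - 1)) * c k)"
  proof (rule sum.cong)
    fix k assume k: "k \<in> {1..l}"
    have eq: "{T \<in> ?J. card T div d = k} = insert s0 ` {B. B \<subseteq> S - {s0} \<and> card B = d * k - 1}"
    proof (intro equalityI subsetI)
      fix T assume "T \<in> {T \<in> ?J. card T div d = k}"
      then have "s0 \<in> T" "T \<subseteq> S" "d dvd card T" "card T div d = k" by auto
      then have T: "s0 \<in> T" "T \<subseteq> S" "card T = d * k" using dvd_mult_div_cancel[of d "card T"] by metis+
      then have "card (T - {s0}) = d * k - 1" using S(1) by (simp add: finite_subset)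
      then show "T \<in> insert s0 ` {B. B \<subseteq> S - {s0} \<and> card B = d * k - 1}"
        using T by (intro image_eqI[of _ _ "T - {s0}"]) auto
    next
      fix T assume "T \<in> insert s0 ` {B. B \<subseteq> S - {s0} \<and> card B = d * k - 1}"
      then obtain B where B: "T = insert s0 B" "B \<subseteq> S - {s0}" "card B = d * k - 1" by blast
      then have "finite B" "s0 \<notin> B" using S(1) finite_subset[of B S] by auto
      then have "card T = d * k" using B k d by simp
      then show "T \<in> {T \<in> ?J. card T div d = k}" using B S(2) d by auto
    qed
    have "card {T \<in> ?J. card T div d = k} = card {B. B \<subseteq> S - {s0} \<and> card B = d * k - 1}"
      unfolding eq by (rule card_image) (auto simp: inj_on_def)
    also have "\<dots> = (d * l - 1) choose (d * k - 1)"
      using S by (subst n_subsets) auto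
    finally have "card {T \<in> ?J. card T div d = k} = (d * l - 1) choose (d * k - 1)" .
    moreover have "(\<Sum>T\<in>{T \<in> ?J. card T div d = k}. g T) = (\<Sum>T\<in>{T \<in> ?J. card T div d = k}. c k)"
      by (rule sum.cong) (use val in auto)
    ultimately show "(\<Sum>T\<in>{T \<in> ?J. card T div d = k}. g T) = ((d * l - 1) choose (d * k - 1)) * c k"
      by simp
  qed simp
  finally show ?thesis .
qed

section \<open>Recurrences for the numbers of pairs\<close>

definition pair_number :: "nat \<Rightarrow> nat \<Rightarrow> nat" where
  "pair_number m l = root_number (3 * m) 1 (2 * l) * root_number 2 m (3 * l)"

lemma free_subgroup_number_altdef: "free_subgroup_number m l = card (free_subgroups m (6 * m * l))"
  by (simp add: free_subgroup_number_def free_subgroups_def)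

lemma pair_number_rec:
  assumes m: "m \<ge> 1" and l: "l \<ge> 1"
  shows "pair_number m l = (\<Sum>k\<in>{1..l}. ((6 * m * l - 1) choose (6 * m * k - 1)) *
    (fact (6 * m * k - 1) * free_subgroup_number m k * pair_number m (l - k)))"
proof -
  define S where "S = {..<6 * m * l}"
  have S: "finite S" "0 \<in> S" "card S = 6 * m * l" using m l by (auto simp: S_def)
  have "pair_number m l = card (good_pairs m S)"
    using card_good_pairs[OF m S(1,3)] by (simp add: pair_number_def)
  also have "\<dots> = (\<Sum>T\<in>{T. 0 \<in> T \<and> T \<subseteq> S}. card (trans_pairs m T 0) * card (good_pairs m (S - T)))"
    by (rule card_good_pairs_decompose[OF m S(1,2)])
  also have "\<dots> = (\<Sum>k\<in>{1..l}. ((6 * m * l - 1) choose (6 * m * k - 1)) *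
    (fact (6 * m * k - 1) * free_subgroup_number m k * pair_number m (l - k)))"
  proof (rule sum_supersets_by_card[OF S])
    fix T assume T: "0 \<in> T" "T \<subseteq> S" "\<not> 6 * m dvd card T"
    have "finite T" using T(2) S(1) finite_subset by blast
    then have "trans_pairs m T 0 = {}"
      using good_card_dvd[OF m] T(3) by (auto simp: trans_pairs_def)
    then show "card (trans_pairs m T 0) * card (good_pairs m (S - T)) = 0" by simp
  next
    fix T k assume T: "0 \<in> T" "T \<subseteq> S" "card T = 6 * m * k"
    have fT: "finite T" using T(2) S(1) finite_subset by blast
    have "card (S - T) = 6 * m * (l - k)"
      using T S fT by (simp add: card_Diff_subset diff_mult_distrib2)
    then have "card (good_pairs m (S - T)) = pair_number m (l - k)"
      using card_good_pairs[OF m, of "S - T"] S(1) by (simp add: pair_number_def)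
    then show "card (trans_pairs m T 0) * card (good_pairs m (S - T)) =
        fact (6 * m * k - 1) * free_subgroup_number m k * pair_number m (l - k)"
      using card_trans_pairs[OF m fT T(1)] T(3) by (simp add: free_subgroup_number_altdef)
  qed (use m in simp)
  finally show ?thesis .
qed

definition pair_coeff :: "nat \<Rightarrow> nat \<Rightarrow> real" where
  "pair_coeff m l = real (pair_number m l) / fact (6 * m * l)"

text \<open>The coefficientwise form of \<open>6 m z A' = G A\<close>. The factor
  \<open>fact (6 * m * k - 1)\<close> for labellings cancels against the binomial, so the subgroup
  numbers enter as an ordinary generating function.\<close>

lemma pair_coeff_convolution:
  assumes m: "m \<ge> 1" and l: "l \<ge> 1"
  shows "real (6 * m * l) * pair_coeff m l =
    (\<Sum>k\<in>{1..l}. real (free_subgroup_number m k) * pair_coeff m (l - k))"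
proof -
  let ?n = "6 * m * l"
  have n: "?n > 0" using m l by simp
  have "real ?n * pair_coeff m l = real (pair_number m l) / fact (?n - 1)"
    unfolding pair_coeff_def using n fact_reduce[OF n, where 'a = real] by (simp add: field_simps)
  also have "\<dots> = (\<Sum>k\<in>{1..l}. real (((?n - 1) choose (6 * m * k - 1)) *
    (fact (6 * m * k - 1) * free_subgroup_number m k * pair_number m (l - k))) / fact (?n - 1))"
    unfolding pair_number_rec[OF m l] of_nat_sum sum_divide_distrib ..
  also have "\<dots> = (\<Sum>k\<in>{1..l}. real (free_subgroup_number m k) * pair_coeff m (l - k))"
  proof (rule sum.cong)
    fix k assume k: "k \<in> {1..l}"
    then have "6 * m * k \<le> ?n" "6 * m * k > 0" using m by auto
    then have le: "6 * m * k - 1 \<le> ?n - 1" and eq: "?n - 1 - (6 * m * k - 1) = 6 * m * (l - k)"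
      by (simp_all only: diff_le_mono diff_mult_distrib2)
    have "real ((?n - 1) choose (6 * m * k - 1)) =
        fact (?n - 1) / (fact (6 * m * k - 1) * fact (6 * m * (l - k)))"
      using binomial_fact[OF le, where 'a = real] unfolding eq .
    note choose = this
    have aux: "a / (b * c) * (b * f * p) / a = f * (p / c)" if "a \<noteq> 0" "b \<noteq> 0" for a b c f p :: real
      using that by simp
    show "real (((?n - 1) choose (6 * m * k - 1)) *
        (fact (6 * m * k - 1) * free_subgroup_number m k * pair_number m (l - k))) / fact (?n - 1) =
      real (free_subgroup_number m k) * pair_coeff m (l - k)"
      unfolding of_nat_mult choose of_nat_fact pair_coeff_def by (rule aux) simp_all
  qed simp
  finally show ?thesis .
qed

lemma fact_falling:
  "j0 < N \<Longrightarrow> fact (N - 1) = (\<Prod>j\<in>{1..j0}. N - j) * (fact (N - 1 - j0) :: nat)"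
proof (induction j0)
  case (Suc j0)
  then have "fact (N - 1) = (\<Prod>j\<in>{1..j0}. N - j) * (fact (N - 1 - j0) :: nat)" by simp
  moreover have "(fact (N - 1 - j0) :: nat) = (N - Suc j0) * fact (N - 1 - Suc j0)"
    using fact_reduce[of "N - 1 - j0", where 'a = nat] Suc.prems by simp
  ultimately show ?case by simp
qed simp

text \<open>The number of permutations with \<open>k\<close> cycles of length \<open>r\<close> is (r
  k)! / (r^k k!), written here without division.\<close>

lemma root_number_one: "r > 0 \<Longrightarrow> root_number r 1 k * (\<Prod>i\<in>{1..k}. r * i) = fact (r * k)"
proof (induction k)
  case (Suc k)
  let ?N = "r * Suc k"
  have "fact ?N = ?N * (fact (?N - 1) :: nat)" using Suc.prems fact_reduce[of ?N, where 'a = nat] by simp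
  also have "(fact (?N - 1) :: nat) = (\<Prod>j\<in>{1..r - 1}. ?N - j) * fact (?N - 1 - (r - 1))"
    by (rule fact_falling) (use Suc.prems in \<open>simp add: less_Suc_eq_le\<close>)
  also have "?N - 1 - (r - 1) = r * k" using Suc.prems by simp
  also have "fact (r * k) = root_number r 1 k * (\<Prod>i\<in>{1..k}. r * i)" using Suc by simp
  finally show ?case by (simp add: root_number_def mult_ac)
qed (simp add: root_number_def)

lemma root_number_two: "root_number 2 m k = (\<Prod>i\<in>{1..k}. 2 * m * i - m)"
  by (simp add: root_number_def numeral_2_eq_2)

text \<open>The number of \<open>Y\<close> times the product of the \<open>3 * m * i\<close> is
  \<open>fact (6 * m * l)\<close>, so after division by this factorial only the number of square
  roots remains above that product.\<close>

lemma pair_coeff_product: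
  assumes m: "m \<ge> 1"
  shows "pair_coeff m l * (\<Prod>i\<in>{1..2 * l}. real (3 * m * i)) = (\<Prod>i\<in>{1..3 * l}. real (2 * m * i - m))"
proof -
  have root: "root_number (3 * m) 1 (2 * l) * (\<Prod>i\<in>{1..2 * l}. 3 * m * i) = fact (6 * m * l)"
    using root_number_one[of "3 * m" "2 * l"] m by (simp add: mult_ac)
  have comm: "a * r * p = a * p * r" for a r p :: nat by simp
  have "pair_number m l * (\<Prod>i\<in>{1..2 * l}. 3 * m * i) =
      fact (6 * m * l) * (\<Prod>i\<in>{1..3 * l}. 2 * m * i - m)"
    unfolding pair_number_def root[symmetric] root_number_two by (rule comm)
  from arg_cong[OF this, of real] have "real (pair_number m l) * (\<Prod>i\<in>{1..2 * l}. real (3 * m * i)) =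
      fact (6 * m * l) * (\<Prod>i\<in>{1..3 * l}. real (2 * m * i - m))"
    by (simp only: of_nat_mult[of "pair_number m l"] of_nat_mult[of "fact (6 * m * l)"]
        of_nat_prod of_nat_fact)
  then show ?thesis
    by (simp only: pair_coeff_def times_divide_eq_left nonzero_mult_div_cancel_left[OF fact_nonzero])
qed

text \<open>Passing from \<open>l\<close> to \<open>Suc l\<close> adds two factors to the product on
  the left of \<open>pair_coeff_product\<close> and three on the right. The factor
  \<open>6 l + 3\<close> cancels against \<open>3 (2 l + 1)\<close>, leaving a quotient that is
  quadratic over linear in \<open>l\<close>.\<close>

lemma pair_coeff_rec:
  assumes m: "m \<ge> 1"
  shows "6 * real (Suc l) * pair_coeff m (Suc l) =
    real m * (6 * real l + 1) * (6 * real l + 5) * pair_coeff m l"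
proof -
  define P where "P = (\<Prod>i\<in>{1..2 * l}. real (3 * m * i))"
  have P: "P \<noteq> 0" using m by (simp add: P_def)
  have p: "2 * Suc l = Suc (Suc (2 * l))" "3 * Suc l = Suc (Suc (Suc (3 * l)))" by simp_all
  have d: "real (2 * m * i - m) = real m * (2 * real i - 1)" if "i \<ge> 1" for i
  proof -
    have "m \<le> 2 * m * i" using that by simp
    then show ?thesis by (simp add: of_nat_diff algebra_simps)
  qed
  have P': "(\<Prod>i\<in>{1..2 * Suc l}. real (3 * m * i)) =
      P * real (3 * m * Suc (2 * l)) * real (3 * m * Suc (Suc (2 * l)))"
    unfolding p P_def by (subst prod.cl_ivl_Suc, subst prod.cl_ivl_Suc) (simp del: of_nat_mult)
  define Q where "Q = (\<Prod>i\<in>{1..3 * l}. real (2 * m * i - m))"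
  have Q': "(\<Prod>i\<in>{1..3 * Suc l}. real (2 * m * i - m)) = Q * real (2 * m * Suc (3 * l) - m) *
      real (2 * m * Suc (Suc (3 * l)) - m) * real (2 * m * Suc (Suc (Suc (3 * l))) - m)"
    unfolding p Q_def
    by (subst prod.cl_ivl_Suc, subst prod.cl_ivl_Suc, subst prod.cl_ivl_Suc) (simp del: of_nat_mult)
  have *: "real (3 * m * Suc (2 * l)) = 3 * real m * (2 * real l + 1)"
    "real (3 * m * Suc (Suc (2 * l))) = 3 * real m * (2 * real l + 2)"
    "real (2 * m * Suc (3 * l) - m) = real m * (6 * real l + 1)"
    "real (2 * m * Suc (Suc (3 * l)) - m) = real m * (6 * real l + 3)"
    "real (2 * m * Suc (Suc (Suc (3 * l))) - m) = real m * (6 * real l + 5)"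
    by (simp_all only: d) (simp_all add: algebra_simps)
  have Q: "Q = pair_coeff m l * P" using pair_coeff_product[OF m, of l] by (simp only: P_def Q_def)
  have "pair_coeff m (Suc l) * (P * (3 * real m * (2 * real l + 1)) * (3 * real m * (2 * real l + 2))) =
      pair_coeff m l * P * (real m * (6 * real l + 1)) * (real m * (6 * real l + 3)) *
        (real m * (6 * real l + 5))"
    using pair_coeff_product[OF m, of "Suc l"] unfolding P' Q' * Q .
  then have "(P * (3 * real m * real m * (2 * real l + 1))) * (6 * real (Suc l) * pair_coeff m (Suc l)) =
     (P * (3 * real m * real m * (2 * real l + 1))) *
      (real m * (6 * real l + 1) * (6 * real l + 5) * pair_coeff m l)"
    by (simp add: algebra_simps)
  moreover have "2 * real l + 1 \<noteq> 0" by linarith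
  ultimately show ?thesis using P m by (subst (asm) mult_cancel_left) auto
qed

text \<open>The exponential coefficients are quotients by factorials, so the differential equation
  is derived over the reals and pulled back along this injective ring embedding.\<close>

definition real_fps :: "int fps \<Rightarrow> real fps" where
  "real_fps F = Abs_fps (\<lambda>n. real_of_int (fps_nth F n))"

lemma real_fps_simps:
  "real_fps (F + G) = real_fps F + real_fps G"
  "real_fps (F * G) = real_fps F * real_fps G"
  "real_fps fps_X = fps_X"
  "real_fps (of_int c) = of_int c"
  "real_fps (fps_XD F) = fps_XD (real_fps F)"
  by (auto simp: real_fps_def fps_eq_iff fps_mult_nth fps_of_int[symmetric])

lemma real_fps_eq_iff: "real_fps F = real_fps G \<longleftrightarrow> F = G"
  by (simp add: real_fps_def fps_eq_iff)

text \<open>The exponential generating function \<open>A\<close> of all permutation pairs satisfies a linear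
  equation of order two, and \<open>G = 6 m z A' / A\<close>.\<close>

lemma F_series_riccati:
  assumes m: "m \<ge> 1"
  defines "G \<equiv> F_series m - 1"
  shows "G = fps_X * (of_int (6 * int m) * fps_XD G + G\<^sup>2 + of_int (6 * int m) * G + of_int (5 * (int m)\<^sup>2))"
proof -
  define A where "A = Abs_fps (pair_coeff m)"
  define g where "g = real_fps G"
  define M where "M = (of_nat m :: real fps)"
  have g_nth: "fps_nth g l = (if l = 0 then 0 else real (free_subgroup_number m l))" for l
    by (simp add: g_def real_fps_def G_def F_series_def)
  have M_nth: "fps_nth (M * F) l = real m * fps_nth F l" for F l
    by (simp add: M_def fps_of_nat[symmetric])
  have num: "fps_nth (numeral n * F) l = numeral n * fps_nth F l" for n and F :: "real fps" and l
    by (simp add: numeral_fps_const)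
  have E1: "g * A = 6 * (M * fps_XD A)"
  proof (rule fps_ext)
    fix l
    show "fps_nth (g * A) l = fps_nth (6 * (M * fps_XD A)) l"
    proof (cases "l = 0")
      case True
      then show ?thesis by (simp add: g_nth num M_nth)
    next
      case False
      have "fps_nth (g * A) l = (\<Sum>k\<in>{1..l}. real (free_subgroup_number m k) * pair_coeff m (l - k))"
        unfolding fps_mult_nth A_def
        by (rule sum.mono_neutral_cong_right) (auto simp: g_nth)
      also have "\<dots> = real (6 * m * l) * pair_coeff m l"
        using pair_coeff_convolution[OF m, of l] False by simp
      finally show ?thesis by (simp add: num M_nth A_def)
    qed
  qed
  \<comment> \<open>The recurrence for the coefficients, with (6k + 1)(6k + 5) expanded to 36k^2 +
    36k + 5.\<close>
  have E2: "6 * fps_XD A = M * (fps_X * (36 * fps_XD (fps_XD A) + 36 * fps_XD A + 5 * A))"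
  proof (rule fps_ext)
    fix l
    show "fps_nth (6 * fps_XD A) l =
      fps_nth (M * (fps_X * (36 * fps_XD (fps_XD A) + 36 * fps_XD A + 5 * A))) l"
    proof (cases l)
      case (Suc k)
      have "6 * (real (Suc k) * pair_coeff m (Suc k)) =
        real m * (36 * (real k * (real k * pair_coeff m k)) + 36 * (real k * pair_coeff m k) + 5 * pair_coeff m k)"
        using pair_coeff_rec[OF m, of k] by (simp add: algebra_simps)
      then show ?thesis by (simp only: Suc num M_nth fps_XD_nth fps_add_nth fps_X_mult_nth A_def fps_nth_Abs_fps) simp
    qed (simp add: num M_nth)
  qed
  have "fps_XD (6 * (M * F)) = 6 * (M * fps_XD F)" for F
    by (rule fps_ext) (simp only: num M_nth fps_XD_nth, simp only: mult_ac)
  with arg_cong[OF E1, of fps_XD] have E3: "fps_XD g * A + g * fps_XD A = 6 * (M * fps_XD (fps_XD A))"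
    by (simp only: fps_XD_mult)
  \<comment> \<open>Since \<open>g\<close> is a multiple of the logarithmic derivative of
    \<open>A\<close>, the derivatives of \<open>A\<close> can be eliminated; what is left of
    \<open>A\<close> is a common factor.\<close>
  have "g * A = fps_X * (6 * M * fps_XD g + g\<^sup>2 + 6 * M * g + 5 * M\<^sup>2) * A"
    using E1 E2 E3 by algebra
  \<comment> \<open>The constant term of \<open>A\<close> is 1, from empty products.\<close>
  moreover have "A \<noteq> 0"
    by (auto simp: fps_eq_iff A_def pair_coeff_def pair_number_def root_number_def intro!: exI[of _ 0])
  ultimately have "g = fps_X * (6 * M * fps_XD g + g\<^sup>2 + 6 * M * g + 5 * M\<^sup>2)" by simp
  then show ?thesis
    unfolding real_fps_eq_iff[symmetric, of G] power2_eq_square real_fps_simps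
    by (simp add: g_def M_def power2_eq_square)
qed

theorem theorem19:
  fixes \<alpha> m :: nat
  assumes "\<alpha> \<ge> 1" and "m \<ge> 1"
  shows "\<exists>a :: nat \<Rightarrow> int fls.
    (\<forall>i \<le> 2 ^ (\<alpha> + 2) - 1. laurent_polynomial (a i)) \<and>
    fls_cong (fps_to_fls (F_series m))
      (\<Sum>i = 0..2 ^ (\<alpha> + 2) - 1. a i * fps_to_fls Phi ^ i)
      (2 ^ (3 * 2 ^ \<alpha>))"
  using riccati_Phi_representation[OF F_series_riccati[OF assms(2)], of \<alpha>] by simp

end
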